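(* Consider problem (P), the stochastic oracle and Algorithm 3 described in the context. Let $\{(x_1^k,\dots,x_N^k,\lambda^k)\}_{k\ge 0}$ be a sequence generated by Algorithm 3, and suppose, with $\Delta=17\beta^2-16(L+1)\beta-128L^2$, $$\beta>\frac{8(L+1)+8\sqrt{(L+1)^2+34L^2}}{17},\qquad \gamma\in\left(\frac{16}{17\beta+\sqrt\Delta},\ \frac{16}{17\beta-\sqrt\Delta}\right),$$ and $H_i\succ\left(\frac{8L^2}{\beta}+L+1\right)I$ for $i=1,\dots,N-1$. Define $$\kappa_1:=\frac{4}{\beta^2}\left[\left(\beta-\tfrac1\gamma\right)^2+L^2\right],\quad \kappa_2:=3\left[\left(\beta-\tfrac1\gamma\right)^2+L^2\right],\quad \kappa_3:=2\left(L+\beta\sqrt N\max_{1\le i\le N}\|A_i\|_2^2+\max_{1\le i\le N-1}\|H_i\|_2\right)^2,$$ $$\tau:=\min\left\{-\left(\tfrac{\beta+L}{2}-\tfrac1\gamma+\tfrac8\beta\left[\beta-\tfrac1\gamma\right]^2+\tfrac{4L^2}{\beta}+\tfrac12\right),\ \min_{1\le i\le N-1}\left\{-\left(\tfrac{4L^2}{\beta}+\tfrac{L+1}2-\tfrac{\sigma_{\min}(H_i)}{2}\right)\right\}\right\},$$ $\kappa_4:=\frac2\tau\left(\frac8\beta+\frac N2\right)$, where $\sigma_{\min}$ denotes the smallest singular value. For $\epsilon>0$ let the batch size satisfy $$M\ge\frac{2\sigma^2}{\epsilon^2}\max\left\{\kappa_1\kappa_4+\tfrac{8}{\beta^2},\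 \kappa_2\kappa_4+3,\ \kappa_3\kappa_4+2\right\},$$ let $$K:=\left\lceil\frac{4\max\{\kappa_1,\kappa_2,\kappa_3\}}{\tau\epsilon^2}\left(\mathsf E[\Psi_S(x_1^1,\dots,x_N^1,\lambda^1,x_N^0)]-\sum_{i=1}^{N-1}r_i^*-f^*+\frac{2\sigma^2}{\beta}\right)\right\rceil,$$ and let $k^*:=\operatorname{argmin}_{2\le k\le K+1}\sum_{i=1}^N\left(\|x_i^k-x_i^{k+1}\|^2+\|x_i^{k-1}-x_i^k\|^2\right)$. Then $(x_1^{k^*+1},\dots,x_N^{k^*+1})$ with $\lambda^{k^*+1}$ is an $\epsilon$-stationary solution of (P) in expectation.
   Context: Problem (P): minimize $f(x_1,\dots,x_N)+\sum_{i=1}^{N-1}r_i(x_i)$ subject to $\sum_{i=1}^N A_ix_i=b$ with $A_N=I$, $x_N\in\mathbb R^{n_N}$, and $x_i\in\mathcal M_i\cap X_i$ for $i=1,\dots,N-1$. Here $A_i\in\mathbb R^{m\times n_i}$, $b\in\mathbb R^m$, $n_N=m$; $f:\mathbb R^{n_1}\times\cdots\times\mathbb R^{n_N}\to\mathbb R$ is smooth (possibly nonconvex) with $L$-Lipschitz gradient, $L>0$; $\nabla_i f$ is the partial gradient in block $x_i$; $r_i:\mathbb R^{n_i}\to\mathbb R$ is convex and locally Lipschitz (possibly nonsmooth), and $r_N\equiv0$; $\mathcal M_i$ is a Riemannian submanifold embedded in $\mathbb R^{n_i}$ (with the Euclidean inner product as metric); $X_i\subset\mathbb R^{n_i}$ is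 closed and convex. Assume the following are finite: $r_i^*=\min_{x_i\in\mathcal M_i\cap X_i}r_i(x_i)$ and $f^*=\min\{f(x): x_i\in\mathcal M_i\cap X_i\ (i\le N-1),\ x_N\in\mathbb R^{n_N}\}$. Stochastic oracle: for each $i=1,\dots,N$ there is $G_i(x,\xi_i)$ with $\mathsf E[G_i(x,\xi_i)]=\nabla_if(x)$ and $\mathsf E[\|G_i(x,\xi_i)-\nabla_if(x)\|^2]\le\sigma^2$ for every $x$. The mini-batch estimate is $G_i^M(x)=\frac1M\sum_{j=1}^M G_i(x,\xi_i^j)$ with $\xi_i^j$ i.i.d.; fresh samples, independent of the past, are drawn at every call. Augmented Lagrangian: $\mathcal L_\beta(x_1,\dots,x_N,\lambda)=f(x_1,\dots,x_N)+\sum_{i=1}^{N-1}r_i(x_i)-\langle\sum_{i=1}^N A_ix_i-b,\lambda\rangle+\frac\beta2\|\sum_{i=1}^N A_ix_i-b\|^2$. Write $\|v\|_H^2=v^\top Hv$. Potential: $\Psi_S(x_1,\dots,x_N,\lambda,\bar x)=\mathcal L_\beta(x_1,\dots,x_N,\lambda)+\frac4\beta\left[(\beta-\frac1\gamma)^2+L^2\right]\|\bar x-x_N\|^2$. Stochastic linearization: $\tilde{\mathcal L}^i_\beta(x_i;\hat x_1,\dots,\hat x_N,\lambda;M)=f(\hat x)+\langle G_i^M(\hat x),x_i-\hat x_i\rangle+r_i(x_i)-\langle\sum_{j\ne i}A_j\hat x_j+A_ix_i-b,\lambda\rangle+\frac\beta2\|\sum_{j\ne i}A_j\hat x_j+A_ix_i-b\|^2$.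 Algorithm 3: given $x_i^0\in\mathcal M_i\cap X_i$ ($i\le N-1$), $x_N^0\in\mathbb R^{n_N}$, $\lambda^0\in\mathbb R^m$, $\beta,\gamma>0$, symmetric $H_i\succ0$, batch size $M$; for $k=0,1,\dots$: Step 1: for $i=1,\dots,N-1$ in order, $x_i^{k+1}$ is a global minimizer (assumed to exist and be computable) over $x_i\in\mathcal M_i\cap X_i$ of $\tilde{\mathcal L}^i_\beta(x_i;x_1^{k+1},\dots,x_{i-1}^{k+1},x_i^k,\dots,x_N^k,\lambda^k;M)+\frac12\|x_i-x_i^k\|_{H_i}^2$. Step 2: $x_N^{k+1}=x_N^k-\gamma\left[G_N^M(x_1^{k+1},\dots,x_{N-1}^{k+1},x_N^k)-\lambda^k+\beta\left(\sum_{j=1}^{N-1}A_jx_j^{k+1}+x_N^k-b\right)\right]$ (a gradient step on $\tilde{\mathcal L}^N_\beta$). Step 3: $\lambda^{k+1}=\lambda^k-\beta(\sum_{i=1}^N A_ix_i^{k+1}-b)$. Cones: for $C\subset\mathbb R^n$ and $x\in C$, the tangent cone $T_C(x)$ is the set of $w$ such that for all sequences $x_j\to x$ in $C$ and $t_j\downarrow0$ there are $w_j\to w$ with $x_j+t_jw_j\in C$ for all $j$. For a closed subset $S$ of $\mathcal M$, $x\in S$ and a chart $(U,\psi)$ of $\mathcal M$ at $x$: $\mathcal T_S(x)=[\mathbf D\psi(x)]^{-1}[T_{\psi(S\cap U)}(\psi(x))]$ and $\mathcal N_S(x)=\{u\in\mathcal T_x\mathcal M:\langle u,v\rangle\le0\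 \forall v\in\mathcal T_S(x)\}$, where $\mathcal T_x\mathcal M$ is the tangent space. $\epsilon$-stationary solution in expectation: randomly generated $x^*,\lambda^*$ such that $\mathsf E[\|\nabla_Nf(x^* )-A_N^\top\lambda^*\|]\le\epsilon$, $\mathsf E[\|\sum_{i=1}^N A_ix_i^*-b\|]\le\epsilon$, and for $i=1,\dots,N-1$ $$\mathsf E\left[\operatorname{dist}\left(\operatorname{Proj}_{\mathcal T_{x_i^*}\mathcal M_i}\left(-\nabla_if(x^* )+A_i^\top\lambda^*-\partial r_i(x_i^* )\right),\ \mathcal N_{X_i\cap\mathcal M_i}(x_i^* )\right)\right]\le\epsilon,$$ where $\operatorname{dist}(A,B)=\inf_{a\in A,b\in B}\|a-b\|$, $\partial r_i$ is the convex subdifferential and $\operatorname{Proj}$ is orthogonal projection.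
   Formalization: The index k* is taken as a (deterministic) minimizer over 2≤k≤K+1 of the expectation of the sum of squared iterate differences; with k* chosen separately for each random sample path, as literally written, the claim is false. *)

theory Defs
  imports "HOL-Probability.Probability"
begin

text \<open>
  The product \<open>R^n_1 x ... x R^n_N\<close> is \<^typ>\<open>real^'n\<close> together with a labelling \<open>c :: 'n \<Rightarrow> nat\<close>
  of the coordinates by block numbers: the coordinates of block \<open>i\<close> are those \<open>j\<close> with \<open>c j = i\<close>,
  so \<open>n_i = card {j. c j = i}\<close>. The factor \<open>R^n_i\<close> is the coordinate subspace \<open>block_space c i\<close>
  (isometric to \<open>R^n_i\<close>), and \<open>x_i\<close> is \<open>block c i x\<close>.

  The matrices \<open>A_i\<close> are the column blocks of one matrix \<open>A = [A_1, ..., A_N]\<close>, so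
  \<open>sum_i A_i x_i = A *v x\<close>. In the last block, \<open>e :: 'm \<Rightarrow> 'n\<close> lists the coordinates, which
  identifies it with \<open>R^m\<close> and gives a meaning to \<open>A_N = I\<close>.
\<close>

definition block :: "('n \<Rightarrow> nat) \<Rightarrow> nat \<Rightarrow> real^'n \<Rightarrow> real^'n" where
  "block c i x = (\<chi> j. if c j = i then x $ j else 0)"

definition block_space :: "('n \<Rightarrow> nat) \<Rightarrow> nat \<Rightarrow> (real^'n) set" where
  "block_space c i = {x. \<forall>j. c j \<noteq> i \<longrightarrow> x $ j = 0}"

definition block_cols :: "('n \<Rightarrow> nat) \<Rightarrow> nat \<Rightarrow> real^'n^'m \<Rightarrow> real^'n^'m" where
  "block_cols c i A = (\<chi> k j. if c j = i then A $ k $ j else 0)"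

definition put_block :: "('n \<Rightarrow> nat) \<Rightarrow> nat \<Rightarrow> real^'n \<Rightarrow> real^'n \<Rightarrow> real^'n" where
  "put_block c i y x = (\<chi> j. if c j = i then y $ j else x $ j)"

text \<open>\<open>sweep c i u v = (u_1, ..., u_{i-1}, v_i, ..., v_N)\<close>\<close>

definition sweep :: "('n \<Rightarrow> nat) \<Rightarrow> nat \<Rightarrow> real^'n \<Rightarrow> real^'n \<Rightarrow> real^'n" where
  "sweep c i u v = (\<chi> j. if c j < i then u $ j else v $ j)"

definition last_block :: "('m \<Rightarrow> 'n) \<Rightarrow> real^'n \<Rightarrow> real^'m" where
  "last_block e x = (\<chi> l. x $ (e l))"

text \<open>An \<open>n_i x n_i\<close> matrix is a matrix vanishing outside the coordinates of block \<open>i\<close>.\<close>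

definition block_matrix :: "('n \<Rightarrow> nat) \<Rightarrow> nat \<Rightarrow> real^'n^'n \<Rightarrow> bool" where
  "block_matrix c i H \<longleftrightarrow> (\<forall>j l. H $ j $ l \<noteq> 0 \<longrightarrow> c j = i \<and> c l = i)"

text \<open>\<open>H \<succ> t I\<close> as matrices acting on the coordinate subspace \<open>E\<close>\<close>

definition succ_scaled_id :: "(real^'n) set \<Rightarrow> real^'n^'n \<Rightarrow> real \<Rightarrow> bool" where
  "succ_scaled_id E H t \<longleftrightarrow> (\<forall>v\<in>E. v \<noteq> 0 \<longrightarrow> v \<bullet> (H *v v) > t * (v \<bullet> v))"

definition spectral_norm :: "real^'n^'m \<Rightarrow> real" where
  "spectral_norm A = onorm ((*v) A)"

text \<open>Singular values are the square roots of the eigenvalues of \<open>H\<^sup>T H\<close>.\<close>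

definition sigma_min :: "(real^'n) set \<Rightarrow> real^'n^'n \<Rightarrow> real" where
  "sigma_min E H =
     Min {s. 0 \<le> s \<and> (\<exists>v\<in>E. v \<noteq> 0 \<and> (transpose H ** H) *v v = s\<^sup>2 *\<^sub>R v)}"


subsection \<open>Submanifolds and cones\<close>

primrec Ck_on :: "nat \<Rightarrow> 'a::real_normed_vector set \<Rightarrow> ('a \<Rightarrow> 'b::real_normed_vector) \<Rightarrow> bool" where
  "Ck_on 0 U g \<longleftrightarrow> continuous_on U g"
| "Ck_on (Suc k) U g \<longleftrightarrow>
     (\<forall>x\<in>U. g differentiable (at x)) \<and> (\<forall>v. Ck_on k U (\<lambda>x. frechet_derivative g (at x) v))"

definition Cinf_on :: "'a::real_normed_vector set \<Rightarrow> ('a \<Rightarrow> 'b::real_normed_vector) \<Rightarrow> bool" where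
  "Cinf_on U g \<longleftrightarrow> (\<forall>k. Ck_on k U g)"

text \<open>
  A diffeomorphism \<open>\<psi>\<close> between open sets of the ambient space that flattens \<open>\<M>\<close> onto a linear
  subspace \<open>V\<close>. Its restriction to \<open>U \<inter> \<M>\<close> is a chart of \<open>\<M>\<close> with values in \<open>V \<cong> R^d\<close>.
  A subset of a coordinate subspace is a submanifold of that subspace iff it is one of the whole
  space, with the same tangent spaces, so this is also used for \<open>\<M>_i \<subseteq> R^n_i\<close>.
\<close>

definition slice_chart ::
  "'a::euclidean_space set \<Rightarrow> 'a set \<Rightarrow> 'a set \<Rightarrow> ('a \<Rightarrow> 'a) \<Rightarrow> bool" where
  "slice_chart \<M> V U \<psi> \<longleftrightarrow>
     subspace V \<and> open U \<and> inj_on \<psi> U \<and> open (\<psi> ` U) \<and>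
     Cinf_on U \<psi> \<and> Cinf_on (\<psi> ` U) (inv_into U \<psi>) \<and>
     \<psi> ` (U \<inter> \<M>) = \<psi> ` U \<inter> V"

definition embedded_submanifold :: "'a::euclidean_space set \<Rightarrow> bool" where
  "embedded_submanifold \<M> \<longleftrightarrow>
     (\<exists>d. \<forall>x\<in>\<M>. \<exists>V U \<psi>. x \<in> U \<and> dim V = d \<and> slice_chart \<M> V U \<psi>)"

definition tangent_space :: "'a::euclidean_space set \<Rightarrow> 'a \<Rightarrow> 'a set" where
  "tangent_space \<M> x =
     {v. \<exists>(p :: real \<Rightarrow> 'a) s. s > 0 \<and> Cinf_on {-s<..<s} p \<and> p ` {-s<..<s} \<subseteq> \<M> \<and> p 0 = x \<and>
         (p has_vector_derivative v) (at 0)}"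

definition tangent_cone :: "'a::euclidean_space set \<Rightarrow> 'a \<Rightarrow> 'a set" where
  "tangent_cone C x =
     {w. \<forall>y t. (\<forall>j::nat. y j \<in> C) \<and> y \<longlonglongrightarrow> x \<and> (\<forall>j. t j > (0::real)) \<and> t \<longlonglongrightarrow> 0 \<longrightarrow>
           (\<exists>z. z \<longlonglongrightarrow> w \<and> (\<forall>j. y j + t j *\<^sub>R z j \<in> C))}"

definition chart_at :: "'a::euclidean_space set \<Rightarrow> 'a \<Rightarrow> 'a set \<times> ('a \<Rightarrow> 'a)" where
  "chart_at \<M> x = (SOME (U, \<psi>). x \<in> U \<and> (\<exists>V. slice_chart \<M> V U \<psi>))"

text \<open>The cone does not depend on the chart, because diffeomorphisms preserve tangent cones.\<close>

definition manifold_tangent_cone :: "'a::euclidean_space set \<Rightarrow> 'a set \<Rightarrow> 'a \<Rightarrow> 'a set" where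
  "manifold_tangent_cone \<M> S x =
     (let (U, \<psi>) = chart_at \<M> x in
      {v \<in> tangent_space \<M> x. frechet_derivative \<psi> (at x) v \<in> tangent_cone (\<psi> ` (S \<inter> U)) (\<psi> x)})"

definition manifold_normal_cone :: "'a::euclidean_space set \<Rightarrow> 'a set \<Rightarrow> 'a \<Rightarrow> 'a set" where
  "manifold_normal_cone \<M> S x =
     {u \<in> tangent_space \<M> x. \<forall>v\<in>manifold_tangent_cone \<M> S x. u \<bullet> v \<le> 0}"

text \<open>Convex subdifferential of a function defined on the subspace \<open>E\<close>\<close>

definition subdifferential :: "'a::euclidean_space set \<Rightarrow> ('a \<Rightarrow> real) \<Rightarrow> 'a \<Rightarrow> 'a set" where
  "subdifferential E \<rho> x = {g \<in> E. \<forall>y\<in>E. \<rho> y \<ge> \<rho> x + g \<bullet> (y - x)}"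

definition locally_Lipschitz_on :: "'a::euclidean_space set \<Rightarrow> ('a \<Rightarrow> real) \<Rightarrow> bool" where
  "locally_Lipschitz_on E \<rho> \<longleftrightarrow> (\<forall>x\<in>E. \<exists>u>0. \<exists>l. l-lipschitz_on (cball x u \<inter> E) \<rho>)"


subsection \<open>The algorithm\<close>

definition aug_lagrangian ::
  "nat \<Rightarrow> ('n \<Rightarrow> nat) \<Rightarrow> real^'n^'m \<Rightarrow> real^'m \<Rightarrow> (real^'n \<Rightarrow> real) \<Rightarrow> (nat \<Rightarrow> real^'n \<Rightarrow> real) \<Rightarrow>
   real \<Rightarrow> real^'n \<Rightarrow> real^'m \<Rightarrow> real" where
  "aug_lagrangian N c A b f r \<beta> x lam =
     f x + (\<Sum>i\<in>{1..<N}. r i (block c i x)) - (A *v x - b) \<bullet> lam + \<beta> / 2 * (norm (A *v x - b))\<^sup>2"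

definition potential ::
  "nat \<Rightarrow> ('n \<Rightarrow> nat) \<Rightarrow> ('m \<Rightarrow> 'n) \<Rightarrow> real^'n^'m \<Rightarrow> real^'m \<Rightarrow> (real^'n \<Rightarrow> real) \<Rightarrow>
   (nat \<Rightarrow> real^'n \<Rightarrow> real) \<Rightarrow> real \<Rightarrow> real \<Rightarrow> real \<Rightarrow> real^'n \<Rightarrow> real^'m \<Rightarrow> real^'m \<Rightarrow> real" where
  "potential N c e A b f r L \<beta> \<gamma> x lam xbar =
     aug_lagrangian N c A b f r \<beta> x lam
     + 4 / \<beta> * ((\<beta> - 1 / \<gamma>)\<^sup>2 + L\<^sup>2) * (norm (xbar - last_block e x))\<^sup>2"

text \<open>Here \<open>g\<close> is the mini-batch gradient estimate for block \<open>i\<close> at \<open>xh\<close>.\<close>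

definition stochastic_lagrangian ::
  "('n \<Rightarrow> nat) \<Rightarrow> real^'n^'m \<Rightarrow> real^'m \<Rightarrow> (real^'n \<Rightarrow> real) \<Rightarrow> (nat \<Rightarrow> real^'n \<Rightarrow> real) \<Rightarrow> real \<Rightarrow>
   nat \<Rightarrow> real^'n \<Rightarrow> real^'n \<Rightarrow> real^'n \<Rightarrow> real^'m \<Rightarrow> real" where
  "stochastic_lagrangian c A b f r \<beta> i g y xh lam =
     f xh + g \<bullet> (y - block c i xh) + r i y
     - (A *v put_block c i y xh - b) \<bullet> lam
     + \<beta> / 2 * (norm (A *v put_block c i y xh - b))\<^sup>2"

definition minibatch ::
  "(real^'n \<Rightarrow> 's \<Rightarrow> real^'n) \<Rightarrow> nat \<Rightarrow> real^'n \<Rightarrow> (nat \<Rightarrow> 's) \<Rightarrow> real^'n" where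
  "minibatch Gi M x s = (1 / real M) *\<^sub>R (\<Sum>q<M. Gi x (s q))"

text \<open>
  One realisation of the algorithm; \<open>s k i q\<close> is the \<open>q\<close>-th sample drawn for block \<open>i\<close> in
  iteration \<open>k\<close>. In the second step \<open>A *v xh\<close> is \<open>sum_{j<N} A_j x_j^{k+1} + x_N^k\<close> since \<open>A_N = I\<close>.
\<close>

definition stochastic_admm ::
  "nat \<Rightarrow> ('n \<Rightarrow> nat) \<Rightarrow> ('m \<Rightarrow> 'n) \<Rightarrow> real^'n^'m \<Rightarrow> real^'m \<Rightarrow> (real^'n \<Rightarrow> real) \<Rightarrow>
   (nat \<Rightarrow> real^'n \<Rightarrow> real) \<Rightarrow> (nat \<Rightarrow> (real^'n) set) \<Rightarrow> (nat \<Rightarrow> (real^'n) set) \<Rightarrow>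
   (nat \<Rightarrow> real^'n \<Rightarrow> 's \<Rightarrow> real^'n) \<Rightarrow> real \<Rightarrow> real \<Rightarrow> (nat \<Rightarrow> real^'n^'n) \<Rightarrow> nat \<Rightarrow>
   (nat \<Rightarrow> nat \<Rightarrow> nat \<Rightarrow> 's) \<Rightarrow> (nat \<Rightarrow> real^'n) \<Rightarrow> (nat \<Rightarrow> real^'m) \<Rightarrow> bool" where
  "stochastic_admm N c e A b f r \<M> X G \<beta> \<gamma> H M s x lam \<longleftrightarrow> (\<forall>k.
     (\<forall>i\<in>{1..<N}. let xh = sweep c i (x (Suc k)) (x k); xi = block c i (x k) in
        is_arg_min
          (\<lambda>y. stochastic_lagrangian c A b f r \<beta> i (minibatch (G i) M xh (s k i)) y xh (lam k)
               + 1 / 2 * ((y - xi) \<bullet> (H i *v (y - xi))))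
          (\<lambda>y. y \<in> \<M> i \<inter> X i)
          (block c i (x (Suc k)))) \<and>
     (let xh = sweep c N (x (Suc k)) (x k) in
        last_block e (x (Suc k)) = last_block e (x k)
          - \<gamma> *\<^sub>R (last_block e (minibatch (G N) M xh (s k N)) - lam k + \<beta> *\<^sub>R (A *v xh - b))) \<and>
     lam (Suc k) = lam k - \<beta> *\<^sub>R (A *v x (Suc k) - b))"


subsection \<open>Stochastic assumptions\<close>

text \<open>\<open>D i\<close> is the distribution of the random variable \<open>\<xi>_i\<close>.\<close>

definition stochastic_oracle ::
  "nat \<Rightarrow> ('n \<Rightarrow> nat) \<Rightarrow> (real^'n \<Rightarrow> real^'n) \<Rightarrow> (nat \<Rightarrow> 's measure) \<Rightarrow>
   (nat \<Rightarrow> real^'n \<Rightarrow> 's \<Rightarrow> real^'n) \<Rightarrow> real \<Rightarrow> bool" where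
  "stochastic_oracle N c gradf D G \<sigma> \<longleftrightarrow> (\<forall>i\<in>{1..N}.
     prob_space (D i) \<and>
     (\<lambda>(x, s). G i x s) \<in> borel_measurable (borel \<Otimes>\<^sub>M D i) \<and>
     (\<forall>x. (\<forall>s\<in>space (D i). G i x s \<in> block_space c i) \<and>
          integrable (D i) (G i x) \<and>
          (\<integral>s. G i x s \<partial>D i) = block c i (gradf x) \<and>
          (\<integral>\<^sup>+s. ennreal ((norm (G i x s - block c i (gradf x)))\<^sup>2) \<partial>D i) \<le> ennreal (\<sigma>\<^sup>2)))"

text \<open>
  The events determined by the calls preceding call \<open>(k, i)\<close>, that is, by their samples and by the
  blocks \<open>x_j^{l+1}\<close> computed from them. (The initial point is deterministic, and the multipliers
  are functions of the iterates.)
\<close>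

definition past ::
  "'w measure \<Rightarrow> nat \<Rightarrow> ('n \<Rightarrow> nat) \<Rightarrow> (nat \<Rightarrow> 's measure) \<Rightarrow> nat \<Rightarrow>
   (nat \<Rightarrow> nat \<Rightarrow> nat \<Rightarrow> 'w \<Rightarrow> 's) \<Rightarrow> (nat \<Rightarrow> 'w \<Rightarrow> real^'n) \<Rightarrow> nat \<Rightarrow> nat \<Rightarrow> 'w set set" where
  "past P N c D M \<xi> x k i = sigma_sets (space P)
     ({(\<lambda>\<omega>. block c j (x (Suc l) \<omega>)) -` B \<inter> space P | l j B.
         (l < k \<or> l = k \<and> j < i) \<and> j \<in> {1..N} \<and> B \<in> sets borel} \<union>
      {\<xi> l j q -` B \<inter> space P | l j q B.
         (l < k \<or> l = k \<and> j < i) \<and> j \<in> {1..N} \<and> q < M \<and> B \<in> sets (D j)})"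

definition fresh_samples ::
  "'w measure \<Rightarrow> nat \<Rightarrow> ('n \<Rightarrow> nat) \<Rightarrow> (nat \<Rightarrow> 's measure) \<Rightarrow> nat \<Rightarrow>
   (nat \<Rightarrow> nat \<Rightarrow> nat \<Rightarrow> 'w \<Rightarrow> 's) \<Rightarrow> (nat \<Rightarrow> 'w \<Rightarrow> real^'n) \<Rightarrow> bool" where
  "fresh_samples P N c D M \<xi> x \<longleftrightarrow> (\<forall>k. \<forall>i\<in>{1..N}.
     (\<forall>q<M. \<xi> k i q \<in> measurable P (D i) \<and> distr P (D i) (\<xi> k i q) = D i) \<and>
     prob_space.indep_vars P (\<lambda>_. D i) (\<xi> k i) {..<M} \<and>
     prob_space.indep_set P (past P N c D M \<xi> x k i)
       (sigma_sets (space P) {\<xi> k i q -` B \<inter> space P | q B. q < M \<and> B \<in> sets (D i)}))"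


subsection \<open>Stationarity in expectation\<close>

text \<open>
  For measurable \<open>h\<close> this is the expectation, see below. The majorant makes the bound in the
  definition of stationarity meaningful without presupposing that the distance to the normal cone
  is measurable.
\<close>

definition upper_expectation :: "'w measure \<Rightarrow> ('w \<Rightarrow> real) \<Rightarrow> ennreal" where
  "upper_expectation P h =
     (INF g\<in>{g \<in> borel_measurable P. \<forall>\<omega>\<in>space P. ennreal (h \<omega>) \<le> g \<omega>}. \<integral>\<^sup>+\<omega>. g \<omega> \<partial>P)"

lemma upper_expectation_eq_nn_integral:
  assumes [measurable]: "h \<in> borel_measurable P"
  shows "upper_expectation P h = (\<integral>\<^sup>+\<omega>. ennreal (h \<omega>) \<partial>P)"
  unfolding upper_expectation_def
proof (rule antisym)
  show "(INF g\<in>{g \<in> borel_measurable P. \<forall>\<omega>\<in>space P. ennreal (h \<omega>) \<le> g \<omega>}. \<integral>\<^sup>+\<omega>. g \<omega> \<partial>P)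
        \<le> (\<integral>\<^sup>+\<omega>. ennreal (h \<omega>) \<partial>P)"
    by (rule INF_lower) auto
  show "(\<integral>\<^sup>+\<omega>. ennreal (h \<omega>) \<partial>P)
        \<le> (INF g\<in>{g \<in> borel_measurable P. \<forall>\<omega>\<in>space P. ennreal (h \<omega>) \<le> g \<omega>}. \<integral>\<^sup>+\<omega>. g \<omega> \<partial>P)"
    by (rule INF_greatest) (auto intro: nn_integral_mono)
qed

text \<open>
  The orthogonal projection onto the tangent space is \<^const>\<open>closest_point\<close>. The cones are only
  meaningful at points of \<open>\<M>_i \<inter> X_i\<close>, hence the first conjunct.
\<close>

definition eps_stationary_in_expectation ::
  "'w measure \<Rightarrow> nat \<Rightarrow> ('n \<Rightarrow> nat) \<Rightarrow> real^'n^'m \<Rightarrow> real^'m \<Rightarrow> (real^'n \<Rightarrow> real^'n) \<Rightarrow>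
   (nat \<Rightarrow> real^'n \<Rightarrow> real) \<Rightarrow> (nat \<Rightarrow> (real^'n) set) \<Rightarrow> (nat \<Rightarrow> (real^'n) set) \<Rightarrow> real \<Rightarrow>
   ('w \<Rightarrow> real^'n) \<Rightarrow> ('w \<Rightarrow> real^'m) \<Rightarrow> bool" where
  "eps_stationary_in_expectation P N c A b gradf r \<M> X \<epsilon> xs lams \<longleftrightarrow>
     (\<forall>\<omega>\<in>space P. \<forall>i\<in>{1..<N}. block c i (xs \<omega>) \<in> \<M> i \<inter> X i) \<and>
     (\<integral>\<^sup>+\<omega>. ennreal (norm (block c N (gradf (xs \<omega>)) - transpose (block_cols c N A) *v lams \<omega>)) \<partial>P)
       \<le> ennreal \<epsilon> \<and>
     (\<integral>\<^sup>+\<omega>. ennreal (norm (A *v xs \<omega> - b)) \<partial>P) \<le> ennreal \<epsilon> \<and>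
     (\<forall>i\<in>{1..<N}.
        upper_expectation P
          (\<lambda>\<omega>. let xi = block c i (xs \<omega>) in
             setdist
               (closest_point (tangent_space (\<M> i) xi) `
                  {- block c i (gradf (xs \<omega>)) + transpose (block_cols c i A) *v lams \<omega> - g | g.
                     g \<in> subdifferential (block_space c i) (r i) xi})
               (manifold_normal_cone (\<M> i) (X i \<inter> \<M> i) xi))
        \<le> ennreal \<epsilon>)"

end

theory Submission
  imports Defs
begin

text \<open>
  Optimality of each block update, of the gradient step and of the multiplier update bounds the three
  residuals by consecutive differences of the iterates and by the sampling errors, while the potential
  decreases in expectation by \<open>\<tau>\<close> times the squared differences, up to a noise term of order \<open>\<sigma>^2 / M\<close>.
  Since the potential is bounded below in expectation, some iteration among the first \<open>K + 1\<close> has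
  small differences.

  For a minimizer over \<open>\<M>\<^sub>i \<inter> X\<^sub>i\<close>, the tangent cone is convex (it is a Clarke cone), so one
  separation argument yields a single subgradient that is optimal in all tangent directions.

  The indices \<open>2, ..., K + 1\<close> of \<open>k\<^sup>*\<close> involve \<open>K + 1\<close> noise terms, but \<open>M\<close> and \<open>K\<close> only account for \<open>K\<close>.
  The surplus is absorbed because \<open>\<kappa>\<^sub>3\<close> dominates \<open>\<kappa>\<^sub>1\<close> and \<open>\<kappa>\<^sub>2\<close>, and \<open>\<kappa>\<^sub>3 \<kappa>\<^sub>4 \<ge> 64\<close> makes the direct
  contribution of the sampling error to the residuals small.
\<close>

subsection \<open>Tangent cones and first-order optimality\<close>

text \<open>Two obstacles shape the argument. No moment of the iterates is given in advance, so
  integrability has to be carried along the run block by block: the proximal term bounds each step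
  by quantities known before it, and \<open>rstar\<close> bounds the new objective from below. And
  the distance to the normal cone need not be measurable, so every residual is bounded pointwise by
  an integrable majorant whose mean is compared with \<open>\<epsilon>^2\<close>.

  Because \<open>A_N = I\<close>, the multiplier is the last gradient estimate up to a multiple of
  the last step, which turns the ascent in the multiplier into primal steps and errors. The last
  block enters this difference with its previous step as well; the extra term of the potential
  telescopes that delayed contribution away, and \<tau> is what remains of the step coefficients.

  Sampling errors of successive iterations are orthogonal, whence the noise constant
  \<open>8 / \<beta>\<close> instead of \<open>16 / \<beta>\<close>. The interval for \<gamma>
  places \<open>1 / \<gamma>\<close> between the roots of a quadratic with discriminant
  \<Delta>.\<close>

lemma has_derivative_sequentially:
  fixes f :: "'a::real_normed_vector \<Rightarrow> 'b::real_normed_vector"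
  assumes f: "(f has_derivative f') (at x)" and v: "v \<longlonglongrightarrow> w" and t: "t \<longlonglongrightarrow> 0"
    and t_pos: "\<And>j. t j > (0::real)"
  shows "(\<lambda>j. (f (x + t j *\<^sub>R v j) - f x) /\<^sub>R t j) \<longlonglongrightarrow> f' w"
proof -
  have lin: "bounded_linear f'" using f by (rule has_derivative_bounded_linear)
  have "Bseq v" using v convergent_imp_Bseq convergentI by blast
  then obtain C where C: "C > 0" "\<And>j. norm (v j) \<le> C" by (auto elim: BseqE)
  have tv: "(\<lambda>j. t j *\<^sub>R v j) \<longlonglongrightarrow> 0" using tendsto_scaleR[OF t v] by simp
  \<comment> \<open>The directions vary with \<open>j\<close>; their common bound \<open>C\<close>
    makes the remainder of the derivative uniformly small.\<close>
  have "(\<lambda>j. (f (x + t j *\<^sub>R v j) - f x) /\<^sub>R t j - f' (v j)) \<longlonglongrightarrow> 0"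
  proof (rule LIMSEQ_I)
    fix \<epsilon> :: real assume \<epsilon>: "\<epsilon> > 0"
    then have "\<epsilon> / (2 * C) > 0" using C by simp
    then obtain d where d: "d > 0"
      "\<And>y. norm (y - x) < d \<Longrightarrow> norm (f y - f x - f' (y - x)) \<le> \<epsilon> / (2 * C) * norm (y - x)"
      using f unfolding has_derivative_at_alt by blast
    obtain n where n: "\<And>j. j \<ge> n \<Longrightarrow> norm (t j *\<^sub>R v j) < d"
      using LIMSEQ_D[OF tv d(1)] by auto
    have "norm ((f (x + t j *\<^sub>R v j) - f x) /\<^sub>R t j - f' (v j)) < \<epsilon>" if "j \<ge> n" for j
    proof -
      have "(f (x + t j *\<^sub>R v j) - f x) /\<^sub>R t j - f' (v j)
          = (f (x + t j *\<^sub>R v j) - f x - f' (t j *\<^sub>R v j)) /\<^sub>R t j"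
        using t_pos[of j] by (simp add: linear_simps(5)[OF lin] scaleR_diff_right)
      then have "norm ((f (x + t j *\<^sub>R v j) - f x) /\<^sub>R t j - f' (v j))
          = norm (f (x + t j *\<^sub>R v j) - f x - f' (t j *\<^sub>R v j)) / t j"
        using t_pos[of j] by (simp only: norm_scaleR abs_inverse abs_of_pos divide_inverse mult.commute)
      also have "\<dots> \<le> \<epsilon> / (2 * C) * norm (t j *\<^sub>R v j) / t j"
        using d(2)[of "x + t j *\<^sub>R v j"] n[OF that] t_pos[of j]
        by (intro divide_right_mono) (simp_all only: add_diff_cancel_left' less_imp_le)
      also have "\<dots> = \<epsilon> / (2 * C) * norm (v j)" using t_pos[of j] by simp
      also have "\<dots> \<le> \<epsilon> / (2 * C) * C" using C \<epsilon> by (intro mult_left_mono) auto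
      also have "\<dots> < \<epsilon>" using C \<epsilon> by simp
      finally show ?thesis .
    qed
    then show "\<exists>no. \<forall>j\<ge>no. norm ((f (x + t j *\<^sub>R v j) - f x) /\<^sub>R t j - f' (v j) - 0) < \<epsilon>"
      by auto
  qed
  from tendsto_add[OF this bounded_linear.tendsto[OF lin v]] show ?thesis by simp
qed

section \<open>Smooth maps, charts and tangent spaces\<close>

text \<open>On an open set, functions that agree have the same Frechet derivatives at every point,
  so the induction passes to the derivatives.\<close>

lemma Ck_on_cong:
  assumes "Ck_on k U f" "open U" "\<And>x. x \<in> U \<Longrightarrow> f x = g x"
  shows "Ck_on k U g"
  using assms
proof (induction k arbitrary: f g)
  case 0
  then show ?case by (auto cong: continuous_on_cong)
next
  case (Suc k)
  have der: "(g has_derivative frechet_derivative f (at x)) (at x)" if "x \<in> U" for x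
    using Suc.prems that
    by (auto intro!: has_derivative_transform_within_open[of f _ x UNIV U g]
        simp: frechet_derivative_works)
  then have eq: "frechet_derivative g (at x) = frechet_derivative f (at x)" if "x \<in> U" for x
    using that frechet_derivative_at by metis
  have "Ck_on k U (\<lambda>x. frechet_derivative g (at x) v)" for v
    by (rule Suc.IH[of "\<lambda>x. frechet_derivative f (at x) v"]) (use Suc.prems eq in auto)
  then show ?case using der by (auto simp: differentiable_def)
qed

text \<open>With an affine inner map the induction closes without a product rule: the derivative of
  the composite in direction \<open>v\<close> is again such a composite, of the derivative of
  \<open>h\<close> in the fixed direction \<open>v *\<^sub>R w\<close>.\<close>

lemma Ck_on_affine:
  fixes h :: "'a::real_normed_vector \<Rightarrow> 'b::real_normed_vector" and I :: "real set"
  assumes "Ck_on k W h" "open I" "\<And>t. t \<in> I \<Longrightarrow> y + t *\<^sub>R w \<in> W"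
  shows "Ck_on k I (\<lambda>t. h (y + t *\<^sub>R w))"
  using assms
proof (induction k arbitrary: h)
  case 0
  then show ?case
    by (auto intro!: continuous_on_compose2[of W h] continuous_intros)
next
  case (Suc k)
  have der: "((\<lambda>t. h (y + t *\<^sub>R w)) has_derivative
      (\<lambda>s. frechet_derivative h (at (y + t *\<^sub>R w)) (s *\<^sub>R w))) (at t)" if "t \<in> I" for t
  proof -
    have "(h has_derivative frechet_derivative h (at (y + t *\<^sub>R w))) (at (y + t *\<^sub>R w))"
      using Suc.prems that by (auto simp: frechet_derivative_works)
    then show ?thesis
      by (auto intro!: has_derivative_compose[of "\<lambda>t. y + t *\<^sub>R w" "\<lambda>s. s *\<^sub>R w" t UNIV h]
          derivative_eq_intros)
  qed
  then have eq: "frechet_derivative (\<lambda>t. h (y + t *\<^sub>R w)) (at t)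
      = (\<lambda>s. frechet_derivative h (at (y + t *\<^sub>R w)) (s *\<^sub>R w))" if "t \<in> I" for t
    using that frechet_derivative_at by metis
  have "Ck_on k I (\<lambda>t. frechet_derivative (\<lambda>t. h (y + t *\<^sub>R w)) (at t) v)" for v
  proof (rule Ck_on_cong)
    show "Ck_on k I (\<lambda>t. (\<lambda>z. frechet_derivative h (at z) (v *\<^sub>R w)) (y + t *\<^sub>R w))"
      by (rule Suc.IH) (use Suc.prems in auto)
  qed (use Suc.prems eq in auto)
  then show ?case using der by (auto simp: differentiable_def)
qed

lemma Cinf_on_differentiable: "Cinf_on U g \<Longrightarrow> x \<in> U \<Longrightarrow> g differentiable (at x)"
  unfolding Cinf_on_def using Ck_on.simps(2) by blast

text \<open>Differentiating \<open>inv_into U \<psi> (\<psi> z) = z\<close> near \<open>x\<close>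
  shows that \<open>\<chi>'\<close> is a left inverse of \<open>\<psi>'\<close>.\<close>

lemma slice_chart_derivatives:
  fixes \<M> :: "'a::euclidean_space set"
  assumes chart: "slice_chart \<M> V U \<psi>" and x: "x \<in> U"
  obtains \<psi>' \<chi>' where "\<psi>' = frechet_derivative \<psi> (at x)" "(\<psi> has_derivative \<psi>') (at x)"
    "(inv_into U \<psi> has_derivative \<chi>') (at (\<psi> x))" "\<And>v. \<chi>' (\<psi>' v) = v"
proof -
  define \<psi>' where "\<psi>' = frechet_derivative \<psi> (at x)"
  define \<chi>' where "\<chi>' = frechet_derivative (inv_into U \<psi>) (at (\<psi> x))"
  have U: "open U" "inj_on \<psi> U" using chart by (auto simp: slice_chart_def)
  have 1: "(\<psi> has_derivative \<psi>') (at x)"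
    using Cinf_on_differentiable[of U \<psi> x] chart x
    by (auto simp: slice_chart_def \<psi>'_def frechet_derivative_works)
  have 2: "(inv_into U \<psi> has_derivative \<chi>') (at (\<psi> x))"
    using Cinf_on_differentiable[of "\<psi> ` U" "inv_into U \<psi>" "\<psi> x"] chart x
    by (auto simp: slice_chart_def \<chi>'_def frechet_derivative_works)
  have "((\<lambda>z. inv_into U \<psi> (\<psi> z)) has_derivative (\<lambda>v. \<chi>' (\<psi>' v))) (at x)"
    using has_derivative_compose[OF 1 2] .
  then have "((\<lambda>z. z) has_derivative (\<lambda>v. \<chi>' (\<psi>' v))) (at x)"
    by (rule has_derivative_transform_within_open[of _ _ _ UNIV U]) (use U x in auto)
  then have "(\<lambda>v. \<chi>' (\<psi>' v)) = (\<lambda>v. v)"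
    using has_derivative_unique has_derivative_ident by blast
  then show thesis using that[of \<psi>' \<chi>'] 1 2 \<psi>'_def by (metis)
qed

text \<open>In the chart a curve in \<open>\<M>\<close> has difference quotients in the closed
  subspace \<open>V\<close>; conversely, a straight line in \<open>V\<close> pulled back by the
  chart is a smooth curve in \<open>\<M>\<close>. This form makes the linear structure of the
  tangent space visible.\<close>

lemma tangent_space_slice_chart:
  fixes \<M> :: "'a::euclidean_space set"
  assumes chart: "slice_chart \<M> V U \<psi>" and x: "x \<in> U" "x \<in> \<M>"
  shows "tangent_space \<M> x = {v. frechet_derivative \<psi> (at x) v \<in> V}"
proof -
  obtain \<psi>' \<chi>' where \<psi>': "\<psi>' = frechet_derivative \<psi> (at x)" "(\<psi> has_derivative \<psi>') (at x)"
    and \<chi>': "(inv_into U \<psi> has_derivative \<chi>') (at (\<psi> x))" "\<And>v. \<chi>' (\<psi>' v) = v"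
    using slice_chart_derivatives[OF chart x(1)] by blast
  have V: "subspace V" and U: "open U" "inj_on \<psi> U" "open (\<psi> ` U)"
    and inv: "Cinf_on (\<psi> ` U) (inv_into U \<psi>)" and flat: "\<psi> ` (U \<inter> \<M>) = \<psi> ` U \<inter> V"
    using chart by (auto simp: slice_chart_def)
  have xV: "\<psi> x \<in> V" using flat x by blast
  have "\<psi>' v \<in> V" if v: "v \<in> tangent_space \<M> x" for v
  proof -
    obtain p :: "real \<Rightarrow> 'a" and s where p: "s > 0" "p ` {-s<..<s} \<subseteq> \<M>" "p 0 = x"
      "(p has_vector_derivative v) (at 0)"
      using v unfolding tangent_space_def by blast
    have der: "((\<lambda>t. \<psi> (p t)) has_derivative (\<lambda>h. \<psi>' (h *\<^sub>R v))) (at 0)"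
      using has_derivative_compose[of p "\<lambda>h. h *\<^sub>R v" 0 UNIV \<psi> \<psi>'] p \<psi>'
      by (simp add: has_vector_derivative_def)
    define t where "t = (\<lambda>j. inverse (real (Suc j)))"
    have t: "t \<longlonglongrightarrow> 0" "\<And>j. t j > 0"
      unfolding t_def using LIMSEQ_inverse_real_of_nat by auto
    have lim: "(\<lambda>j. (\<psi> (p (0 + t j *\<^sub>R 1)) - \<psi> (p 0)) /\<^sub>R t j) \<longlonglongrightarrow> \<psi>' (1 *\<^sub>R v)"
      using has_derivative_sequentially[OF der _ t, of "\<lambda>_. 1" 1] by simp
    have "isCont p 0" using p(4) has_vector_derivative_continuous by blast
    then have "(\<lambda>j. p (t j)) \<longlonglongrightarrow> x" using isCont_tendsto_compose[OF _ t(1)] p(3) by metis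
    then have "eventually (\<lambda>j. p (t j) \<in> U) sequentially"
      using U(1) x(1) topological_tendstoD by blast
    moreover have "eventually (\<lambda>j. t j < s) sequentially"
      by (rule order_tendstoD(2)[OF t(1) p(1)])
    ultimately have "eventually (\<lambda>j. (\<psi> (p (0 + t j *\<^sub>R 1)) - \<psi> (p 0)) /\<^sub>R t j \<in> V) sequentially"
    proof eventually_elim
      case (elim j)
      then have "t j \<in> {-s<..<s}" using t(2)[of j] p(1) by simp
      then have "p (t j) \<in> U \<inter> \<M>" using elim p(2) by blast
      then have "\<psi> (p (t j)) \<in> V" using flat by blast
      then show ?case using xV p(3) V by (simp add: subspace_diff subspace_scale)
    qed
    from Lim_in_closed_set[OF closed_subspace[OF V] this _ lim] show ?thesis by simp
  qed
  moreover have "v \<in> tangent_space \<M> x" if v: "\<psi>' v \<in> V" for v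
  proof -
    define p where "p = (\<lambda>t. inv_into U \<psi> (\<psi> x + t *\<^sub>R \<psi>' v))"
    have "isCont (\<lambda>t. \<psi> x + t *\<^sub>R \<psi>' v) 0" by (intro continuous_intros)
    then have "((\<lambda>t. \<psi> x + t *\<^sub>R \<psi>' v) \<longlongrightarrow> \<psi> x) (at 0)" by (simp add: isCont_def)
    then have "eventually (\<lambda>t. \<psi> x + t *\<^sub>R \<psi>' v \<in> \<psi> ` U) (at 0)"
      using topological_tendstoD[of _ "\<psi> x" _ "\<psi> ` U"] U(3) x(1) by auto
    then obtain s where s: "s > 0" "\<And>t. t \<noteq> 0 \<Longrightarrow> dist t 0 < s \<Longrightarrow> \<psi> x + t *\<^sub>R \<psi>' v \<in> \<psi> ` U"
      by (auto simp: eventually_at)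
    \<comment> \<open>\<open>eventually_at\<close> says nothing about \<open>t = 0\<close>; there
      the point is \<open>\<psi> x\<close> itself.\<close>
    have s': "\<psi> x + t *\<^sub>R \<psi>' v \<in> \<psi> ` U" if "t \<in> {-s<..<s}" for t
      using s(2)[of t] that x(1) by (cases "t = 0") (auto simp: dist_real_def)
    have "Cinf_on {-s<..<s} p"
      unfolding Cinf_on_def p_def
      using inv s' by (auto intro!: Ck_on_affine[of _ "\<psi> ` U"] simp: Cinf_on_def)
    moreover have "p t \<in> \<M>" if "t \<in> {-s<..<s}" for t
    proof -
      have "\<psi> x + t *\<^sub>R \<psi>' v \<in> \<psi> ` (U \<inter> \<M>)"
        unfolding flat using s'[OF that] V xV v by (simp add: subspace_add subspace_scale)
      then show ?thesis unfolding p_def using U(2) by (auto simp: inv_into_f_f)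
    qed
    moreover have "p 0 = x" using U(2) x(1) by (simp add: p_def)
    moreover have "(p has_vector_derivative v) (at 0)"
    proof -
      have "((\<lambda>t. \<psi> x + t *\<^sub>R \<psi>' v) has_derivative (\<lambda>h. h *\<^sub>R \<psi>' v)) (at 0)"
        by (auto intro!: derivative_eq_intros)
      moreover have "(inv_into U \<psi> has_derivative \<chi>') (at (\<psi> x + 0 *\<^sub>R \<psi>' v))" using \<chi>' by simp
      ultimately have "(p has_derivative (\<lambda>h. \<chi>' (h *\<^sub>R \<psi>' v))) (at 0)"
        unfolding p_def by (rule has_derivative_compose)
      moreover have "\<chi>' (h *\<^sub>R \<psi>' v) = h *\<^sub>R v" for h
        using \<chi>'(2)[of v] linear_simps(5)[OF has_derivative_bounded_linear[OF \<chi>'(1)]] by metis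
      ultimately show ?thesis by (simp add: has_vector_derivative_def)
    qed
    ultimately show ?thesis using s(1) unfolding tangent_space_def by blast
  qed
  ultimately show ?thesis using \<psi>'(1) by blast
qed

lemma chart_at:
  assumes "embedded_submanifold \<M>" "x \<in> \<M>"
  obtains U \<psi> V where "chart_at \<M> x = (U, \<psi>)" "x \<in> U" "slice_chart \<M> V U \<psi>"
proof -
  obtain U \<psi> where U: "chart_at \<M> x = (U, \<psi>)" by fastforce
  have "\<exists>p. case p of (U, \<psi>) \<Rightarrow> x \<in> U \<and> (\<exists>V. slice_chart \<M> V U \<psi>)"
    using assms unfolding embedded_submanifold_def by fast
  from someI_ex[OF this] have "x \<in> U \<and> (\<exists>V. slice_chart \<M> V U \<psi>)"
    using U unfolding chart_at_def by auto
  then show thesis using that U by blast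
qed

lemma subspace_tangent_space:
  fixes \<M> :: "'a::euclidean_space set"
  assumes "embedded_submanifold \<M>" "x \<in> \<M>"
  shows "subspace (tangent_space \<M> x)"
proof -
  obtain U \<psi> V where c: "x \<in> U" "slice_chart \<M> V U \<psi>" using chart_at[OF assms] by metis
  obtain \<psi>' \<chi>' where \<psi>': "\<psi>' = frechet_derivative \<psi> (at x)" "(\<psi> has_derivative \<psi>') (at x)"
    using slice_chart_derivatives[OF c(2,1)] by blast
  have "subspace (\<psi>' -` V)"
    using c(2) \<psi>'(2) by (auto intro!: linear_subspace_vimage has_derivative_linear simp: slice_chart_def)
  then show ?thesis
    using tangent_space_slice_chart[OF c(2,1) assms(2)] \<psi>'(1) by (simp add: vimage_def)
qed

section \<open>The Clarke tangent cone\<close>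

lemma tangent_cone_zero: "0 \<in> tangent_cone C x"
  unfolding tangent_cone_def by (auto intro!: exI[of _ "\<lambda>_. 0"])

text \<open>The factor moves into the step lengths: \<open>a * t j\<close> is again a positive null
  sequence.\<close>

lemma tangent_cone_scale:
  assumes w: "w \<in> tangent_cone C x" and a: "a \<ge> 0"
  shows "a *\<^sub>R w \<in> tangent_cone C x"
proof (cases "a = 0")
  case True
  then show ?thesis by (simp add: tangent_cone_zero)
next
  case False
  then have a: "a > 0" using a by simp
  show ?thesis unfolding tangent_cone_def
  proof clarify
    fix y and t :: "nat \<Rightarrow> real"
    assume y: "\<forall>j. y j \<in> C" "y \<longlonglongrightarrow> x" and t: "\<forall>j. 0 < t j" "t \<longlonglongrightarrow> 0"
    have "\<forall>j. a * t j > 0" "(\<lambda>j. a * t j) \<longlonglongrightarrow> 0"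
      using t a tendsto_mult_right_zero[OF t(2)] by auto
    then obtain z where z: "z \<longlonglongrightarrow> w" "\<And>j. y j + (a * t j) *\<^sub>R z j \<in> C"
      using w y unfolding tangent_cone_def mem_Collect_eq
      by (elim allE[of _ y] allE[of _ "\<lambda>j. a * t j"]) auto
    from tendsto_scaleR[OF tendsto_const[of a] z(1)] z(2)
    show "\<exists>z. z \<longlonglongrightarrow> a *\<^sub>R w \<and> (\<forall>j. y j + t j *\<^sub>R z j \<in> C)"
      by (intro exI[of _ "\<lambda>j. a *\<^sub>R z j"]) (simp add: mult.commute)
  qed
qed

text \<open>This is where it matters that the cone quantifies over all base sequences: the points
  \<open>y j + t j *\<^sub>R z j\<close> reached along \<open>w\<close> lie in \<open>C\<close>,
  converge to \<open>x\<close>, and serve as base sequence for \<open>w'\<close>.\<close>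

lemma tangent_cone_add:
  assumes w: "w \<in> tangent_cone C x" and w': "w' \<in> tangent_cone C x"
  shows "w + w' \<in> tangent_cone C x"
  unfolding tangent_cone_def
proof clarify
  fix y and t :: "nat \<Rightarrow> real"
  assume y: "\<forall>j. y j \<in> C" "y \<longlonglongrightarrow> x" and t: "\<forall>j. 0 < t j" "t \<longlonglongrightarrow> 0"
  then obtain z where z: "z \<longlonglongrightarrow> w" "\<And>j. y j + t j *\<^sub>R z j \<in> C"
    using w unfolding tangent_cone_def mem_Collect_eq by (elim allE[of _ y] allE[of _ t]) auto
  have "(\<lambda>j. y j + t j *\<^sub>R z j) \<longlonglongrightarrow> x + 0 *\<^sub>R w" using y t z by (intro tendsto_intros)
  then obtain z' where z': "z' \<longlonglongrightarrow> w'" "\<And>j. y j + t j *\<^sub>R z j + t j *\<^sub>R z' j \<in> C"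
    using w' z(2) t unfolding tangent_cone_def mem_Collect_eq
    by (elim allE[of _ "\<lambda>j. y j + t j *\<^sub>R z j"] allE[of _ t]) auto
  then show "\<exists>z. z \<longlonglongrightarrow> w + w' \<and> (\<forall>j. y j + t j *\<^sub>R z j \<in> C)"
    using tendsto_add[OF z(1) z'(1)]
    by (intro exI[of _ "\<lambda>j. z j + z' j"]) (simp add: scaleR_add_right add.assoc)
qed

lemma manifold_tangent_cone_convex:
  fixes \<M> :: "'a::euclidean_space set"
  assumes \<M>: "embedded_submanifold \<M>" and x: "x \<in> \<M>"
  shows "convex (manifold_tangent_cone \<M> S x)" "0 \<in> manifold_tangent_cone \<M> S x"
proof -
  obtain U \<psi> V where c: "chart_at \<M> x = (U, \<psi>)" "x \<in> U" "slice_chart \<M> V U \<psi>"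
    using chart_at[OF assms] by metis
  obtain \<psi>' \<chi>' where \<psi>': "\<psi>' = frechet_derivative \<psi> (at x)" "(\<psi> has_derivative \<psi>') (at x)"
    using slice_chart_derivatives[OF c(3,2)] by blast
  have lin: "linear \<psi>'" using \<psi>'(2) by (rule has_derivative_linear)
  have eq: "manifold_tangent_cone \<M> S x
      = {v \<in> tangent_space \<M> x. \<psi>' v \<in> tangent_cone (\<psi> ` (S \<inter> U)) (\<psi> x)}"
    unfolding manifold_tangent_cone_def c(1) \<psi>'(1) by simp
  note sub = subspace_tangent_space[OF assms]
  show "0 \<in> manifold_tangent_cone \<M> S x"
    unfolding eq using sub by (simp add: subspace_0 linear_0[OF lin] tangent_cone_zero)
  show "convex (manifold_tangent_cone \<M> S x)"
    unfolding eq
  proof (rule convexI, clarify, intro conjI)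
    fix v w :: 'a and a b :: real
    assume *: "v \<in> tangent_space \<M> x" "w \<in> tangent_space \<M> x" "0 \<le> a" "0 \<le> b"
      "\<psi>' v \<in> tangent_cone (\<psi> ` (S \<inter> U)) (\<psi> x)" "\<psi>' w \<in> tangent_cone (\<psi> ` (S \<inter> U)) (\<psi> x)"
    show "a *\<^sub>R v + b *\<^sub>R w \<in> tangent_space \<M> x"
      using sub * by (simp add: subspace_add subspace_scale)
    show "\<psi>' (a *\<^sub>R v + b *\<^sub>R w) \<in> tangent_cone (\<psi> ` (S \<inter> U)) (\<psi> x)"
      unfolding linear_add[OF lin] linear_cmul[OF lin]
      using * by (intro tangent_cone_add tangent_cone_scale)
  qed
qed

text \<open>The constant base sequence at \<open>\<psi> x\<close> yields points of \<open>S\<close>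
  seen in the chart, and the inverse chart carries them back. Their directions \<open>z j\<close>
  vary, hence the sequential form of differentiability.\<close>

lemma manifold_tangent_cone_sequence:
  fixes \<M> :: "'a::euclidean_space set"
  assumes \<M>: "embedded_submanifold \<M>" and S: "S \<subseteq> \<M>" and x: "x \<in> S"
    and v: "v \<in> manifold_tangent_cone \<M> S x"
  obtains t :: "nat \<Rightarrow> real" and y where "\<And>j. t j > 0" "t \<longlonglongrightarrow> 0" "y \<longlonglongrightarrow> v"
    "\<And>j. x + t j *\<^sub>R y j \<in> S"
proof -
  obtain U \<psi> V where c: "chart_at \<M> x = (U, \<psi>)" "x \<in> U" "slice_chart \<M> V U \<psi>"
    using chart_at[OF \<M>, of x] x S by (metis subsetD)
  obtain \<psi>' \<chi>' where \<psi>': "\<psi>' = frechet_derivative \<psi> (at x)" "(\<psi> has_derivative \<psi>') (at x)"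
    and \<chi>': "(inv_into U \<psi> has_derivative \<chi>') (at (\<psi> x))" "\<And>v. \<chi>' (\<psi>' v) = v"
    using slice_chart_derivatives[OF c(3,2)] by blast
  have U: "inj_on \<psi> U" using c(3) by (auto simp: slice_chart_def)
  have cone: "\<psi>' v \<in> tangent_cone (\<psi> ` (S \<inter> U)) (\<psi> x)"
    using v unfolding manifold_tangent_cone_def c(1) \<psi>'(1) by simp
  define t where "t = (\<lambda>j. inverse (real (Suc j)))"
  have t: "t \<longlonglongrightarrow> 0" "\<And>j. t j > 0"
    unfolding t_def using LIMSEQ_inverse_real_of_nat by auto
  obtain z where z: "z \<longlonglongrightarrow> \<psi>' v" "\<And>j. \<psi> x + t j *\<^sub>R z j \<in> \<psi> ` (S \<inter> U)"
    using cone x c(2) t unfolding tangent_cone_def mem_Collect_eq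
    by (elim allE[of _ "\<lambda>j. \<psi> x"] allE[of _ t]) auto
  \<comment> \<open>A difference quotient, so that \<open>x + t j *\<^sub>R y j\<close> is exactly
    the point of \<open>S\<close> delivered by the chart.\<close>
  define y where "y = (\<lambda>j. (inv_into U \<psi> (\<psi> x + t j *\<^sub>R z j) - x) /\<^sub>R t j)"
  have "y \<longlonglongrightarrow> v"
    using has_derivative_sequentially[OF \<chi>'(1) z(1) t] \<chi>'(2)[of v] U c(2) by (simp add: y_def)
  moreover have "x + t j *\<^sub>R y j \<in> S" for j
  proof -
    have "x + t j *\<^sub>R y j = inv_into U \<psi> (\<psi> x + t j *\<^sub>R z j)"
      using t(2)[of j] by (simp add: y_def)
    then show ?thesis using z(2)[of j] U by auto
  qed
  ultimately show thesis using that t by blast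
qed

section \<open>Separation and first-order conditions\<close>

text \<open>Separate the strict epigraph of \<open>\<rho> (x + v) - \<rho> x\<close> from the
  hypograph of \<open>- (a \<bullet> v)\<close> over \<open>T\<close>. The hyperplane is the graph
  of a linear function below the first and above the second; its slope is the required
  \<open>g\<close>.\<close>

lemma subgradient_sandwich:
  fixes \<rho> :: "'a::euclidean_space \<Rightarrow> real"
  assumes \<rho>: "convex_on UNIV \<rho>" and T: "convex T" "0 \<in> T"
    and dom: "\<And>v. v \<in> T \<Longrightarrow> \<rho> (x + v) - \<rho> x \<ge> - (a \<bullet> v)"
  obtains g where "\<And>y. \<rho> y \<ge> \<rho> x + g \<bullet> (y - x)" "\<And>v. v \<in> T \<Longrightarrow> (a + g) \<bullet> v \<ge> 0"
proof -
  define A where "A = {p :: 'a \<times> real. \<rho> (x + fst p) - \<rho> x < snd p}"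
  define B where "B = {p :: 'a \<times> real. fst p \<in> T \<and> snd p \<le> - (a \<bullet> fst p)}"
  have "convex A"
  proof (rule convexI)
    fix p q :: "'a \<times> real" and u v :: real
    assume pq: "p \<in> A" "q \<in> A" and uv: "0 \<le> u" "0 \<le> v" "u + v = 1"
    have "x + (u *\<^sub>R fst p + v *\<^sub>R fst q) = u *\<^sub>R (x + fst p) + v *\<^sub>R (x + fst q)"
      using uv(3) scaleR_add_left[of u v x] by (simp add: scaleR_add_right)
    then have "\<rho> (x + (u *\<^sub>R fst p + v *\<^sub>R fst q)) \<le> u * \<rho> (x + fst p) + v * \<rho> (x + fst q)"
      using \<rho> uv unfolding convex_on_def by auto
    moreover have "u * \<rho> x + v * \<rho> x = \<rho> x" using uv(3) by (metis distrib_right mult_1)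
    moreover have "u * (\<rho> (x + fst p) - \<rho> x) + v * (\<rho> (x + fst q) - \<rho> x) < u * snd p + v * snd q"
      using convex_bound_lt[of "\<rho> (x + fst p) - \<rho> x - snd p" 0 "\<rho> (x + fst q) - \<rho> x - snd q" u v]
        pq uv by (simp add: A_def right_diff_distrib)
    ultimately show "u *\<^sub>R p + v *\<^sub>R q \<in> A" unfolding A_def by (simp add: algebra_simps)
  qed
  moreover have "convex B"
  proof (rule convexI)
    fix p q :: "'a \<times> real" and u v :: real
    assume pq: "p \<in> B" "q \<in> B" and uv: "0 \<le> u" "0 \<le> v" "u + v = 1"
    have "u * snd p + v * snd q \<le> u * (- (a \<bullet> fst p)) + v * (- (a \<bullet> fst q))"
      using pq uv unfolding B_def by (intro add_mono mult_left_mono) auto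
    then show "u *\<^sub>R p + v *\<^sub>R q \<in> B"
      using pq uv T(1) unfolding B_def convex_def by (auto simp: inner_simps algebra_simps)
  qed
  moreover have "(0, 1) \<in> A" "(0, 0) \<in> B" using T(2) by (auto simp: A_def B_def)
  moreover have "A \<inter> B = {}" using dom by (force simp: A_def B_def)
  ultimately obtain n \<mu> where n: "n \<noteq> 0" "\<And>p. p \<in> A \<Longrightarrow> n \<bullet> p \<le> \<mu>" "\<And>p. p \<in> B \<Longrightarrow> n \<bullet> p \<ge> \<mu>"
    using separating_hyperplane_sets[of A B] by blast
  obtain w s where ws: "n = (w, s)" by fastforce
  have A': "w \<bullet> y + s * t \<le> \<mu>" if "\<rho> (x + y) - \<rho> x < t" for y t
    using n(2)[of "(y, t)"] that by (simp add: A_def ws inner_Pair)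
  have B': "w \<bullet> y + s * t \<ge> \<mu>" if "y \<in> T" "t \<le> - (a \<bullet> y)" for y t
    using n(3)[of "(y, t)"] that by (simp add: B_def ws inner_Pair)
  have "\<mu> \<le> 0" using B'[of 0 0] T(2) by simp
  \<comment> \<open>The hyperplane is not vertical: \<rho> is finite everywhere, so with
    \<open>s = 0\<close> the point over \<open>w\<close> itself would give
    \<open>w \<bullet> w \<le> 0\<close>.\<close>
  have "s < 0"
  proof -
    have "s \<le> 0" using A'[of 0 1] \<open>\<mu> \<le> 0\<close> by simp
    moreover have "s \<noteq> 0"
    proof
      assume "s = 0"
      then have "w \<bullet> w \<le> 0"
        using A'[of w "\<rho> (x + w) - \<rho> x + 1"] \<open>\<mu> \<le> 0\<close> by simp
      then have "w = 0" by (meson inner_ge_zero antisym inner_eq_zero_iff)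
      then show False using n(1) ws \<open>s = 0\<close> by (simp add: zero_prod_def)
    qed
    ultimately show ?thesis by simp
  qed
  \<comment> \<open>The origin is a limit of points of \<open>A\<close>: for negative \<mu> the
    height \<open>\<mu> / (2 * s)\<close> would be positive and give
    \<open>\<mu> / 2 \<le> \<mu>\<close>.\<close>
  have "\<mu> \<ge> 0"
  proof (rule ccontr)
    assume "\<not> \<mu> \<ge> 0"
    then show False using A'[of 0 "\<mu> / (2 * s)"] \<open>s < 0\<close> by (simp add: divide_neg_neg)
  qed
  with \<open>\<mu> \<le> 0\<close> have \<mu>: "\<mu> = 0" by simp
  define g where "g = (- 1 / s) *\<^sub>R w"
  have w: "w = (- s) *\<^sub>R g" using \<open>s < 0\<close> by (simp add: g_def)
  have "\<rho> y \<ge> \<rho> x + g \<bullet> (y - x)" for y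
  proof (rule field_le_epsilon)
    fix \<epsilon> :: real assume "\<epsilon> > 0"
    then have "- s * (g \<bullet> (y - x)) + s * (\<rho> y - \<rho> x + \<epsilon>) \<le> 0"
      using A'[of "y - x" "\<rho> y - \<rho> x + \<epsilon>"] \<mu> by (simp add: w)
    then have "s * (\<rho> y - \<rho> x + \<epsilon> - g \<bullet> (y - x)) \<le> 0" by (simp add: algebra_simps)
    then show "\<rho> x + g \<bullet> (y - x) \<le> \<rho> y + \<epsilon>" using \<open>s < 0\<close> by (simp add: mult_le_0_iff)
  qed
  moreover have "(a + g) \<bullet> v \<ge> 0" if "v \<in> T" for v
  proof -
    have "- s * (g \<bullet> v + a \<bullet> v) \<ge> 0"
      using B'[OF that order_refl] \<mu> by (simp add: w algebra_simps)
    then show ?thesis using \<open>s < 0\<close> by (simp add: inner_simps mult_le_0_iff)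
  qed
  ultimately show thesis using that by blast
qed

text \<open>In a subspace the variational inequality of the closest point may be tested with both
  \<open>v\<close> and \<open>- v\<close>, which turns it into an equality.\<close>

lemma closest_point_subspace:
  fixes T :: "'a::euclidean_space set"
  assumes T: "subspace T"
  shows "closest_point T a \<in> T" "v \<in> T \<Longrightarrow> closest_point T a \<bullet> v = a \<bullet> v"
proof -
  have cl: "closed T" "T \<noteq> {}" "convex T"
    using T closed_subspace subspace_0 subspace_imp_convex by auto
  show cp: "closest_point T a \<in> T" using closest_point_in_set cl by blast
  assume v: "v \<in> T"
  have "(a - closest_point T a) \<bullet> (y - closest_point T a) \<le> 0" if "y \<in> T" for y
    using closest_point_dot[of T y a] cl that by simp
  from this[of "closest_point T a + v"] this[of "closest_point T a - v"]
  show "closest_point T a \<bullet> v = a \<bullet> v"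
    using cp v T by (simp add: subspace_add subspace_diff inner_diff_left)
qed

text \<open>
  Convexity along the segment gives \<open>\<rho>(x + t v) - \<rho>(x) \<le> t (\<rho>(x + v) - \<rho>(x))\<close>, so one only compares
  \<open>\<rho>(x + v) - \<rho>(x)\<close> with the linear part on the convex tangent cone. A single separation then produces a
  subgradient that works for all tangent directions at once.
\<close>

lemma first_order_optimality:
  fixes \<rho> :: "'a::euclidean_space \<Rightarrow> real"
  assumes \<M>: "embedded_submanifold \<M>" and S: "S \<subseteq> \<M>" and x: "x \<in> S"
    and \<rho>: "convex_on UNIV \<rho>" and \<phi>: "GDERIV \<phi> x :> a"
    and min: "\<And>y. y \<in> S \<Longrightarrow> \<phi> x + \<rho> x \<le> \<phi> y + \<rho> y"
  obtains g where "\<And>y. \<rho> y \<ge> \<rho> x + g \<bullet> (y - x)"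
    "closest_point (tangent_space \<M> x) (- a - g) \<in> manifold_normal_cone \<M> S x"
proof -
  have x': "x \<in> \<M>" using S x by blast
  have cont: "continuous_on UNIV \<rho>" using convex_on_continuous[OF open_UNIV] \<rho> by blast
  have dom: "\<rho> (x + v) - \<rho> x \<ge> - (a \<bullet> v)" if v: "v \<in> manifold_tangent_cone \<M> S x" for v
  proof -
    obtain t :: "nat \<Rightarrow> real" and y where t: "\<And>j. t j > 0" "t \<longlonglongrightarrow> 0" and y: "y \<longlonglongrightarrow> v"
      and yS: "\<And>j. x + t j *\<^sub>R y j \<in> S"
      using manifold_tangent_cone_sequence[OF \<M> S x v] by blast
    have "(\<lambda>j. (\<phi> (x + t j *\<^sub>R y j) - \<phi> x) /\<^sub>R t j) \<longlonglongrightarrow> v \<bullet> a"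
      using has_derivative_sequentially[OF \<phi>[unfolded gderiv_def] y t(2,1)] .
    moreover have "isCont \<rho> (x + v)" using cont continuous_on_eq_continuous_at by blast
    then have "(\<lambda>j. \<rho> (x + y j)) \<longlonglongrightarrow> \<rho> (x + v)"
      by (rule isCont_tendsto_compose) (intro tendsto_intros y)
    ultimately have lim: "(\<lambda>j. (\<phi> (x + t j *\<^sub>R y j) - \<phi> x) /\<^sub>R t j + \<rho> (x + y j) - \<rho> x)
        \<longlonglongrightarrow> v \<bullet> a + \<rho> (x + v) - \<rho> x"
      by (intro tendsto_intros)
    \<comment> \<open>Convexity along the segment from \<open>x\<close> to \<open>x + y j\<close>
      requires \<open>t j \<le> 1\<close>.\<close>
    have "eventually (\<lambda>j. t j < 1) sequentially" by (rule order_tendstoD(2)[OF t(2) zero_less_one])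
    then have "eventually (\<lambda>j. 0 \<le> (\<phi> (x + t j *\<^sub>R y j) - \<phi> x) /\<^sub>R t j + \<rho> (x + y j) - \<rho> x) sequentially"
    proof eventually_elim
      case (elim j)
      have "x + t j *\<^sub>R y j = (1 - t j) *\<^sub>R x + t j *\<^sub>R (x + y j)" by (simp add: algebra_simps)
      then have "\<rho> (x + t j *\<^sub>R y j) \<le> (1 - t j) * \<rho> x + t j * \<rho> (x + y j)"
        using convex_onD[OF \<rho>, of "t j" x "x + y j"] t(1)[of j] elim by simp
      then have "\<rho> (x + t j *\<^sub>R y j) - \<rho> x \<le> t j * (\<rho> (x + y j) - \<rho> x)" by (simp add: algebra_simps)
      with min[OF yS[of j]] have "0 \<le> (\<phi> (x + t j *\<^sub>R y j) - \<phi> x) + t j * (\<rho> (x + y j) - \<rho> x)" by simp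
      then have "0 \<le> ((\<phi> (x + t j *\<^sub>R y j) - \<phi> x) + t j * (\<rho> (x + y j) - \<rho> x)) / t j"
        using t(1)[of j] by (simp add: zero_le_divide_iff)
      also have "\<dots> = (\<phi> (x + t j *\<^sub>R y j) - \<phi> x) /\<^sub>R t j + \<rho> (x + y j) - \<rho> x"
        using t(1)[of j] by (simp add: field_simps)
      finally show ?case .
    qed
    from tendsto_lowerbound[OF lim this] show ?thesis by (simp add: inner_commute)
  qed
  obtain g where g: "\<And>y. \<rho> y \<ge> \<rho> x + g \<bullet> (y - x)"
    "\<And>v. v \<in> manifold_tangent_cone \<M> S x \<Longrightarrow> (a + g) \<bullet> v \<ge> 0"
    using subgradient_sandwich[OF \<rho> manifold_tangent_cone_convex[OF \<M> x'] dom] by blast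
  note sub = subspace_tangent_space[OF \<M> x']
  \<comment> \<open>Cone directions are tangent, so projecting onto the tangent space preserves
    inner products with them.\<close>
  have "manifold_tangent_cone \<M> S x \<subseteq> tangent_space \<M> x"
    unfolding manifold_tangent_cone_def by (auto split: prod.splits)
  then have "closest_point (tangent_space \<M> x) (- a - g) \<bullet> v \<le> 0"
    if "v \<in> manifold_tangent_cone \<M> S x" for v
    using g(2)[OF that] closest_point_subspace(2)[OF sub, of v "- a - g"] that
    by (auto simp: inner_simps)
  then have "closest_point (tangent_space \<M> x) (- a - g) \<in> manifold_normal_cone \<M> S x"
    unfolding manifold_normal_cone_def using closest_point_subspace(1)[OF sub] by blast
  then show thesis using that g(1) by blast
qed

subsection \<open>Step sizes\<close>

text \<open>With \<open>g = 1 / \<gamma>\<close>, the descent coefficient times \<beta> is a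
  quadratic in \<open>g\<close> with discriminant \<Delta>, and the interval for \<gamma> says that
  \<open>g\<close> lies strictly between its roots. The last two bounds come from completing
  squares; they serve to compare the \<kappa> constants with one another.\<close>

lemma admm_step_sizes:
  fixes L \<beta> \<gamma> \<Delta> :: real
  assumes L: "L > 0" and Delta: "\<Delta> = 17 * \<beta>^2 - 16 * (L + 1) * \<beta> - 128 * L^2"
    and beta: "\<beta> > (8 * (L + 1) + 8 * sqrt ((L + 1)^2 + 34 * L^2)) / 17"
    and gamma: "\<gamma> \<in> {16 / (17 * \<beta> + sqrt \<Delta>) <..< 16 / (17 * \<beta> - sqrt \<Delta>)}"
  shows "\<beta> > 16 / 17" "\<beta> > 3 * L" "\<gamma> > 0"
    "(\<beta> + L) / 2 - 1 / \<gamma> + 8 / \<beta> * (\<beta> - 1 / \<gamma>)^2 + 4 * L^2 / \<beta> + 1 / 2 < 0"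
    "- ((\<beta> + L) / 2 - 1 / \<gamma> + 8 / \<beta> * (\<beta> - 1 / \<gamma>)^2 + 4 * L^2 / \<beta> + 1 / 2) \<le> \<beta>"
    "64 * ((\<beta> - 1 / \<gamma>)^2 + L^2) \<le> 9 * \<beta>^2"
proof -
  define S where "S = sqrt ((L + 1)^2 + 34 * L^2)"
  have S: "S \<ge> 0" "S^2 = (L + 1)^2 + 34 * L^2" by (auto simp: S_def)
  \<comment> \<open>The lower bound on \<beta> is the larger root of \<Delta> as a quadratic in
    \<beta>: \<open>17 * \<Delta>\<close> equals
    \<open>(17 * \<beta> - 8 * (L + 1))^2 - (8 * S)^2\<close>.\<close>
  have "17 * \<beta> - 8 * (L + 1) > 8 * S" using beta by (simp add: S_def field_simps)
  then have "(17 * \<beta> - 8 * (L + 1))^2 > (8 * S)^2" using S by (intro power_strict_mono) auto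
  then have D0: "\<Delta> > 0" using S(2) Delta by (simp add: power2_eq_square algebra_simps)
  have \<beta>0: "\<beta> > 0" using \<open>17 * \<beta> - 8 * (L + 1) > 8 * S\<close> S L by simp
  have "\<beta> * (17 * \<beta> - 16 * (L + 1)) > 0"
    using D0 zero_le_square[of L] unfolding Delta power2_eq_square
    by (simp only: algebra_simps)
  then have "17 * \<beta> - 16 * (L + 1) > 0" using \<beta>0 by (simp add: zero_less_mult_iff)
  then show "\<beta> > 16 / 17" using L by simp
  show "\<beta> > 3 * L"
  proof (rule ccontr)
    assume "\<not> \<beta> > 3 * L"
    \<comment> \<open>The second factor is chosen to reproduce the \<open>\<beta>^2\<close> and
      \<open>L * \<beta>\<close> terms of \<Delta>, leaving a negative remainder.\<close>
    then have "(3 * L - \<beta>) * (17 * \<beta> + 35 * L) \<ge> 0" using \<beta>0 L by simp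
    moreover have "\<Delta> = - ((3 * L - \<beta>) * (17 * \<beta> + 35 * L)) - 23 * L^2 - 16 * \<beta>"
      unfolding Delta by (simp add: power2_eq_square algebra_simps)
    ultimately show False using D0 \<beta>0 zero_le_power2[of L] by linarith
  qed
  define s where "s = sqrt \<Delta>"
  have s: "s > 0" "s^2 = \<Delta>" using D0 by (auto simp: s_def)
  have "s^2 < (17 * \<beta>)^2"
  proof -
    have "16 * (L + 1) * \<beta> > 0" "\<beta>^2 > 0" "L^2 \<ge> 0" using L \<beta>0 by auto
    moreover have "(17 * \<beta>)^2 = 289 * \<beta>^2" by (simp add: power_mult_distrib)
    ultimately show ?thesis using s(2) Delta by linarith
  qed
  then have s17: "s < 17 * \<beta>" by (rule power2_less_imp_less) (use \<beta>0 in simp)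
  have \<gamma>: "16 / (17 * \<beta> + s) < \<gamma>" "\<gamma> < 16 / (17 * \<beta> - s)" using gamma by (auto simp: s_def)
  have "0 < 16 / (17 * \<beta> + s)" using s(1) \<beta>0 by simp
  then show g0: "\<gamma> > 0" using \<gamma>(1) by (rule less_trans)
  define g where "g = 1 / \<gamma>"
  have "g < (17 * \<beta> + s) / 16" using \<gamma>(1) g0 s(1) \<beta>0 by (simp add: g_def field_simps)
  moreover have "g > (17 * \<beta> - s) / 16" using \<gamma>(2) g0 s(1) s17 by (simp add: g_def field_simps)
  ultimately have "\<bar>16 * g - 17 * \<beta>\<bar> < s" by (simp add: abs_less_iff)
  then have "(16 * g - 17 * \<beta>)^2 < \<Delta>" using s 
    using power_strict_mono[of "\<bar>16 * g - 17 * \<beta>\<bar>" s 2] by simp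
  then have key: "8 * (\<beta> - g)^2 - g * \<beta> + \<beta>^2 / 2 + L * \<beta> / 2 + \<beta> / 2 + 4 * L^2 < 0"
    unfolding Delta by (simp add: power2_eq_square algebra_simps)
  define q where "q = (\<beta> + L) / 2 - g + 8 / \<beta> * (\<beta> - g)^2 + 4 * L^2 / \<beta> + 1 / 2"
  have q: "q * \<beta> = 8 * (\<beta> - g)^2 - g * \<beta> + \<beta>^2 / 2 + L * \<beta> / 2 + \<beta> / 2 + 4 * L^2"
    using \<beta>0 by (simp add: q_def power2_eq_square field_simps)
  with key have "q * \<beta> < 0" by simp
  then have "q < 0" using \<beta>0 by (simp add: mult_less_0_iff)
  then show "(\<beta> + L) / 2 - 1 / \<gamma> + 8 / \<beta> * (\<beta> - 1 / \<gamma>)^2 + 4 * L^2 / \<beta> + 1 / 2 < 0"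
    by (simp add: q_def g_def)
  have nonneg: "L * \<beta> \<ge> 0" "L^2 \<ge> 0" "\<beta>^2 \<ge> 0" using L \<beta>0 by auto
  \<comment> \<open>Completing the square in \<open>\<beta> - g\<close>: at most
    \<open>17 / 32 * \<beta>^2\<close> survives.\<close>
  have "- q * \<beta> = \<beta>^2 - 15 / 32 * \<beta>^2 - 1 / 8 * (8 * (\<beta> - g) + \<beta> / 2)^2
      - (L * \<beta> / 2 + \<beta> / 2 + 4 * L^2)"
    using q by (simp add: power2_eq_square algebra_simps)
  moreover have "(8 * (\<beta> - g) + \<beta> / 2)^2 \<ge> 0" by simp
  ultimately have "- q * \<beta> \<le> \<beta>^2" using nonneg \<beta>0 by linarith
  then have "- q * \<beta> \<le> \<beta> * \<beta>" by (simp add: power2_eq_square)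
  then have "- q \<le> \<beta>" using \<beta>0 by (rule mult_right_le_imp_le)
  then show "- ((\<beta> + L) / 2 - 1 / \<gamma> + 8 / \<beta> * (\<beta> - 1 / \<gamma>)^2 + 4 * L^2 / \<beta> + 1 / 2) \<le> \<beta>"
    by (simp add: q_def g_def)
  \<comment> \<open>Sixteen times the negative quantity of \<open>key\<close> is added, so that the
    cross terms form a perfect square.\<close>
  have "64 * ((\<beta> - g)^2 + L^2) = 9 * \<beta>^2 - 16 * (2 * (\<beta> - g) + \<beta> / 4)^2 - 8 * \<beta> * (L + 1)
      + 16 * (8 * (\<beta> - g)^2 - g * \<beta> + \<beta>^2 / 2 + L * \<beta> / 2 + \<beta> / 2 + 4 * L^2)"
    by (simp add: power2_eq_square algebra_simps)
  moreover have "(2 * (\<beta> - g) + \<beta> / 4)^2 \<ge> 0" "8 * \<beta> * (L + 1) \<ge> 0" using L \<beta>0 by auto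
  moreover have "z \<le> 9 * w" if "z = 9 * w - 16 * u - v + 16 * y" "u \<ge> 0" "v \<ge> 0" "y < 0"
    for z w u v y :: real
    using that by linarith
  ultimately have "64 * ((\<beta> - g)^2 + L^2) \<le> 9 * \<beta>^2" using key by blast
  then show "64 * ((\<beta> - 1 / \<gamma>)^2 + L^2) \<le> 9 * \<beta>^2" by (simp add: g_def)
qed

subsection \<open>Gradients, norms and eigenvalues\<close>

text \<open>Along the segment, \<open>h\<close> is \<open>f\<close> minus its linear and quadratic
  model terms; the Lipschitz estimate makes its derivative nonpositive, so monotonicity replaces an
  integral remainder.\<close>

lemma descent_upper:
  fixes f :: "'a::real_inner \<Rightarrow> real"
  assumes grad: "\<And>y. GDERIV f y :> gradf y" and lip: "L-lipschitz_on UNIV gradf"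
  shows "f y \<le> f x + gradf x \<bullet> (y - x) + L / 2 * (norm (y - x))^2"
proof -
  define d where "d = y - x"
  define h where "h t = f (x + t *\<^sub>R d) - t * (gradf x \<bullet> d) - L / 2 * t^2 * (norm d)^2" for t
  have "h 1 \<le> h 0"
  proof (rule DERIV_nonpos_imp_nonincreasing[of 0 1 h])
    fix t :: real assume t: "0 \<le> t" "t \<le> 1"
    have "((\<lambda>t. f (x + t *\<^sub>R d)) has_derivative (\<lambda>s. (s *\<^sub>R d) \<bullet> gradf (x + t *\<^sub>R d))) (at t)"
      by (rule has_derivative_compose[of "\<lambda>t. x + t *\<^sub>R d" "\<lambda>s. s *\<^sub>R d" t UNIV f])
        (auto intro!: derivative_eq_intros grad[unfolded gderiv_def])
    then have "((\<lambda>t. f (x + t *\<^sub>R d)) has_real_derivative (d \<bullet> gradf (x + t *\<^sub>R d))) (at t)"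
      by (simp add: has_field_derivative_def mult.commute[of _ "_ \<bullet> _"])
    then have "(h has_real_derivative
        (d \<bullet> gradf (x + t *\<^sub>R d) - gradf x \<bullet> d - L * t * (norm d)^2)) (at t)"
      unfolding h_def by (auto intro!: derivative_eq_intros)
    moreover have "d \<bullet> gradf (x + t *\<^sub>R d) - gradf x \<bullet> d - L * t * (norm d)^2 \<le> 0"
    proof -
      have "d \<bullet> gradf (x + t *\<^sub>R d) - gradf x \<bullet> d = d \<bullet> (gradf (x + t *\<^sub>R d) - gradf x)"
        by (simp add: inner_diff_right inner_commute)
      also have "\<dots> \<le> norm d * norm (gradf (x + t *\<^sub>R d) - gradf x)" by (rule norm_cauchy_schwarz)
      also have "\<dots> \<le> norm d * (L * norm (t *\<^sub>R d))"
        using lipschitz_onD[OF lip, of "x + t *\<^sub>R d" x]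
        by (intro mult_left_mono) (auto simp: dist_norm)
      also have "\<dots> = L * t * (norm d)^2" using t by (simp add: power2_eq_square)
      finally show ?thesis by simp
    qed
    ultimately show "\<exists>y. (h has_real_derivative y) (at t) \<and> y \<le> 0" by blast
  qed simp
  then show ?thesis by (simp add: h_def d_def)
qed

text \<open>The upper estimate applied to \<open>f\<close> and to \<open>- f\<close>. The two-sided
  form later squeezes \<open>f\<close> along the run between integrable quadratics.\<close>

lemma descent_abs:
  fixes f :: "'a::real_inner \<Rightarrow> real"
  assumes grad: "\<And>y. GDERIV f y :> gradf y" and lip: "L-lipschitz_on UNIV gradf"
  shows "\<bar>f y - f x - gradf x \<bullet> (y - x)\<bar> \<le> L / 2 * (norm (y - x))^2"
proof -
  have "GDERIV (\<lambda>y. - f y) y :> - gradf y" for y using grad GDERIV_minus by blast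
  moreover have "L-lipschitz_on UNIV (\<lambda>y. - gradf y)"
    using lip by (auto simp: lipschitz_on_def dist_norm norm_minus_commute)
  ultimately have "- f y \<le> - f x + (- gradf x) \<bullet> (y - x) + L / 2 * (norm (y - x))^2"
    by (rule descent_upper)
  then show ?thesis
    using descent_upper[of f gradf L y x, OF grad lip] unfolding abs_le_iff inner_minus_left by linarith
qed

lemma inner_young:
  fixes u v :: "'a::real_inner"
  assumes "a > 0"
  shows "\<bar>u \<bullet> v\<bar> \<le> a / 2 * (norm u)^2 + 1 / (2 * a) * (norm v)^2"
proof -
  have "0 \<le> (a * norm u - norm v)^2" by simp
  then have "2 * a * (norm u * norm v) \<le> a^2 * (norm u)^2 + (norm v)^2"
    by (simp add: power2_eq_square algebra_simps)
  then have "norm u * norm v \<le> (a^2 * (norm u)^2 + (norm v)^2) / (2 * a)"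
    using assms by (simp add: pos_le_divide_eq mult.commute)
  also have "\<dots> = a / 2 * (norm u)^2 + 1 / (2 * a) * (norm v)^2"
    using assms by (simp add: field_simps power2_eq_square)
  finally show ?thesis using Cauchy_Schwarz_ineq2[of u v] by linarith
qed

lemma norm_add_sq_le:
  fixes u v :: "'a::real_inner"
  assumes "a > 0"
  shows "(norm (u + v))^2 \<le> (1 + a) * (norm u)^2 + (1 + 1 / a) * (norm v)^2"
proof -
  have "(norm (u + v))^2 = (norm u)^2 + (norm v)^2 + 2 * (u \<bullet> v)"
    by (simp add: power2_norm_eq_inner algebra_simps inner_commute)
  then show ?thesis using inner_young[OF assms, of u v] by (simp add: algebra_simps)
qed

lemma norm_add_sq_le2:
  fixes u v :: "'a::real_inner"
  shows "(norm (u + v))^2 \<le> 2 * (norm u)^2 + 2 * (norm v)^2"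
  using norm_add_sq_le[of 1 u v] by simp

text \<open>
  The smallest eigenvalue of \<open>H\<close> on \<open>E\<close> is its smallest singular value there, because \<open>H\<close> is symmetric
  and positive definite.
\<close>

lemma sigma_min_bounds:
  fixes H :: "real^'n^'n"
  assumes E: "subspace E" "E \<noteq> {0}" and HE: "\<And>v. v \<in> E \<Longrightarrow> H *v v \<in> E"
    and sym: "transpose H = H" and t: "t \<ge> 0" and H: "succ_scaled_id E H t"
  shows "sigma_min E H > t" "v \<in> E \<Longrightarrow> v \<bullet> (H *v v) \<ge> sigma_min E H * (norm v)^2"
proof -
  \<comment> \<open>The eigenvalue is found as the minimum of the Rayleigh quotient over the compact
    unit sphere of \<open>E\<close>.\<close>
  define Sp where "Sp = E \<inter> sphere 0 1"
  have selfadj: "v \<bullet> (H *v w) = (H *v v) \<bullet> w" for v w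
    using dot_lmul_matrix[of v H w] sym by (metis vector_transpose_matrix)
  have "compact Sp" unfolding Sp_def using E(1) closed_subspace by (intro closed_Int_compact) auto
  moreover have "Sp \<noteq> {}"
  proof -
    obtain w where w: "w \<in> E" "w \<noteq> 0" using E subspace_0 by blast
    then have "(1 / norm w) *\<^sub>R w \<in> Sp" using E(1) by (simp add: Sp_def subspace_scale)
    then show ?thesis by blast
  qed
  moreover have "continuous_on Sp (\<lambda>v. v \<bullet> (H *v v))"
    by (intro continuous_intros matrix_vector_mult_linear_continuous_on)
  ultimately obtain v0 where v0: "v0 \<in> Sp" "\<And>v. v \<in> Sp \<Longrightarrow> v0 \<bullet> (H *v v0) \<le> v \<bullet> (H *v v)"
    using continuous_attains_inf by metis
  define \<mu> where "\<mu> = v0 \<bullet> (H *v v0)"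
  have v0': "v0 \<in> E" "norm v0 = 1" "v0 \<noteq> 0" using v0(1) by (auto simp: Sp_def)
  have vv: "v0 \<bullet> v0 = 1" using v0'(2) by (simp add: dot_square_norm)
  have \<mu>t: "\<mu> > t" using H v0' vv unfolding succ_scaled_id_def \<mu>_def by force
  have ray: "v \<bullet> (H *v v) \<ge> \<mu> * (v \<bullet> v)" if "v \<in> E" for v
  proof (cases "v = 0")
    case False
    then have "(1 / norm v) *\<^sub>R v \<in> Sp" using that E(1) by (simp add: Sp_def subspace_scale)
    from v0(2)[OF this] have "\<mu> \<le> v \<bullet> (H *v v) / (norm v)^2"
      by (simp add: \<mu>_def matrix_vector_mult_scaleR power2_eq_square)
    then show ?thesis using False by (simp add: field_simps power2_norm_eq_inner)
  qed simp
  \<comment> \<open>Perturb the minimizer by its own residual \<open>z\<close>: the quadratic in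
    \<open>t\<close> is nonnegative and vanishes at \<open>t = 0\<close>, so its linear coefficient
    \<open>2 * (z \<bullet> z)\<close> must vanish.\<close>
  have eig: "H *v v0 = \<mu> *\<^sub>R v0"
  proof -
    define z where "z = H *v v0 - \<mu> *\<^sub>R v0"
    have z: "z \<in> E" using E(1) HE v0' by (simp add: z_def subspace_diff subspace_scale)
    define q where "q = z \<bullet> (H *v z) - \<mu> * (z \<bullet> z)"
    have q0: "q \<ge> 0" using ray[OF z] by (simp add: q_def)
    have poly: "0 \<le> t^2 * q + 2 * t * (z \<bullet> z)" for t :: real
    proof -
      have "v0 + t *\<^sub>R z \<in> E" using E(1) v0' z by (simp add: subspace_add subspace_scale)
      from ray[OF this] have "0 \<le> (v0 + t *\<^sub>R z) \<bullet> (H *v (v0 + t *\<^sub>R z))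
          - \<mu> * ((v0 + t *\<^sub>R z) \<bullet> (v0 + t *\<^sub>R z))" by simp
      also have "\<dots> = (v0 \<bullet> (H *v v0) - \<mu> * (v0 \<bullet> v0)) + t * (z \<bullet> (H *v v0) + v0 \<bullet> (H *v z)
          - 2 * \<mu> * (z \<bullet> v0)) + t^2 * q"
        unfolding q_def
        by (simp add: matrix_vector_right_distrib matrix_vector_mult_scaleR inner_simps
            power2_eq_square algebra_simps inner_commute[of v0 z])
      also have "v0 \<bullet> (H *v z) = z \<bullet> (H *v v0)" using selfadj[of v0 z] by (simp add: inner_commute)
      also have "z \<bullet> (H *v v0) + z \<bullet> (H *v v0) - 2 * \<mu> * (z \<bullet> v0) = 2 * (z \<bullet> z)"
        unfolding z_def[of] by (simp add: inner_diff_right z_def)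
      finally show ?thesis using vv by (simp add: \<mu>_def algebra_simps)
    qed
    have "z \<bullet> z = 0"
    proof (rule ccontr)
      assume "z \<bullet> z \<noteq> 0"
      then have p: "z \<bullet> z > 0" by simp
      \<comment> \<open>Negative, and small enough for the linear term to dominate;
        \<open>q + 1\<close> keeps the denominator positive when \<open>q = 0\<close>.\<close>
      define t where "t = - (z \<bullet> z) / (q + 1)"
      have "t * (t * q + 2 * (z \<bullet> z)) \<ge> 0" using poly[of t] by (simp add: power2_eq_square algebra_simps)
      moreover have "t < 0" using p q0 by (simp add: t_def divide_neg_pos)
      ultimately have "t * q + 2 * (z \<bullet> z) \<le> 0" by (simp add: zero_le_mult_iff)
      moreover have "t * q \<ge> - (z \<bullet> z)" using p q0 by (simp add: t_def field_simps)
      ultimately show False using p by simp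
    qed
    then show ?thesis by (simp add: z_def)
  qed
  define \<Sigma> where "\<Sigma> = {s. 0 \<le> s \<and> (\<exists>v\<in>E. v \<noteq> 0 \<and> (transpose H ** H) *v v = s^2 *\<^sub>R v)}"
  have HH: "(transpose H ** H) *v v = H *v (H *v v)" for v
    by (simp add: sym matrix_vector_mul_assoc)
  have "\<mu> \<in> \<Sigma>"
    unfolding \<Sigma>_def HH using \<mu>t t v0' eig
    by (auto intro!: bexI[of _ v0] simp: matrix_vector_mult_scaleR power2_eq_square)
  moreover have "s \<ge> \<mu>" if s: "s \<in> \<Sigma>" for s
  proof -
    obtain v where v: "s \<ge> 0" "v \<in> E" "v \<noteq> 0" "H *v (H *v v) = s^2 *\<^sub>R v"
      using s unfolding \<Sigma>_def HH by blast
    have "(norm (H *v v))^2 = v \<bullet> (H *v (H *v v))"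
      by (simp add: power2_norm_eq_inner selfadj)
    also have "\<dots> = (s * norm v)^2"
      by (simp add: v(4) power_mult_distrib power2_norm_eq_inner)
    finally have "norm (H *v v) = s * norm v" using v(1) by (simp add: power2_eq_iff_nonneg)
    then have "\<mu> * (v \<bullet> v) \<le> norm v * (s * norm v)"
      using ray[OF v(2)] norm_cauchy_schwarz[of v "H *v v"] by simp
    then have "\<mu> * (norm v)^2 \<le> s * (norm v)^2"
      by (simp add: power2_norm_eq_inner[symmetric] power2_eq_square mult_ac)
    then show ?thesis using v(3) by simp
  qed
  \<comment> \<open>\<open>Min\<close> needs a finite set: eigenvectors belonging to distinct
    nonnegative \<open>s\<close> are orthogonal, hence independent.\<close>
  moreover have "finite \<Sigma>"
  proof -
    have "\<forall>s\<in>\<Sigma>. \<exists>v. v \<noteq> 0 \<and> H *v (H *v v) = s^2 *\<^sub>R v" unfolding \<Sigma>_def HH by blast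
    from bchoice[OF this] obtain w
      where w: "\<And>s. s \<in> \<Sigma> \<Longrightarrow> w s \<noteq> 0 \<and> H *v (H *v w s) = s^2 *\<^sub>R w s"
      by blast
    have orth: "w s \<bullet> w s' = 0" if "s \<in> \<Sigma>" "s' \<in> \<Sigma>" "s \<noteq> s'" for s s'
    proof -
      have "s^2 * (w s \<bullet> w s') = (H *v (H *v w s)) \<bullet> w s'" using w that by simp
      also have "\<dots> = w s \<bullet> (H *v (H *v w s'))" by (simp add: selfadj)
      also have "\<dots> = s'^2 * (w s \<bullet> w s')" using w that by simp
      finally have "s^2 = s'^2 \<or> w s \<bullet> w s' = 0" by auto
      then show ?thesis using that by (auto simp: \<Sigma>_def power2_eq_iff_nonneg)
    qed
    have "inj_on w \<Sigma>"
    proof (rule inj_onI, rule ccontr)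
      fix s s' assume "s \<in> \<Sigma>" "s' \<in> \<Sigma>" "w s = w s'" "s \<noteq> s'"
      then show False using orth[of s s'] w[of s] by simp
    qed
    moreover have "pairwise orthogonal (w ` \<Sigma>)"
      unfolding pairwise_def orthogonal_def using orth by blast
    then have "independent (w ` \<Sigma>)" by (rule pairwise_orthogonal_independent) (use w in force)
    then have "finite (w ` \<Sigma>)" by (rule independent_imp_finite)
    ultimately show ?thesis using finite_imageD by blast
  qed
  ultimately have "Min \<Sigma> = \<mu>" by (intro Min_eqI) auto
  then have sm: "sigma_min E H = \<mu>" by (simp add: sigma_min_def \<Sigma>_def)
  show "sigma_min E H > t" using sm \<mu>t by simp
  show "v \<bullet> (H *v v) \<ge> sigma_min E H * (norm v)^2" if "v \<in> E"
    using ray[OF that] sm by (simp add: power2_norm_eq_inner)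
qed

lemma spectral_norm: "norm (A *v x) \<le> spectral_norm A * norm x"
  unfolding spectral_norm_def by (rule onorm) (rule matrix_vector_mul_bounded_linear)

lemma spectral_norm_nonneg: "spectral_norm A \<ge> 0"
  unfolding spectral_norm_def by (rule onorm_pos_le) (rule matrix_vector_mul_bounded_linear)

text \<open>Moving the transpose across the inner product of \<open>z\<close> with itself leaves one
  factor \<open>norm z\<close> to cancel. Thus both factors in \<kappa>3 can be expressed by the
  norms of the blocks themselves.\<close>

lemma spectral_norm_transpose: "norm (transpose A *v y) \<le> spectral_norm A * norm y"
proof -
  define z where "z = transpose A *v y"
  have "norm z * norm z = z \<bullet> z" by (simp add: power2_norm_eq_inner[symmetric] power2_eq_square)
  also have "\<dots> = y \<bullet> (A *v z)" unfolding z_def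
    using dot_lmul_matrix[of y A] by (metis vector_transpose_matrix transpose_transpose)
  also have "\<dots> \<le> norm y * norm (A *v z)" by (rule norm_cauchy_schwarz)
  also have "\<dots> \<le> norm y * (spectral_norm A * norm z)" by (intro mult_left_mono spectral_norm) auto
  finally have "norm z * norm z \<le> (spectral_norm A * norm y) * norm z" by (simp only: mult_ac)
  moreover have "spectral_norm A * norm y \<ge> 0" using spectral_norm_nonneg[of A] by simp
  ultimately show ?thesis unfolding z_def[symmetric]
    by (metis mult_right_le_imp_le norm_ge_zero order_le_less)
qed

subsection \<open>Blocks\<close>

lemma subspace_block_space: "subspace (block_space c i)"
  by (auto simp: subspace_def block_space_def)

lemma block_simps:
  "block c i (x + y) = block c i x + block c i y" "block c i (x - y) = block c i x - block c i y"
  "block c i (- x) = - block c i x" "block c i (a *\<^sub>R x) = a *\<^sub>R block c i x" "block c i 0 = 0"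
  by (auto simp: block_def vec_eq_iff)

lemma bounded_linear_block: "bounded_linear (block c i)"
  by (intro linear_conv_bounded_linear[THEN iffD1] linearI) (simp_all add: block_simps)

lemma block_mem: "block c i x \<in> block_space c i"
  by (simp add: block_def block_space_def)

lemma block_id: "x \<in> block_space c i \<Longrightarrow> block c i x = x"
  by (auto simp: block_def block_space_def vec_eq_iff)

lemma block_block: "block c i (block c j x) = (if i = j then block c i x else 0)"
  by (auto simp: block_def vec_eq_iff)

lemma inner_block: "block c i x \<bullet> y = x \<bullet> block c i y"
  by (simp add: inner_vec_def block_def if_distrib if_distribR cong: if_cong)

lemma inner_block_space: "y \<in> block_space c i \<Longrightarrow> block c i x \<bullet> y = x \<bullet> y"
  by (simp add: inner_block block_id)

lemma norm_block_le: "norm (block c i x) \<le> norm x"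
proof -
  have "(norm (block c i x))^2 = x \<bullet> block c i x"
    by (simp add: power2_norm_eq_inner inner_block block_block)
  also have "\<dots> \<le> norm x * norm (block c i x)" by (rule norm_cauchy_schwarz)
  finally show ?thesis by (cases "block c i x = 0") (auto simp: power2_eq_square)
qed

lemma sum_block:
  assumes "range c \<subseteq> I" "finite I"
  shows "(\<Sum>i\<in>I. block c i x) = x"
proof -
  have "(\<Sum>i\<in>I. block c i x) $ j = x $ j" for j
  proof -
    have "(\<Sum>i\<in>I. block c i x) $ j = (\<Sum>i\<in>I. if i = c j then x $ j else 0)"
      by (auto simp: block_def intro!: sum.cong)
    then show ?thesis using assms by (simp add: sum.delta image_subset_iff)
  qed
  then show ?thesis by (simp add: vec_eq_iff)
qed

lemma sum_norm_block:
  assumes "range c \<subseteq> I" "finite I"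
  shows "(\<Sum>i\<in>I. (norm (block c i x))^2) = (norm x)^2"
proof -
  have "(\<Sum>i\<in>I. (norm (block c i x))^2) = x \<bullet> (\<Sum>i\<in>I. block c i x)"
    by (simp add: power2_norm_eq_inner inner_block block_block inner_sum_right)
  then show ?thesis by (simp add: sum_block[OF assms] power2_norm_eq_inner)
qed

lemma sweep_Suc: "sweep c (Suc i) u v = sweep c i u v + block c i (u - v)"
  by (auto simp: sweep_def block_def vec_eq_iff less_Suc_eq)

lemma sweep_below: "range c \<subseteq> {1..N} \<Longrightarrow> i \<le> 1 \<Longrightarrow> sweep c i u v = v"
  by (simp add: sweep_def vec_eq_iff image_subset_iff) (meson leD le_trans)

lemma sweep_above: "range c \<subseteq> {1..N} \<Longrightarrow> i > N \<Longrightarrow> sweep c i u v = u"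
  by (simp add: sweep_def vec_eq_iff image_subset_iff) (meson le_less_trans)

lemma block_sweep: "block c j (sweep c i u v) = block c j (if j < i then u else v)"
  by (auto simp: sweep_def block_def vec_eq_iff)

lemma put_block_eq: "y \<in> block_space c i \<Longrightarrow> put_block c i y x = x + (y - block c i x)"
  by (auto simp: put_block_def block_def block_space_def vec_eq_iff)

lemma put_block_sweep: "put_block c i (block c i u) (sweep c i u v) = sweep c (Suc i) u v"
  by (auto simp: sweep_def block_def put_block_def vec_eq_iff less_Suc_eq)

lemma put_block_self: "put_block c i (block c i x) x = x"
  by (auto simp: block_def put_block_def vec_eq_iff)

lemma block_cols_mult: "block_cols c i A *v x = A *v block c i x"
  by (auto simp: block_cols_def block_def matrix_vector_mult_def vec_eq_iff intro!: sum.cong)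

lemma transpose_block_cols_mult: "transpose (block_cols c i A) *v y = block c i (transpose A *v y)"
  by (auto simp: block_cols_def block_def matrix_vector_mult_def transpose_def vec_eq_iff intro!: sum.cong)

lemma last_block_simps:
  "last_block e (x + y) = last_block e x + last_block e y"
  "last_block e (x - y) = last_block e x - last_block e y"
  "last_block e (a *\<^sub>R x) = a *\<^sub>R last_block e x"
  by (auto simp: last_block_def vec_eq_iff)

lemma bounded_linear_last_block: "bounded_linear (last_block e)"
  by (intro linear_conv_bounded_linear[THEN iffD1] linearI) (simp_all add: last_block_simps)

text \<open>The coordinates listed by \<open>e\<close> are exactly those of block \<open>N\<close>,
  each once, so reindexing the inner product along \<open>e\<close> is the whole argument.\<close>

lemma
  assumes e: "bij_betw e UNIV {j. c j = N}"
  shows last_block_block: "last_block e (block c N x) = last_block e x"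
    and inner_last_block: "last_block e x \<bullet> last_block e y = block c N x \<bullet> block c N y"
    and norm_last_block: "norm (last_block e x) = norm (block c N x)"
proof -
  have ce: "c (e l) = N" for l using e by (auto simp: bij_betw_def)
  then show "last_block e (block c N x) = last_block e x"
    by (simp add: last_block_def block_def vec_eq_iff)
  have *: "last_block e x \<bullet> last_block e y = block c N x \<bullet> block c N y" for x y
  proof -
    have "block c N x \<bullet> block c N y = (\<Sum>j\<in>UNIV. if c j = N then x $ j * y $ j else 0)"
      by (auto simp: inner_vec_def block_def intro!: sum.cong)
    also have "\<dots> = (\<Sum>j | c j = N. x $ j * y $ j)"
      by (simp add: sum.If_cases)
    also have "\<dots> = (\<Sum>l\<in>UNIV. x $ (e l) * y $ (e l))"
      using sum.reindex_bij_betw[OF e, of "\<lambda>j. x $ j * y $ j"] by simp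
    finally show ?thesis by (simp add: last_block_def inner_vec_def)
  qed
  show "last_block e x \<bullet> last_block e y = block c N x \<bullet> block c N y" by (rule *)
  show "norm (last_block e x) = norm (block c N x)" using *[of x x] by (simp add: norm_eq_sqrt_inner)
qed

lemma
  fixes A :: "real^'n^'m"
  assumes e: "bij_betw e UNIV {j. c j = N}" and A: "\<And>k l. A $ k $ (e l) = (if k = l then 1 else 0)"
  shows mult_last_block: "w \<in> block_space c N \<Longrightarrow> A *v w = last_block e w"
    and last_block_transpose: "last_block e (transpose A *v y) = y"
proof -
  assume w: "w \<in> block_space c N"
  have "(\<Sum>j\<in>UNIV. A $ k $ j * w $ j) = w $ (e k)" for k
  proof -
    have "(\<Sum>j\<in>UNIV. A $ k $ j * w $ j) = (\<Sum>j | c j = N. A $ k $ j * w $ j)"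
      using w by (intro sum.mono_neutral_right) (auto simp: block_space_def)
    also have "\<dots> = (\<Sum>l\<in>UNIV. A $ k $ (e l) * w $ (e l))"
      using sum.reindex_bij_betw[OF e, of "\<lambda>j. A $ k $ j * w $ j"] by simp
    also have "\<dots> = (\<Sum>l\<in>UNIV. if k = l then w $ (e l) else 0)"
      by (intro sum.cong) (auto simp: A)
    finally show ?thesis by simp
  qed
  then show "A *v w = last_block e w" by (simp add: matrix_vector_mult_def last_block_def vec_eq_iff)
next
  have "(\<Sum>k\<in>UNIV. A $ k $ (e l) * y $ k) = (\<Sum>k\<in>UNIV. if k = l then y $ k else 0)" for l
    by (intro sum.cong) (auto simp: A)
  then show "last_block e (transpose A *v y) = y"
    by (simp add: matrix_vector_mult_def last_block_def transpose_def vec_eq_iff)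
qed

lemma block_matrix_mult:
  assumes H: "block_matrix c i H"
  shows "H *v v \<in> block_space c i"
  using H unfolding block_matrix_def block_space_def matrix_vector_mult_def
  by (auto intro!: sum.neutral) blast

text \<open>The identity block preserves norms, so any nonzero vector is a witness. This bounds
  \<kappa>3 below in terms of \<beta>, whatever the other blocks are.\<close>

lemma spectral_norm_last_block:
  fixes A :: "real^'n^'m"
  assumes e: "bij_betw e UNIV {j. c j = N}" and A: "\<And>k l. A $ k $ (e l) = (if k = l then 1 else 0)"
  shows "spectral_norm (block_cols c N A) \<ge> 1"
proof -
  define y :: "real^'m" where "y = 1"
  define w where "w = block c N (transpose A *v y)"
  have "norm (block_cols c N A *v w) = norm w" and "norm w = norm y"
    using mult_last_block[OF e A, of w] norm_last_block[OF e, of w] norm_last_block[OF e, of "transpose A *v y"]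
    unfolding w_def block_cols_mult
    by (simp_all only: block_block block_mem last_block_block[OF e] last_block_transpose[OF e A] if_True refl)
  moreover have "y \<noteq> 0" by (simp add: y_def)
  ultimately have "1 * norm w \<le> spectral_norm (block_cols c N A) * norm w" "norm w > 0"
    using spectral_norm[of "block_cols c N A" w] by auto
  then show ?thesis using mult_le_cancel_right_pos by blast
qed

subsection \<open>Square-integrable random vectors\<close>

text \<open>A class closed under everything the algorithm does: sums, linear maps and the Lipschitz
  gradient. Measurability is a separate conjunct because it does not follow from that of the
  norm.\<close>

definition sq_integrable :: "'w measure \<Rightarrow> ('w \<Rightarrow> 'a::euclidean_space) \<Rightarrow> bool" where
  "sq_integrable P X \<longleftrightarrow> X \<in> borel_measurable P \<and> integrable P (\<lambda>\<omega>. (norm (X \<omega>))^2)"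

lemma sq_integrableD:
  "sq_integrable P X \<Longrightarrow> X \<in> borel_measurable P"
  "sq_integrable P X \<Longrightarrow> integrable P (\<lambda>\<omega>. (norm (X \<omega>))^2)"
  by (auto simp: sq_integrable_def)

lemma sq_integrable_bound:
  assumes "X \<in> borel_measurable P" "integrable P q" "\<And>\<omega>. \<omega> \<in> space P \<Longrightarrow> (norm (X \<omega>))^2 \<le> q \<omega>"
  shows "sq_integrable P X"
  unfolding sq_integrable_def
proof
  show "integrable P (\<lambda>\<omega>. (norm (X \<omega>))^2)"
    by (rule Bochner_Integration.integrable_bound[OF assms(2)])
      (use assms in \<open>auto intro!: AE_I2 order_trans[OF assms(3) abs_ge_self]\<close>)
qed fact

lemma sq_integrable_nn_integral:
  assumes X: "X \<in> borel_measurable P" and c: "c \<ge> 0"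
    and le: "(\<integral>\<^sup>+\<omega>. ennreal ((norm (X \<omega>))^2) \<partial>P) \<le> ennreal c"
  shows "sq_integrable P X" "(\<integral>\<omega>. (norm (X \<omega>))^2 \<partial>P) \<le> c"
proof -
  have "(\<integral>\<^sup>+\<omega>. ennreal (norm ((norm (X \<omega>))^2)) \<partial>P) < \<infinity>"
    using le_less_trans[OF le ennreal_less_top] by simp
  then have int: "integrable P (\<lambda>\<omega>. (norm (X \<omega>))^2)"
    using X by (intro integrableI_bounded) auto
  then show "sq_integrable P X" using X by (simp add: sq_integrable_def)
  have "ennreal (\<integral>\<omega>. (norm (X \<omega>))^2 \<partial>P) \<le> ennreal c"
    using le nn_integral_eq_integral[OF int] by simp
  then show "(\<integral>\<omega>. (norm (X \<omega>))^2 \<partial>P) \<le> c" using c by simp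
qed

lemma sq_integrable_add:
  assumes X: "sq_integrable P X" and Y: "sq_integrable P Y"
  shows "sq_integrable P (\<lambda>\<omega>. X \<omega> + Y \<omega>)"
proof (rule sq_integrable_bound)
  show "integrable P (\<lambda>\<omega>. 2 * (norm (X \<omega>))^2 + 2 * (norm (Y \<omega>))^2)"
    using X Y by (intro Bochner_Integration.integrable_add integrable_mult_right) (auto dest: sq_integrableD)
  show "(\<lambda>\<omega>. X \<omega> + Y \<omega>) \<in> borel_measurable P"
    using X Y by (intro borel_measurable_add sq_integrableD)
  show "(norm (X \<omega> + Y \<omega>))^2 \<le> 2 * (norm (X \<omega>))^2 + 2 * (norm (Y \<omega>))^2" for \<omega>
    using norm_add_sq_le[of 1 "X \<omega>" "Y \<omega>"] by simp
qed

lemma sq_integrable_linear: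
  fixes h :: "'a::euclidean_space \<Rightarrow> 'b::euclidean_space"
  assumes h: "bounded_linear h" and X: "sq_integrable P X"
  shows "sq_integrable P (\<lambda>\<omega>. h (X \<omega>))"
proof -
  obtain C where C: "\<And>x. norm (h x) \<le> norm x * C" using bounded_linear.bounded[OF h] by blast
  show ?thesis
  proof (rule sq_integrable_bound)
    show "integrable P (\<lambda>\<omega>. C^2 * (norm (X \<omega>))^2)" using X by (auto dest: sq_integrableD)
    show "(\<lambda>\<omega>. h (X \<omega>)) \<in> borel_measurable P"
      using borel_measurable_continuous_onI[OF linear_continuous_on[OF h, of UNIV]] sq_integrableD(1)[OF X]
      by (rule measurable_compose[rotated])
    show "(norm (h (X \<omega>)))^2 \<le> C^2 * (norm (X \<omega>))^2" for \<omega>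
      using power_mono[OF C[of "X \<omega>"], of 2] by (simp add: power_mult_distrib mult.commute)
  qed
qed

lemma sq_integrable_scaleR: "sq_integrable P X \<Longrightarrow> sq_integrable P (\<lambda>\<omega>. a *\<^sub>R X \<omega>)"
  by (rule sq_integrable_linear[OF bounded_linear_scaleR_right])

lemma sq_integrable_diff:
  "sq_integrable P X \<Longrightarrow> sq_integrable P Y \<Longrightarrow> sq_integrable P (\<lambda>\<omega>. X \<omega> - Y \<omega>)"
  using sq_integrable_add[of P X "\<lambda>\<omega>. (- 1) *\<^sub>R Y \<omega>"] sq_integrable_scaleR[of P Y "- 1"] by simp

lemma sq_integrable_const: "finite_measure P \<Longrightarrow> sq_integrable P (\<lambda>\<omega>. a)"
  by (simp add: sq_integrable_def finite_measure.integrable_const)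

text \<open>Lipschitz growth controls \<open>h - h 0\<close>; the constant \<open>h 0\<close> is
  square integrable since the measure is finite.\<close>

lemma sq_integrable_lipschitz:
  fixes h :: "'a::euclidean_space \<Rightarrow> 'b::euclidean_space"
  assumes P: "finite_measure P" and h: "L-lipschitz_on UNIV h" and X: "sq_integrable P X"
  shows "sq_integrable P (\<lambda>\<omega>. h (X \<omega>))"
proof -
  have meas: "(\<lambda>\<omega>. h (X \<omega>)) \<in> borel_measurable P"
    using borel_measurable_continuous_onI[OF lipschitz_on_continuous_on[OF h]] sq_integrableD(1)[OF X]
    by (rule measurable_compose[rotated])
  have "sq_integrable P (\<lambda>\<omega>. h (X \<omega>) - h 0)"
  proof (rule sq_integrable_bound)
    show "integrable P (\<lambda>\<omega>. L^2 * (norm (X \<omega>))^2)" using X by (auto dest: sq_integrableD)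
    show "(\<lambda>\<omega>. h (X \<omega>) - h 0) \<in> borel_measurable P" using meas by simp
    show "(norm (h (X \<omega>) - h 0))^2 \<le> L^2 * (norm (X \<omega>))^2" for \<omega>
      using power_mono[OF lipschitz_onD[OF h, of "X \<omega>" 0], of 2]
      by (simp add: power_mult_distrib dist_norm)
  qed
  from sq_integrable_add[OF this sq_integrable_const[OF P, of "h 0"]] show ?thesis by simp
qed

lemma sq_integrable_inner:
  assumes X: "sq_integrable P X" and Y: "sq_integrable P Y"
  shows "integrable P (\<lambda>\<omega>. X \<omega> \<bullet> Y \<omega>)"
proof (rule Bochner_Integration.integrable_bound)
  show "integrable P (\<lambda>\<omega>. 1 / 2 * (norm (X \<omega>))^2 + 1 / (2 * 1) * (norm (Y \<omega>))^2)"
    using X Y by (intro Bochner_Integration.integrable_add integrable_mult_right) (auto dest: sq_integrableD)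
  show "(\<lambda>\<omega>. X \<omega> \<bullet> Y \<omega>) \<in> borel_measurable P"
    using X Y by (intro borel_measurable_inner sq_integrableD)
  show "AE \<omega> in P. norm (X \<omega> \<bullet> Y \<omega>) \<le> norm (1 / 2 * (norm (X \<omega>))^2 + 1 / (2 * 1) * (norm (Y \<omega>))^2)"
  proof (rule AE_I2)
    fix \<omega>
    show "norm (X \<omega> \<bullet> Y \<omega>) \<le> norm (1 / 2 * (norm (X \<omega>))^2 + 1 / (2 * 1) * (norm (Y \<omega>))^2)"
      using inner_young[of 1 "X \<omega>" "Y \<omega>"] by simp
  qed
qed

lemma integrable_between:
  fixes h :: "'w \<Rightarrow> real"
  assumes "integrable P l" "integrable P u" "h \<in> borel_measurable P"
    "\<And>\<omega>. \<omega> \<in> space P \<Longrightarrow> l \<omega> \<le> h \<omega> \<and> h \<omega> \<le> u \<omega>"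
  shows "integrable P h"
proof (rule Bochner_Integration.integrable_bound)
  show "integrable P (\<lambda>\<omega>. \<bar>l \<omega>\<bar> + \<bar>u \<omega>\<bar>)" using assms by auto
  show "AE \<omega> in P. norm (h \<omega>) \<le> norm (\<bar>l \<omega>\<bar> + \<bar>u \<omega>\<bar>)"
    using assms(4) by (intro AE_I2) fastforce
qed fact

text \<open>Instead of Jensen's inequality: \<open>h \<le> (q / \<epsilon> + \<epsilon>) / 2\<close> whenever \<open>h^2 \<le> q\<close>.\<close>

lemma upper_expectation_le:
  assumes P: "prob_space P" and \<epsilon>: "\<epsilon> > 0" and q: "integrable P q" "(\<integral>\<omega>. q \<omega> \<partial>P) \<le> \<epsilon>^2"
    and h: "\<And>\<omega>. \<omega> \<in> space P \<Longrightarrow> (h \<omega>)^2 \<le> q \<omega>"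
  shows "upper_expectation P h \<le> ennreal \<epsilon>"
proof -
  interpret prob_space P by fact
  define g where "g \<omega> = (q \<omega> / \<epsilon> + \<epsilon>) / 2" for \<omega>
  have g: "integrable P g" unfolding g_def using q(1) by auto
  have hg: "h \<omega> \<le> g \<omega>" if "\<omega> \<in> space P" for \<omega>
  proof -
    have "0 \<le> (h \<omega> - \<epsilon>)^2" by simp
    then have "2 * \<epsilon> * h \<omega> \<le> (h \<omega>)^2 + \<epsilon>^2" by (simp add: power2_eq_square algebra_simps)
    also have "\<dots> \<le> q \<omega> + \<epsilon>^2" using h[OF that] by simp
    finally show ?thesis using \<epsilon> by (simp add: g_def field_simps power2_eq_square)
  qed
  have q0: "q \<omega> \<ge> 0" if "\<omega> \<in> space P" for \<omega> using h[OF that] zero_le_power2 order_trans by blast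
  have "upper_expectation P h \<le> (\<integral>\<^sup>+\<omega>. ennreal (g \<omega>) \<partial>P)"
    unfolding upper_expectation_def
    by (rule INF_lower) (use g hg in \<open>auto intro!: ennreal_leI\<close>)
  also have "\<dots> = ennreal (\<integral>\<omega>. g \<omega> \<partial>P)"
    by (rule nn_integral_eq_integral[OF g]) (use q0 \<epsilon> in \<open>auto simp: g_def intro!: AE_I2\<close>)
  also have "(\<integral>\<omega>. g \<omega> \<partial>P) = ((\<integral>\<omega>. q \<omega> \<partial>P) / \<epsilon> + \<epsilon>) / 2"
    unfolding g_def using q(1) prob_space by simp
  also have "ennreal (((\<integral>\<omega>. q \<omega> \<partial>P) / \<epsilon> + \<epsilon>) / 2) \<le> ennreal \<epsilon>"
    using q(2) \<epsilon> by (intro ennreal_leI) (simp add: field_simps power2_eq_square)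
  finally show ?thesis .
qed

subsection \<open>Mini-batches\<close>

context prob_space
begin

text \<open>Unlike for \<^const>\<open>indep_var\<close>, the types of the values of \<open>X\<close> and \<open>Y\<close> may differ.\<close>

lemma indep_set_joint_distr:
  assumes X [measurable]: "X \<in> measurable M S" and Y [measurable]: "Y \<in> measurable M T"
    and ind: "indep_set {X -` A \<inter> space M |A. A \<in> sets S} {Y -` B \<inter> space M |B. B \<in> sets T}"
  shows "distr M S X \<Otimes>\<^sub>M distr M T Y = distr M (S \<Otimes>\<^sub>M T) (\<lambda>x. (X x, Y x))"
proof (rule pair_measure_eqI)
  interpret S: prob_space "distr M S X" by (rule prob_space_distr) simp
  interpret T: prob_space "distr M T Y" by (rule prob_space_distr) simp
  show "sigma_finite_measure (distr M S X)" "sigma_finite_measure (distr M T Y)" ..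
  show "sets (distr M S X \<Otimes>\<^sub>M distr M T Y) = sets (distr M (S \<Otimes>\<^sub>M T) (\<lambda>x. (X x, Y x)))" by simp
  fix A B assume "A \<in> sets (distr M S X)" "B \<in> sets (distr M T Y)"
  then have AB [measurable]: "A \<in> sets S" "B \<in> sets T" by auto
  have "prob ((X -` A \<inter> space M) \<inter> (Y -` B \<inter> space M)) = prob (X -` A \<inter> space M) * prob (Y -` B \<inter> space M)"
    using ind AB unfolding indep_sets2_eq by blast
  moreover have "(\<lambda>x. (X x, Y x)) -` (A \<times> B) \<inter> space M = (X -` A \<inter> space M) \<inter> (Y -` B \<inter> space M)" by auto
  ultimately show "emeasure (distr M S X) A * emeasure (distr M T Y) B
      = emeasure (distr M (S \<Otimes>\<^sub>M T) (\<lambda>x. (X x, Y x))) (A \<times> B)"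
    by (simp add: emeasure_distr emeasure_eq_measure ennreal_mult)
qed

text \<open>By independence the joint law is a product, so Fubini takes the place of conditioning on
  \<open>X\<close>.\<close>

lemma indep_set_nn_integral:
  assumes X [measurable]: "X \<in> measurable M S" and Y [measurable]: "Y \<in> measurable M T"
    and ind: "indep_set {X -` A \<inter> space M |A. A \<in> sets S} {Y -` B \<inter> space M |B. B \<in> sets T}"
    and h: "h \<in> borel_measurable (S \<Otimes>\<^sub>M T)"
  shows "(\<integral>\<^sup>+\<omega>. h (X \<omega>, Y \<omega>) \<partial>M) = (\<integral>\<^sup>+\<omega>'. \<integral>\<^sup>+\<omega>. h (X \<omega>', Y \<omega>) \<partial>M \<partial>M)"
proof -
  note eq = indep_set_joint_distr[OF X Y ind]
  interpret T: prob_space "distr M T Y" by (rule prob_space_distr) simp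
  note h [measurable]
  have "(\<integral>\<^sup>+\<omega>. h (X \<omega>, Y \<omega>) \<partial>M) = (\<integral>\<^sup>+z. h z \<partial>(distr M S X \<Otimes>\<^sub>M distr M T Y))"
    unfolding eq by (subst nn_integral_distr) auto
  also have "\<dots> = (\<integral>\<^sup>+x. \<integral>\<^sup>+y. h (x, y) \<partial>distr M T Y \<partial>distr M S X)"
    by (rule T.nn_integral_fst[symmetric]) simp
  also have "\<dots> = (\<integral>\<^sup>+x. \<integral>\<^sup>+\<omega>. h (x, Y \<omega>) \<partial>M \<partial>distr M S X)"
    by (intro nn_integral_cong) (simp add: nn_integral_distr)
  also have "\<dots> = (\<integral>\<^sup>+\<omega>'. \<integral>\<^sup>+\<omega>. h (X \<omega>', Y \<omega>) \<partial>M \<partial>M)"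
    by (subst nn_integral_distr) auto
  finally show ?thesis .
qed

lemma indep_set_integral:
  fixes h :: "_ \<Rightarrow> real"
  assumes X [measurable]: "X \<in> measurable M S" and Y [measurable]: "Y \<in> measurable M T"
    and ind: "indep_set {X -` A \<inter> space M |A. A \<in> sets S} {Y -` B \<inter> space M |B. B \<in> sets T}"
    and h: "h \<in> borel_measurable (S \<Otimes>\<^sub>M T)"
    and int: "integrable M (\<lambda>\<omega>. h (X \<omega>, Y \<omega>))"
  shows "(\<integral>\<omega>. h (X \<omega>, Y \<omega>) \<partial>M) = (\<integral>\<omega>'. \<integral>\<omega>. h (X \<omega>', Y \<omega>) \<partial>M \<partial>M)"
proof -
  note eq = indep_set_joint_distr[OF X Y ind]
  interpret S: prob_space "distr M S X" by (rule prob_space_distr) simp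
  interpret T: prob_space "distr M T Y" by (rule prob_space_distr) simp
  interpret ST: pair_sigma_finite "distr M S X" "distr M T Y" ..
  note h [measurable]
  have int': "integrable (distr M S X \<Otimes>\<^sub>M distr M T Y) h"
    unfolding eq using int by (subst integrable_distr_eq) auto
  have "(\<integral>\<omega>. h (X \<omega>, Y \<omega>) \<partial>M) = (\<integral>z. h z \<partial>(distr M S X \<Otimes>\<^sub>M distr M T Y))"
    unfolding eq by (subst integral_distr) auto
  also have "\<dots> = (\<integral>x. \<integral>y. h (x, y) \<partial>distr M T Y \<partial>distr M S X)"
    by (rule ST.integral_fst'[symmetric, OF int'])
  also have "\<dots> = (\<integral>x. \<integral>\<omega>. h (x, Y \<omega>) \<partial>M \<partial>distr M S X)"
    by (intro Bochner_Integration.integral_cong) (simp_all add: integral_distr)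
  also have "\<dots> = (\<integral>\<omega>'. \<integral>\<omega>. h (X \<omega>', Y \<omega>) \<partial>M \<partial>M)"
    by (subst integral_distr) auto
  finally show ?thesis .
qed

text \<open>Centred independent terms are uncorrelated, so only the diagonal of the double sum
  remains. The cross terms are computed coordinate by coordinate, since the product rule for
  expectations concerns scalars.\<close>

lemma variance_indep_sum:
  fixes Z :: "nat \<Rightarrow> 'a \<Rightarrow> 'b::euclidean_space"
  assumes indep: "indep_vars (\<lambda>_. borel) Z {..<m}"
    and sq: "\<And>q. q < m \<Longrightarrow> sq_integrable M (Z q)"
    and mean: "\<And>q. q < m \<Longrightarrow> expectation (Z q) = 0"
    and var: "\<And>q. q < m \<Longrightarrow> expectation (\<lambda>\<omega>. (norm (Z q \<omega>))^2) \<le> s"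
  shows "expectation (\<lambda>\<omega>. (norm (\<Sum>q<m. Z q \<omega>))^2) \<le> real m * s"
proof -
  have intZ: "integrable M (Z q)" if "q < m" for q
  proof (rule Bochner_Integration.integrable_bound)
    show "integrable M (\<lambda>\<omega>. 1 + (norm (Z q \<omega>))^2)" using sq[OF that] by (auto dest: sq_integrableD)
    show "AE \<omega> in M. norm (Z q \<omega>) \<le> norm (1 + (norm (Z q \<omega>))^2)"
    proof (rule AE_I2)
      fix \<omega>
      have "0 \<le> (norm (Z q \<omega>) - 1)^2 + (norm (Z q \<omega>))^2 + 1" by simp
      then show "norm (Z q \<omega>) \<le> norm (1 + (norm (Z q \<omega>))^2)"
        by (simp add: power2_eq_square algebra_simps)
    qed
  qed (use sq[OF that] in \<open>auto dest: sq_integrableD\<close>)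
  have cross: "expectation (\<lambda>\<omega>. Z p \<omega> \<bullet> Z q \<omega>) = 0" if "p < m" "q < m" "p \<noteq> q" for p q
  proof -
    have pq: "indep_vars (\<lambda>_. borel) Z {p, q}"
      using indep_vars_subset[OF indep, of "{p, q}"] that by simp
    have comp: "expectation (\<lambda>\<omega>. (Z p \<omega> \<bullet> b) * (Z q \<omega> \<bullet> b)) = 0"
      and int: "integrable M (\<lambda>\<omega>. (Z p \<omega> \<bullet> b) * (Z q \<omega> \<bullet> b))" for b
    proof -
      have *: "indep_vars (\<lambda>_. borel) (\<lambda>i \<omega>. Z i \<omega> \<bullet> b) {p, q}"
        by (rule indep_vars_compose2[OF pq]) simp
      have **: "integrable M (\<lambda>\<omega>. Z i \<omega> \<bullet> b)" if "i \<in> {p, q}" for i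
        using intZ that \<open>p < m\<close> \<open>q < m\<close> by auto
      have "expectation (\<lambda>\<omega>. \<Prod>i\<in>{p, q}. Z i \<omega> \<bullet> b) = (\<Prod>i\<in>{p, q}. expectation (\<lambda>\<omega>. Z i \<omega> \<bullet> b))"
        by (rule indep_vars_lebesgue_integral[OF _ * **]) auto
      moreover have "expectation (\<lambda>\<omega>. Z p \<omega> \<bullet> b) = 0"
        using mean[OF that(1)] intZ[OF that(1)] by (simp add: integral_inner_left)
      ultimately show "expectation (\<lambda>\<omega>. (Z p \<omega> \<bullet> b) * (Z q \<omega> \<bullet> b)) = 0"
        using that(3) by simp
      have "integrable M (\<lambda>\<omega>. \<Prod>i\<in>{p, q}. Z i \<omega> \<bullet> b)"
        by (rule indep_vars_integrable[OF _ * **]) auto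
      then show "integrable M (\<lambda>\<omega>. (Z p \<omega> \<bullet> b) * (Z q \<omega> \<bullet> b))" using that(3) by simp
    qed
    have "expectation (\<lambda>\<omega>. Z p \<omega> \<bullet> Z q \<omega>) = (\<Sum>b\<in>Basis. expectation (\<lambda>\<omega>. (Z p \<omega> \<bullet> b) * (Z q \<omega> \<bullet> b)))"
      by (subst euclidean_inner, rule Bochner_Integration.integral_sum) (rule int)
    then show ?thesis using comp by simp
  qed
  have "expectation (\<lambda>\<omega>. (norm (\<Sum>q<m. Z q \<omega>))^2)
      = expectation (\<lambda>\<omega>. \<Sum>p<m. \<Sum>q<m. Z p \<omega> \<bullet> Z q \<omega>)"
    unfolding power2_norm_eq_inner inner_sum_left inner_sum_right by (subst sum.swap) (rule refl)
  also have "\<dots> = (\<Sum>p<m. expectation (\<lambda>\<omega>. \<Sum>q<m. Z p \<omega> \<bullet> Z q \<omega>))"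
    by (intro Bochner_Integration.integral_sum Bochner_Integration.integrable_sum sq_integrable_inner sq) auto
  also have "\<dots> = (\<Sum>p<m. \<Sum>q<m. expectation (\<lambda>\<omega>. Z p \<omega> \<bullet> Z q \<omega>))"
    by (intro sum.cong refl Bochner_Integration.integral_sum sq_integrable_inner sq) auto
  also have "\<dots> = (\<Sum>p<m. expectation (\<lambda>\<omega>. (norm (Z p \<omega>))^2))"
  proof (intro sum.cong refl)
    fix p assume "p \<in> {..<m}"
    then have p: "p < m" by simp
    have "(\<Sum>q<m. expectation (\<lambda>\<omega>. Z p \<omega> \<bullet> Z q \<omega>))
        = (\<Sum>q<m. if q = p then expectation (\<lambda>\<omega>. Z p \<omega> \<bullet> Z p \<omega>) else 0)"
      using cross p by (intro sum.cong) auto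
    then show "(\<Sum>q<m. expectation (\<lambda>\<omega>. Z p \<omega> \<bullet> Z q \<omega>)) = expectation (\<lambda>\<omega>. (norm (Z p \<omega>))^2)"
      using p by (simp add: power2_norm_eq_inner)
  qed
  also have "\<dots> \<le> (\<Sum>p<m. s)" using var by (intro sum_mono) auto
  finally show ?thesis by simp
qed

text \<open>
  \<open>F\<close> is the past, \<open>Y\<close> the query point and \<open>\<xi>\<close> the fresh batch. Independence lets one freeze \<open>Y\<close> and
  average over the batch only.
\<close>

lemma minibatch_error:
  fixes Gi :: "real^'n::finite \<Rightarrow> 's \<Rightarrow> real^'n" and g :: "real^'n \<Rightarrow> real^'n"
    and \<xi> :: "nat \<Rightarrow> 'a \<Rightarrow> 's"
  assumes Gi [measurable]: "(\<lambda>(x, s). Gi x s) \<in> borel_measurable (borel \<Otimes>\<^sub>M D)"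
    and g [measurable]: "g \<in> borel_measurable borel"
    and D: "prob_space D" and Gi_int: "\<And>y. integrable D (Gi y)" and Gi_mean: "\<And>y. (\<integral>s. Gi y s \<partial>D) = g y"
    and Gi_var: "\<And>y. (\<integral>\<^sup>+s. ennreal ((norm (Gi y s - g y))^2) \<partial>D) \<le> ennreal (\<sigma>^2)"
    and \<xi>: "\<And>q. q < m \<Longrightarrow> \<xi> q \<in> measurable M D" "\<And>q. q < m \<Longrightarrow> distr M D (\<xi> q) = D"
    and indep: "indep_vars (\<lambda>_. D) \<xi> {..<m}" and m: "m \<ge> 1"
    and F: "sigma_algebra (space M) F"
    and indF: "indep_set F (sigma_sets (space M) {\<xi> q -` B \<inter> space M | q B. q < m \<and> B \<in> sets D})"
    and Y: "Y \<in> borel_measurable (sigma (space M) F)"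
  defines "\<delta> \<equiv> \<lambda>\<omega>. minibatch Gi m (Y \<omega>) (\<lambda>q. \<xi> q \<omega>) - g (Y \<omega>)"
  shows "sq_integrable M \<delta>" "expectation (\<lambda>\<omega>. (norm (\<delta> \<omega>))^2) \<le> \<sigma>^2 / real m"
    "\<And>W. W \<in> borel_measurable (sigma (space M) F) \<Longrightarrow> sq_integrable M W \<Longrightarrow> expectation (\<lambda>\<omega>. W \<omega> \<bullet> \<delta> \<omega>) = 0"
proof -
  interpret D: prob_space D by fact
  interpret F: sigma_algebra "space M" F by fact
  \<comment> \<open>The batch as a single random element of a product space, so that it can be
    averaged out at once.\<close>
  define Z where "Z \<omega> = (\<lambda>q\<in>{..<m}. \<xi> q \<omega>)" for \<omega>
  define T where "T = PiM {..<m} (\<lambda>_. D)"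
  define err where "err y z = minibatch Gi m y z - g y" for y z
  define N where "N = sigma (space M) {\<xi> q -` B \<inter> space M | q B. q < m \<and> B \<in> sets D}"
  have Fev: "F \<subseteq> events"
    using indF unfolding indep_sets2_eq by blast
  have spF: "space (sigma (space M) F) = space M" "sets (sigma (space M) F) = F"
    using F.space_closed by (auto simp: space_measure_of_conv sets_measure_of F.sigma_sets_eq)
  have spN: "space N = space M" "sets N = sigma_sets (space M) {\<xi> q -` B \<inter> space M | q B. q < m \<and> B \<in> sets D}"
    unfolding N_def by (auto simp: space_measure_of_conv intro!: sets_measure_of)
  have F_meas: "X \<in> measurable M S" if "X \<in> measurable (sigma (space M) F) S" for X :: "'a \<Rightarrow> 'c" and S
    using that Fev unfolding measurable_def spF by auto
  have Z_N: "Z \<in> measurable N T"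
    unfolding Z_def T_def
  proof (rule measurable_restrict)
    fix q assume q: "q \<in> {..<m}"
    show "\<xi> q \<in> measurable N D"
    proof (rule measurableI)
      show "\<xi> q \<omega> \<in> space D" if "\<omega> \<in> space N" for \<omega>
        using \<xi>(1)[of q] q that spN(1) by (auto dest: measurable_space)
      show "\<xi> q -` B \<inter> space N \<in> sets N" if "B \<in> sets D" for B
        unfolding spN using q that by (auto intro!: sigma_sets.Basic)
    qed
  qed
  have Z [measurable]: "Z \<in> measurable M T"
    unfolding Z_def T_def using \<xi>(1) by (intro measurable_restrict) auto
  \<comment> \<open>Stated for every \<open>X\<close> determined by the past, because it is applied
    to \<open>Y\<close> and to the pair of \<open>W\<close> and \<open>Y\<close>.\<close>
  have ind: "indep_set {X -` A \<inter> space M |A. A \<in> sets S} {Z -` B \<inter> space M |B. B \<in> sets T}"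
    if X: "X \<in> measurable (sigma (space M) F) S" for X :: "'a \<Rightarrow> 'c" and S
  proof -
    have "{X -` A \<inter> space M |A. A \<in> sets S} \<subseteq> F"
      using measurable_sets[OF X] unfolding spF by blast
    moreover have "{Z -` B \<inter> space M |B. B \<in> sets T} \<subseteq> sets N"
      unfolding spN(1)[symmetric] using measurable_sets[OF Z_N] by blast
    ultimately show ?thesis using indF unfolding indep_sets2_eq spN(2) by blast
  qed
  have \<delta>: "\<delta> \<omega> = err (Y \<omega>) (Z \<omega>)" for \<omega>
    unfolding \<delta>_def err_def Z_def minibatch_def by simp
  have err_meas [measurable]: "(\<lambda>(y, z). err y z) \<in> borel_measurable (borel \<Otimes>\<^sub>M T)"
  proof -
    have "(\<lambda>p. Gi (fst p) (snd p q)) \<in> borel_measurable (borel \<Otimes>\<^sub>M T)" if "q < m" for q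
    proof -
      have "(\<lambda>p. (fst p, snd p q)) \<in> measurable (borel \<Otimes>\<^sub>M T) (borel \<Otimes>\<^sub>M D)"
        unfolding T_def using that by (intro measurable_Pair measurable_fst measurable_compose[OF measurable_snd measurable_component_singleton]) auto
      from measurable_compose[OF this Gi] show ?thesis by simp
    qed
    then show ?thesis unfolding err_def minibatch_def split_beta by measurable
  qed
  have Ym [measurable]: "Y \<in> borel_measurable M" by (rule F_meas[OF Y])
  have \<delta>m: "\<delta> \<in> borel_measurable M"
  proof -
    have "(\<lambda>\<omega>. (\<lambda>(y, z). err y z) (Y \<omega>, Z \<omega>)) \<in> borel_measurable M" by measurable
    then show ?thesis by (simp add: \<delta>[abs_def])
  qed
  have m0: "real m > 0" using m by simp
  define \<phi> where "\<phi> y q \<omega> = Gi y (\<xi> q \<omega>) - g y" for y q \<omega>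
  have Giy [measurable]: "Gi y \<in> borel_measurable D" for y using Gi_int by (rule borel_measurable_integrable)
  have \<phi>m: "\<phi> y q \<in> borel_measurable M" if "q < m" for y q
    unfolding \<phi>_def using \<xi>(1)[OF that] by measurable
  have \<phi>nn: "(\<integral>\<^sup>+\<omega>. ennreal ((norm (\<phi> y q \<omega>))^2) \<partial>M) \<le> ennreal (\<sigma>^2)" if "q < m" for y q
  proof -
    have "(\<integral>\<^sup>+\<omega>. ennreal ((norm (\<phi> y q \<omega>))^2) \<partial>M)
        = (\<integral>\<^sup>+s. ennreal ((norm (Gi y s - g y))^2) \<partial>distr M D (\<xi> q))"
      unfolding \<phi>_def using \<xi>(1)[OF that] by (subst nn_integral_distr) auto
    then show ?thesis using Gi_var[of y] \<xi>(2)[OF that] by simp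
  qed
  have \<phi>sq: "sq_integrable M (\<phi> y q)" if "q < m" for y q
    by (rule sq_integrable_nn_integral(1)[OF \<phi>m[OF that] _ \<phi>nn[OF that]]) simp
  have \<phi>int: "integrable M (\<lambda>\<omega>. Gi y (\<xi> q \<omega>))" if "q < m" for y q
    using Gi_int[of y] \<xi>[OF that] integrable_distr_eq[of "\<xi> q" M D "Gi y"] by simp
  have Gi_exp: "expectation (\<lambda>\<omega>. Gi y (\<xi> q \<omega>)) = g y" if "q < m" for y q
    using Gi_mean[of y] \<xi>[OF that] integral_distr[of "\<xi> q" M D "Gi y"] by simp
  have \<phi>mean: "expectation (\<phi> y q) = 0" if "q < m" for y q
    unfolding \<phi>_def using \<phi>int[OF that] Gi_exp[OF that] prob_space by simp
  \<comment> \<open>For frozen \<open>y\<close> the error is an average of \<open>m\<close>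
    independent centred terms; this is the source of the factor \<open>1 / m\<close>.\<close>
  have err_\<phi>: "err y (Z \<omega>) = (1 / real m) *\<^sub>R (\<Sum>q<m. \<phi> y q \<omega>)" for y \<omega>
    using m0 by (simp add: err_def minibatch_def Z_def \<phi>_def sum_subtractf scaleR_diff_right sum_constant_scaleR
        del: sum_constant)
  have err_sq: "sq_integrable M (\<lambda>\<omega>. err y (Z \<omega>))" for y
  proof -
    have "sq_integrable M (\<lambda>\<omega>. \<Sum>q\<in>Q. \<phi> y q \<omega>)" if "finite Q" "Q \<subseteq> {..<m}" for Q
      using that by (induction Q) (auto intro!: sq_integrable_add \<phi>sq sq_integrable_const finite_measure_axioms)
    then show ?thesis unfolding err_\<phi> by (intro sq_integrable_scaleR) auto
  qed
  have err_var: "expectation (\<lambda>\<omega>. (norm (err y (Z \<omega>)))^2) \<le> \<sigma>^2 / real m" for y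
  proof -
    have "expectation (\<lambda>\<omega>. (norm (\<Sum>q<m. \<phi> y q \<omega>))^2) \<le> real m * \<sigma>^2"
    proof (rule variance_indep_sum)
      show "indep_vars (\<lambda>_. borel) (\<phi> y) {..<m}"
        using indep_vars_compose2[OF indep, of "\<lambda>_ s. Gi y s - g y" "\<lambda>_. borel"] by (simp add: \<phi>_def[abs_def])
      show "expectation (\<lambda>\<omega>. (norm (\<phi> y q \<omega>))^2) \<le> \<sigma>^2" if "q < m" for q
        by (rule sq_integrable_nn_integral(2)[OF \<phi>m[OF that] _ \<phi>nn[OF that]]) simp
    qed (simp_all add: \<phi>sq \<phi>mean)
    then have "expectation (\<lambda>\<omega>. (norm (\<Sum>q<m. \<phi> y q \<omega>))^2) / (real m)^2 \<le> real m * \<sigma>^2 / (real m)^2"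
      by (intro divide_right_mono) auto
    then show ?thesis
      unfolding err_\<phi> using m0 by (simp add: power_divide power2_eq_square)
  qed
  have nn: "(\<integral>\<^sup>+\<omega>. ennreal ((norm (\<delta> \<omega>))^2) \<partial>M) \<le> ennreal (\<sigma>^2 / real m)"
  proof -
    have "(\<integral>\<^sup>+\<omega>. ennreal ((norm (\<delta> \<omega>))^2) \<partial>M)
        = (\<integral>\<^sup>+\<omega>. (\<lambda>(y, z). ennreal ((norm (err y z))^2)) (Y \<omega>, Z \<omega>) \<partial>M)" by (simp add: \<delta>)
    also have "\<dots> = (\<integral>\<^sup>+\<omega>'. \<integral>\<^sup>+\<omega>. (\<lambda>(y, z). ennreal ((norm (err y z))^2)) (Y \<omega>', Z \<omega>) \<partial>M \<partial>M)"
      using err_meas by (intro indep_set_nn_integral[OF Ym Z ind[OF Y]]) (simp add: split_beta)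
    also have "\<dots> \<le> (\<integral>\<^sup>+\<omega>'. ennreal (\<sigma>^2 / real m) \<partial>M)"
      using err_var nn_integral_eq_integral[OF sq_integrableD(2)[OF err_sq]]
      by (intro nn_integral_mono) (simp add: ennreal_leI)
    also have "\<dots> = ennreal (\<sigma>^2 / real m)" by (simp add: emeasure_space_1)
    finally show ?thesis .
  qed
  show sq: "sq_integrable M \<delta>"
    by (rule sq_integrable_nn_integral(1)[OF \<delta>m _ nn]) simp
  show "expectation (\<lambda>\<omega>. (norm (\<delta> \<omega>))^2) \<le> \<sigma>^2 / real m"
    by (rule sq_integrable_nn_integral(2)[OF \<delta>m _ nn]) simp
  show "expectation (\<lambda>\<omega>. W \<omega> \<bullet> \<delta> \<omega>) = 0"
    if W: "W \<in> borel_measurable (sigma (space M) F)" "sq_integrable M W" for W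
  proof -
    have WY: "(\<lambda>\<omega>. (W \<omega>, Y \<omega>)) \<in> measurable (sigma (space M) F) (borel \<Otimes>\<^sub>M borel)"
      using W(1) Y by (rule measurable_Pair)
    \<comment> \<open>Both \<open>W\<close> and \<open>Y\<close> are frozen; the inner mean is then
      \<open>W\<close> paired with the mean of the error, which is zero.\<close>
    define h where "h = (\<lambda>((w, y), z). w \<bullet> err y z)"
    have h: "h \<in> borel_measurable ((borel \<Otimes>\<^sub>M borel) \<Otimes>\<^sub>M T)"
    proof -
      have "(\<lambda>p. (snd (fst p), snd p)) \<in> measurable ((borel \<Otimes>\<^sub>M borel) \<Otimes>\<^sub>M T) (borel \<Otimes>\<^sub>M T)" by measurable
      from measurable_compose[OF this err_meas]
      have "(\<lambda>p. err (snd (fst p)) (snd p)) \<in> borel_measurable ((borel \<Otimes>\<^sub>M borel) \<Otimes>\<^sub>M T)" by simp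
      then show ?thesis unfolding h_def split_beta by measurable
    qed
    have "expectation (\<lambda>\<omega>. W \<omega> \<bullet> \<delta> \<omega>) = expectation (\<lambda>\<omega>. h ((W \<omega>, Y \<omega>), Z \<omega>))" by (simp add: h_def \<delta>)
    also have "\<dots> = (\<integral>\<omega>'. expectation (\<lambda>\<omega>. h ((W \<omega>', Y \<omega>'), Z \<omega>)) \<partial>M)"
      by (rule indep_set_integral[OF F_meas[OF WY] Z ind[OF WY] h])
        (use sq_integrable_inner[OF W(2) sq] in \<open>simp add: h_def \<delta>\<close>)
    also have "\<dots> = (\<integral>\<omega>'. 0 \<partial>M)"
    proof (intro Bochner_Integration.integral_cong refl)
      fix \<omega>'
      have int: "integrable M (\<lambda>\<omega>. \<phi> y q \<omega>)" if "q < m" for y q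
        unfolding \<phi>_def using \<phi>int[OF that] by simp
      then have int_sum: "integrable M (\<lambda>\<omega>. \<Sum>q<m. \<phi> y q \<omega>)" for y by auto
      have "expectation (\<lambda>\<omega>. err (Y \<omega>') (Z \<omega>)) = 0"
        unfolding err_\<phi> using int \<phi>mean by simp
      moreover have "integrable M (\<lambda>\<omega>. err (Y \<omega>') (Z \<omega>))" unfolding err_\<phi> using int_sum by simp
      ultimately show "expectation (\<lambda>\<omega>. h ((W \<omega>', Y \<omega>'), Z \<omega>)) = 0"
        unfolding h_def by (simp add: integral_inner_right)
    qed
    finally show ?thesis by simp
  qed
qed

end

subsection \<open>One run of the algorithm\<close>

text \<open>The step sizes enter through \<open>\<beta> > 3 * L\<close> and
  \<open>\<gamma> > 0\<close>; the rate \<tau> appears below as a parameter \<open>t\<close> subject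
  to two bounds, and the exact interval for \<gamma> comes in when the constants are
  combined.\<close>

locale stochastic_admm_run =
  fixes N :: nat
    and c :: "'n::finite \<Rightarrow> nat"
    and e :: "'m::finite \<Rightarrow> 'n"
    and A :: "real^'n^'m"
    and b :: "real^'m"
    and f :: "real^'n \<Rightarrow> real"
    and gradf :: "real^'n \<Rightarrow> real^'n"
    and L \<sigma> \<beta> \<gamma> fstar :: real
    and r :: "nat \<Rightarrow> real^'n \<Rightarrow> real"
    and rstar :: "nat \<Rightarrow> real"
    and \<M> X :: "nat \<Rightarrow> (real^'n) set"
    and D :: "nat \<Rightarrow> 's measure"
    and G :: "nat \<Rightarrow> real^'n \<Rightarrow> 's \<Rightarrow> real^'n"
    and H :: "nat \<Rightarrow> real^'n^'n"
    and M :: nat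
    and P :: "'w measure"
    and \<xi> :: "nat \<Rightarrow> nat \<Rightarrow> nat \<Rightarrow> 'w \<Rightarrow> 's"
    and x :: "nat \<Rightarrow> 'w \<Rightarrow> real^'n"
    and lam :: "nat \<Rightarrow> 'w \<Rightarrow> real^'m"
    and x0 :: "real^'n"
    and lam0 :: "real^'m"
  assumes N: "N \<ge> 2"
    and blocks: "range c = {1..N}"
    and last_block_coords: "bij_betw e UNIV {j. c j = N}"
    and A_N: "\<And>k l. A $ k $ (e l) = (if k = l then 1 else 0)"
    and L: "L > 0"
    and grad: "\<And>y. GDERIV f y :> gradf y"
    and grad_Lipschitz: "L-lipschitz_on UNIV gradf"
    and r_convex: "\<And>i. i \<in> {1..<N} \<Longrightarrow> convex_on (block_space c i) (r i)"
    and manifold: "\<And>i. i \<in> {1..<N} \<Longrightarrow> \<M> i \<subseteq> block_space c i \<and> embedded_submanifold (\<M> i)"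
    and r_bdd: "\<And>i. i \<in> {1..<N} \<Longrightarrow> bdd_below (r i ` (\<M> i \<inter> X i))"
    and rstar: "\<And>i. i \<in> {1..<N} \<Longrightarrow> rstar i = Inf (r i ` (\<M> i \<inter> X i))"
    and f_bdd: "bdd_below (f ` {y. \<forall>i\<in>{1..<N}. block c i y \<in> \<M> i \<inter> X i})"
    and fstar: "fstar = Inf (f ` {y. \<forall>i\<in>{1..<N}. block c i y \<in> \<M> i \<inter> X i})"
    and P: "prob_space P"
    and unbiased: "stochastic_oracle N c gradf D G \<sigma>"
    and random: "\<And>k. x k \<in> borel_measurable P"
    and samples: "fresh_samples P N c D M \<xi> x"
    and H_block: "\<And>i. i \<in> {1..<N} \<Longrightarrow> block_matrix c i (H i) \<and> transpose (H i) = H i"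
    and x0: "\<And>i. i \<in> {1..<N} \<Longrightarrow> block c i x0 \<in> \<M> i \<inter> X i"
    and init: "\<And>w. w \<in> space P \<Longrightarrow> x 0 w = x0 \<and> lam 0 w = lam0"
    and alg: "\<And>w. w \<in> space P \<Longrightarrow>
           stochastic_admm N c e A b f r \<M> X G \<beta> \<gamma> H M
             (\<lambda>k i q. \<xi> k i q w) (\<lambda>k. x k w) (\<lambda>k. lam k w)"
    and beta: "\<beta> > 3 * L" and gamma: "\<gamma> > 0"
    and H_bound: "\<And>i. i \<in> {1..<N} \<Longrightarrow>
           succ_scaled_id (block_space c i) (H i) (8 * L^2 / \<beta> + L + 1)"
    and M_pos: "M \<ge> 1"
begin

text \<open>The query point of call \<open>(k, i)\<close>. The block index acts as a clock: it
  starts at \<open>x k\<close> for \<open>i = 1\<close> and arrives at \<open>x (Suc k)\<close> for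
  \<open>i = Suc N\<close>.\<close>

definition xh :: "nat \<Rightarrow> nat \<Rightarrow> 'w \<Rightarrow> real^'n" where
  "xh k i w = sweep c i (x (Suc k) w) (x k w)"

definition est :: "nat \<Rightarrow> nat \<Rightarrow> 'w \<Rightarrow> real^'n" where
  "est k i w = minibatch (G i) M (xh k i w) (\<lambda>q. \<xi> k i q w)"

definition err :: "nat \<Rightarrow> nat \<Rightarrow> 'w \<Rightarrow> real^'n" where
  "err k i w = est k i w - block c i (gradf (xh k i w))"

definition d :: "nat \<Rightarrow> nat \<Rightarrow> 'w \<Rightarrow> real^'n" where
  "d k i w = block c i (x (Suc k) w - x k w)"

abbreviation AL :: "real^'n \<Rightarrow> real^'m \<Rightarrow> real" where
  "AL \<equiv> aug_lagrangian N c A b f r \<beta>"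

abbreviation sm :: "nat \<Rightarrow> real" where
  "sm i \<equiv> sigma_min (block_space c i) (H i)"

definition constr :: "real^'n \<Rightarrow> real^'m \<Rightarrow> real" where
  "constr y l = - ((A *v y - b) \<bullet> l) + \<beta> / 2 * (norm (A *v y - b))^2"

lemma AL_eq: "AL y l = f y + (\<Sum>i\<in>{1..<N}. r i (block c i y)) + constr y l"
  by (simp add: aug_lagrangian_def constr_def)

lemma beta_pos: "\<beta> > 0" using beta L by simp

lemma blocks': "range c \<subseteq> {1..N}" using blocks by simp

lemma xh_Suc: "xh k (Suc i) w = xh k i w + d k i w"
  by (simp add: xh_def d_def sweep_Suc)

lemma xh_1: "xh k (Suc 0) w = x k w"
  unfolding xh_def by (rule sweep_below[OF blocks']) simp

lemma xh_last: "xh k (Suc N) w = x (Suc k) w"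
  unfolding xh_def by (rule sweep_above[OF blocks']) simp

lemma d_mem: "d k i w \<in> block_space c i" by (simp add: d_def block_mem)

lemma block_xh: "block c j (xh k i w) = block c j (x (if j < i then Suc k else k) w)"
  by (simp add: xh_def block_sweep)

lemma sum_d: "(\<Sum>i=1..N. (norm (d k i w))^2) = (norm (x (Suc k) w - x k w))^2"
  unfolding d_def using sum_norm_block[OF blocks'] by simp

lemma sum_split_last: "(\<Sum>i=1..N. h i) = (\<Sum>i\<in>{1..<N}. h i) + h N"
  using N atLeastLessThanSuc_atLeastAtMost[of 1 N] sum.atLeastLessThan_Suc[of 1 N h] by simp

text \<open>Every block number is attained by \<open>c\<close>, so the block space is nontrivial and
  has a smallest singular value.\<close>

lemma H_eigen:
  assumes i: "i \<in> {1..<N}"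
  shows "sm i > 8 * L^2 / \<beta> + L + 1" "v \<in> block_space c i \<Longrightarrow> v \<bullet> (H i *v v) \<ge> sm i * (norm v)^2"
proof -
  obtain j where j: "c j = i" using i blocks by (metis atLeastAtMost_iff atLeastLessThan_iff imageE less_imp_le)
  then have "axis j 1 \<in> block_space c i" "axis j (1::real) \<noteq> 0"
    by (auto simp: block_space_def axis_def vec_eq_iff)
  then have nz: "block_space c i \<noteq> {0}" by blast
  have t: "8 * L^2 / \<beta> + L + 1 \<ge> 0" using L beta_pos by simp
  note bounds = sigma_min_bounds[OF subspace_block_space nz _ _ t H_bound[OF i]]
  show "sm i > 8 * L^2 / \<beta> + L + 1"
    using bounds(1) H_block[OF i] block_matrix_mult by blast
  show "v \<in> block_space c i \<Longrightarrow> v \<bullet> (H i *v v) \<ge> sm i * (norm v)^2"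
    using bounds(2) H_block[OF i] block_matrix_mult by blast
qed

definition obj :: "nat \<Rightarrow> nat \<Rightarrow> 'w \<Rightarrow> real^'n \<Rightarrow> real" where
  "obj k i w y = stochastic_lagrangian c A b f r \<beta> i (est k i w) y (xh k i w) (lam k w)
    + 1 / 2 * ((y - block c i (x k w)) \<bullet> (H i *v (y - block c i (x k w))))"

lemma arg_min_block:
  assumes w: "w \<in> space P" and i: "i \<in> {1..<N}"
  shows "block c i (x (Suc k) w) \<in> \<M> i \<inter> X i"
    "y \<in> \<M> i \<inter> X i \<Longrightarrow> obj k i w (block c i (x (Suc k) w)) \<le> obj k i w y"
proof -
  have am: "is_arg_min (obj k i w) (\<lambda>y. y \<in> \<M> i \<inter> X i) (block c i (x (Suc k) w))"
    using alg[OF w] i unfolding stochastic_admm_def Let_def obj_def[abs_def] est_def xh_def by blast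
  then show "block c i (x (Suc k) w) \<in> \<M> i \<inter> X i" by (simp add: is_arg_min_def)
  show "y \<in> \<M> i \<inter> X i \<Longrightarrow> obj k i w (block c i (x (Suc k) w)) \<le> obj k i w y"
    using am unfolding is_arg_min_def by (force simp: not_less)
qed

lemma feasible:
  assumes w: "w \<in> space P" and i: "i \<in> {1..<N}"
  shows "block c i (x k w) \<in> \<M> i \<inter> X i"
  using x0[OF i] init[OF w] arg_min_block(1)[OF w i] by (cases k) auto

lemma rstar_le:
  assumes "w \<in> space P" "i \<in> {1..<N}"
  shows "rstar i \<le> r i (block c i (x k w))"
  unfolding rstar[OF assms(2)]
  by (intro cInf_lower imageI feasible assms r_bdd)

section \<open>Descent of the augmented Lagrangian in one iteration\<close>

text \<open>The old block is feasible and hence competes with the global minimizer; for it the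
  linear and the proximal term vanish.\<close>

lemma block_step:
  assumes w: "w \<in> space P" and i: "i \<in> {1..<N}"
  shows "est k i w \<bullet> d k i w + r i (block c i (x (Suc k) w)) + constr (xh k (Suc i) w) (lam k w)
      + 1 / 2 * (d k i w \<bullet> (H i *v d k i w))
    \<le> r i (block c i (x k w)) + constr (xh k i w) (lam k w)"
proof -
  have bx: "block c i (xh k i w) = block c i (x k w)" by (simp add: block_xh)
  have put: "put_block c i (block c i (x k w)) (xh k i w) = xh k i w"
    using put_block_self[of c i "xh k i w"] bx by simp
  have put': "put_block c i (block c i (x (Suc k) w)) (xh k i w) = xh k (Suc i) w"
    by (simp add: xh_def put_block_sweep)
  show ?thesis
    using arg_min_block(2)[OF w i feasible[OF w i], of k k]
    unfolding obj_def stochastic_lagrangian_def constr_def bx put put'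
    by (simp add: d_def block_simps)
qed

lemma last_step:
  assumes w: "w \<in> space P"
  shows "last_block e (d k N w)
    = - (\<gamma> *\<^sub>R (last_block e (est k N w) - lam k w + \<beta> *\<^sub>R (A *v xh k N w - b)))"
proof -
  have "last_block e (x (Suc k) w) = last_block e (x k w)
      - \<gamma> *\<^sub>R (last_block e (est k N w) - lam k w + \<beta> *\<^sub>R (A *v xh k N w - b))"
    using alg[OF w] unfolding stochastic_admm_def Let_def est_def xh_def by blast
  then show ?thesis
    unfolding d_def last_block_block[OF last_block_coords] last_block_simps by simp
qed

lemma lam_step:
  assumes w: "w \<in> space P"
  shows "lam (Suc k) w = lam k w - \<beta> *\<^sub>R (A *v x (Suc k) w - b)"
  using alg[OF w] unfolding stochastic_admm_def by blast

lemma constraint_last: "A *v x (Suc k) w - b = (A *v xh k N w - b) + last_block e (d k N w)"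
proof -
  have "x (Suc k) w = xh k N w + d k N w" using xh_Suc[of k N w] by (simp add: xh_last)
  then show ?thesis
    using mult_last_block[OF last_block_coords A_N d_mem, of k w]
    by (simp add: matrix_vector_right_distrib)
qed

text \<open>Since \<open>A_N = I\<close>, steps 2 and 3 see the same constraint residual up to the
  last step. Eliminating it expresses the multiplier by the gradient estimate and the step
  alone.\<close>

lemma lam_formula:
  assumes w: "w \<in> space P"
  shows "lam (Suc k) w = last_block e (est k N w) - (\<beta> - 1 / \<gamma>) *\<^sub>R last_block e (d k N w)"
proof -
  define z where "z = A *v xh k N w - b"
  have "(1 / \<gamma>) *\<^sub>R last_block e (d k N w) = - (last_block e (est k N w) - lam k w + \<beta> *\<^sub>R z)"
    using gamma unfolding last_step[OF w] z_def by simp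
  then have z: "\<beta> *\<^sub>R z = lam k w - last_block e (est k N w) - (1 / \<gamma>) *\<^sub>R last_block e (d k N w)"
    by (simp add: algebra_simps)
  have "lam (Suc k) w = lam k w - (\<beta> *\<^sub>R z + \<beta> *\<^sub>R last_block e (d k N w))"
    unfolding lam_step[OF w] constraint_last z_def by (simp add: scaleR_add_right)
  then show ?thesis unfolding z by (simp add: algebra_simps)
qed

lemma norm_last_d: "norm (last_block e (d k N w)) = norm (d k N w)"
  using norm_last_block[OF last_block_coords] block_id[OF d_mem] by metis

lemma r_sum_Suc:
  assumes i: "i \<in> {1..<N}"
  shows "(\<Sum>j\<in>{1..<N}. r j (block c j (xh k (Suc i) w)))
    = (\<Sum>j\<in>{1..<N}. r j (block c j (xh k i w)))
      + (r i (block c i (x (Suc k) w)) - r i (block c i (x k w)))"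
proof -
  have "(\<Sum>j\<in>{1..<N}. r j (block c j (xh k (Suc i) w)) - r j (block c j (xh k i w)))
      = (\<Sum>j\<in>{1..<N}. if j = i then r i (block c i (x (Suc k) w)) - r i (block c i (x k w)) else 0)"
    by (intro sum.cong refl) (auto simp: block_xh)
  also have "\<dots> = r i (block c i (x (Suc k) w)) - r i (block c i (x k w))" using i by simp
  finally show ?thesis by (simp add: sum_subtractf)
qed

lemma grad_d: "gradf (xh k i w) \<bullet> d k i w = est k i w \<bullet> d k i w - err k i w \<bullet> d k i w"
  using inner_block_space[OF d_mem[of k i w], of "gradf (xh k i w)"]
  by (simp add: err_def inner_diff_left)

lemma err_d: "- (err k i w \<bullet> d k i w) \<le> 1 / 2 * (norm (err k i w))^2 + 1 / 2 * (norm (d k i w))^2"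
  using inner_young[of 1 "err k i w" "d k i w"] by simp

text \<open>The estimate replaces the true gradient at the price of Young's inequality with weight
  1: hence \<open>L + 1\<close> instead of \<open>L\<close>, and one half of the squared
  error.\<close>

lemma f_step: "f (xh k (Suc i) w)
    \<le> f (xh k i w) + est k i w \<bullet> d k i w + (L + 1) / 2 * (norm (d k i w))^2 + 1 / 2 * (norm (err k i w))^2"
  using descent_upper[OF grad grad_Lipschitz, of "xh k (Suc i) w" "xh k i w"] grad_d[of k i w] err_d[of k i w]
  by (simp add: xh_Suc algebra_simps add_divide_distrib)

lemma descent_block:
  assumes w: "w \<in> space P" and i: "i \<in> {1..<N}"
  shows "AL (xh k (Suc i) w) (lam k w) \<le> AL (xh k i w) (lam k w)
    + ((L + 1) / 2 - sm i / 2) * (norm (d k i w))^2 + 1 / 2 * (norm (err k i w))^2"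
  using f_step[of k i w] block_step[OF w i, of k] r_sum_Suc[OF i, of k w] H_eigen(2)[OF i d_mem, of k w]
  unfolding AL_eq by (simp add: algebra_simps)

text \<open>Nothing is minimized here. Pairing the update with the step \<open>u\<close> evaluates
  all linear terms exactly as \<open>- 1 / \<gamma>\<close> times the squared step; expanding the
  penalty adds \<beta>/2 times it.\<close>

lemma descent_last:
  assumes w: "w \<in> space P"
  shows "AL (x (Suc k) w) (lam k w) \<le> AL (xh k N w) (lam k w)
    + ((\<beta> + L) / 2 - 1 / \<gamma> + 1 / 2) * (norm (d k N w))^2 + 1 / 2 * (norm (err k N w))^2"
proof -
  define z where "z = A *v xh k N w - b"
  define u where "u = last_block e (d k N w)"
  have nw: "norm u = norm (d k N w)" by (simp add: u_def norm_last_d)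
  have "u = - (\<gamma> *\<^sub>R (last_block e (est k N w) - lam k w + \<beta> *\<^sub>R z))"
    unfolding u_def z_def by (rule last_step[OF w])
  then have "(1 / \<gamma>) *\<^sub>R u = - (last_block e (est k N w) - lam k w + \<beta> *\<^sub>R z)" using gamma by simp
  then have "(1 / \<gamma>) * (u \<bullet> u) = - (last_block e (est k N w) - lam k w + \<beta> *\<^sub>R z) \<bullet> u"
    by (metis inner_scaleR_left)
  then have w2: "(1 / \<gamma>) * (norm u)^2 = - (last_block e (est k N w) \<bullet> u) + lam k w \<bullet> u - \<beta> * (z \<bullet> u)"
    by (simp add: power2_norm_eq_inner inner_simps)
  have est: "last_block e (est k N w) \<bullet> u = est k N w \<bullet> d k N w"
    unfolding u_def inner_last_block[OF last_block_coords] block_id[OF d_mem]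
    by (rule inner_block_space[OF d_mem])
  have "constr (x (Suc k) w) (lam k w) = constr (xh k N w) (lam k w) - u \<bullet> lam k w + \<beta> * (z \<bullet> u) + \<beta> / 2 * (norm u)^2"
    unfolding constr_def constraint_last z_def[symmetric] u_def[symmetric]
    by (simp add: power2_norm_eq_inner inner_simps algebra_simps inner_commute[of u z])
  moreover have "(\<Sum>j\<in>{1..<N}. r j (block c j (x (Suc k) w))) = (\<Sum>j\<in>{1..<N}. r j (block c j (xh k N w)))"
    by (intro sum.cong refl) (simp add: block_xh)
  ultimately show ?thesis
    using f_step[of k N w] w2 unfolding AL_eq xh_last nw est
    by (simp add: algebra_simps inner_commute add_divide_distrib)
qed

lemma descent_sweep:
  assumes w: "w \<in> space P" and n: "n < N"
  shows "AL (xh k (Suc n) w) (lam k w) \<le> AL (x k w) (lam k w)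
    + (\<Sum>i=1..n. ((L + 1) / 2 - sm i / 2) * (norm (d k i w))^2 + 1 / 2 * (norm (err k i w))^2)"
  using n
proof (induction n)
  case 0
  then show ?case by (simp add: xh_1)
next
  case (Suc n)
  then show ?case using descent_block[OF w, of "Suc n" k] by simp
qed

text \<open>The multiplier moves along the residual \<open>z\<close>, so the Lagrangian rises by
  exactly \<beta> times its squared norm. Apart from noise this is the only ascent to be
  compensated.\<close>

lemma descent_multiplier:
  assumes w: "w \<in> space P"
  shows "AL (x (Suc k) w) (lam (Suc k) w)
    = AL (x (Suc k) w) (lam k w) + 1 / \<beta> * (norm (lam (Suc k) w - lam k w))^2"
proof -
  define z where "z = A *v x (Suc k) w - b"
  have l: "lam (Suc k) w = lam k w - \<beta> *\<^sub>R z" using lam_step[OF w] by (simp add: z_def)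
  have "z \<bullet> lam (Suc k) w = z \<bullet> lam k w - \<beta> * (norm z)^2"
    unfolding l by (simp add: inner_diff_right power2_norm_eq_inner)
  moreover have "1 / \<beta> * (norm (lam (Suc k) w - lam k w))^2 = \<beta> * (norm z)^2"
    unfolding l using beta_pos by (simp add: power_mult_distrib power2_eq_square)
  ultimately show ?thesis unfolding AL_eq constr_def z_def[symmetric] by simp
qed

lemma descent_iteration:
  assumes w: "w \<in> space P"
  shows "AL (x (Suc k) w) (lam (Suc k) w) \<le> AL (x k w) (lam k w)
    + (\<Sum>i\<in>{1..<N}. ((L + 1) / 2 - sm i / 2) * (norm (d k i w))^2)
    + ((\<beta> + L) / 2 - 1 / \<gamma> + 1 / 2) * (norm (d k N w))^2
    + 1 / 2 * (\<Sum>i=1..N. (norm (err k i w))^2) + 1 / \<beta> * (norm (lam (Suc k) w - lam k w))^2"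
proof -
  obtain n where n: "N = Suc n" using N by (cases N) auto
  then have "{1..n} = {1..<N}" by auto
  then have "AL (xh k N w) (lam k w) \<le> AL (x k w) (lam k w)
    + ((\<Sum>i\<in>{1..<N}. ((L + 1) / 2 - sm i / 2) * (norm (d k i w))^2) + 1 / 2 * (\<Sum>i\<in>{1..<N}. (norm (err k i w))^2))"
    using descent_sweep[OF w, of n k] n by (simp only: sum.distrib sum_distrib_left)
  then show ?thesis
    using descent_last[OF w, of k] descent_multiplier[OF w, of k] unfolding sum_split_last
    by (simp add: algebra_simps)
qed

section \<open>Multiplier differences and the potential\<close>

text \<open>At call \<open>N\<close> the first blocks are already new while the last one is still
  old. The difference of two such points therefore combines the current steps of the first blocks
  with the previous step of the last.\<close>

lemma xh_diff_norm:
  "(norm (xh (Suc k) N w - xh k N w))^2 = (\<Sum>i\<in>{1..<N}. (norm (d (Suc k) i w))^2) + (norm (d k N w))^2"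
proof -
  have "(norm (xh (Suc k) N w - xh k N w))^2 = (\<Sum>i=1..N. (norm (block c i (xh (Suc k) N w - xh k N w)))^2)"
    using sum_norm_block[OF blocks'] by simp
  also have "\<dots> = (\<Sum>i\<in>{1..<N}. (norm (d (Suc k) i w))^2) + (norm (d k N w))^2"
    unfolding sum_split_last by (simp add: block_simps block_xh d_def)
  finally show ?thesis .
qed

lemma last_block_est:
  "last_block e (est k N w) = last_block e (err k N w) + last_block e (gradf (xh k N w))"
  unfolding err_def last_block_simps last_block_block[OF last_block_coords] by simp

lemma last_block_grad_diff:
  "(norm (last_block e (gradf y - gradf z)))^2 \<le> L^2 * (norm (y - z))^2"
proof -
  have "norm (last_block e (gradf y - gradf z)) \<le> norm (gradf y - gradf z)"
    unfolding norm_last_block[OF last_block_coords] by (rule norm_block_le)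
  also have "\<dots> \<le> L * norm (y - z)"
    using lipschitz_onD[OF grad_Lipschitz, of y z] by (simp add: dist_norm)
  finally show ?thesis by (metis power_mono norm_ge_zero power_mult_distrib)
qed

lemma last_block_err_le: "(norm (last_block e (err k N w)))^2 \<le> (norm (err k N w))^2"
  unfolding norm_last_block[OF last_block_coords] by (intro power_mono norm_block_le) auto

lemma xh_last_diff: "x (Suc k) w - xh k N w = d k N w"
  using xh_Suc[of k N w] by (simp add: xh_last)

text \<open>Four terms, hence the factor 4. The two errors are kept together as one difference, so
  that their orthogonality can be used in expectation.\<close>

lemma lam_diff:
  assumes w: "w \<in> space P"
  shows "(norm (lam (Suc (Suc k)) w - lam (Suc k) w))^2
    \<le> 4 * (norm (err (Suc k) N w - err k N w))^2
      + 4 * L^2 * ((\<Sum>i\<in>{1..<N}. (norm (d (Suc k) i w))^2) + (norm (d k N w))^2)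
      + 4 * (\<beta> - 1 / \<gamma>)^2 * ((norm (d (Suc k) N w))^2 + (norm (d k N w))^2)"
proof -
  define B where "B = \<beta> - 1 / \<gamma>"
  define p where "p = last_block e (err (Suc k) N w - err k N w)"
  define q where "q = last_block e (gradf (xh (Suc k) N w) - gradf (xh k N w))"
  define u where "u = - B *\<^sub>R last_block e (d (Suc k) N w)"
  define v where "v = B *\<^sub>R last_block e (d k N w)"
  have eq: "lam (Suc (Suc k)) w - lam (Suc k) w = (p + q) + (u + v)"
    unfolding lam_formula[OF w] last_block_est p_def q_def u_def v_def B_def[symmetric] last_block_simps
    by (simp add: algebra_simps)
  have "(norm ((p + q) + (u + v)))^2 \<le> 4 * (norm p)^2 + 4 * (norm q)^2 + 4 * (norm u)^2 + 4 * (norm v)^2"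
    using norm_add_sq_le2[of "p + q" "u + v"] norm_add_sq_le2[of p q] norm_add_sq_le2[of u v] by linarith
  moreover have "(norm p)^2 \<le> (norm (err (Suc k) N w - err k N w))^2"
    unfolding p_def norm_last_block[OF last_block_coords] by (intro power_mono norm_block_le) auto
  moreover have "(norm q)^2 \<le> L^2 * (norm (xh (Suc k) N w - xh k N w))^2"
    unfolding q_def by (rule last_block_grad_diff)
  moreover have "(norm u)^2 = B^2 * (norm (d (Suc k) N w))^2" "(norm v)^2 = B^2 * (norm (d k N w))^2"
    by (simp_all add: u_def v_def norm_last_d power_mult_distrib)
  moreover have "4 * B^2 * ((norm (d (Suc k) N w))^2 + (norm (d k N w))^2)
      = 4 * (B^2 * (norm (d (Suc k) N w))^2) + 4 * (B^2 * (norm (d k N w))^2)"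
    by (simp add: algebra_simps)
  ultimately show ?thesis
    unfolding eq xh_diff_norm B_def[symmetric] by linarith
qed

text \<open>Indexed so that \<open>pot 0\<close> is the potential at the first iterate with the
  initial last block as the extra argument, as it occurs in \<open>K\<close>.\<close>

definition pot :: "nat \<Rightarrow> 'w \<Rightarrow> real" where
  "pot k w = potential N c e A b f r L \<beta> \<gamma> (x (Suc k) w) (lam (Suc k) w) (last_block e (x k w))"

lemma pot_eq: "pot k w = AL (x (Suc k) w) (lam (Suc k) w)
    + 4 / \<beta> * ((\<beta> - 1 / \<gamma>)^2 + L^2) * (norm (d k N w))^2"
proof -
  have "norm (last_block e (x k w) - last_block e (x (Suc k) w)) = norm (d k N w)"
    unfolding d_def norm_last_block[OF last_block_coords, symmetric] last_block_simps
    by (rule norm_minus_commute)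
  then show ?thesis by (simp add: pot_def potential_def)
qed

text \<open>The delayed term \<open>4 / \<beta> * (B^2 + L^2) * dN'\<close> of the multiplier
  difference is exactly the extra term of \<open>pot k\<close>. The same term in
  \<open>pot (Suc k)\<close> adds to \<open>4 * B^2 / \<beta>\<close>, which explains
  \<open>8 / \<beta> * B^2 + 4 * L^2 / \<beta>\<close> in the bound on \<open>t\<close>.\<close>

lemma pot_descent:
  assumes w: "w \<in> space P"
    and t1: "t \<le> - ((\<beta> + L) / 2 - 1 / \<gamma> + 8 / \<beta> * (\<beta> - 1 / \<gamma>)^2 + 4 * L^2 / \<beta> + 1 / 2)"
    and t2: "\<And>i. i \<in> {1..<N} \<Longrightarrow> t \<le> - (4 * L^2 / \<beta> + (L + 1) / 2 - sm i / 2)"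
  shows "pot (Suc k) w \<le> pot k w - t * (norm (x (Suc (Suc k)) w - x (Suc k) w))^2
    + 1 / 2 * (\<Sum>i=1..N. (norm (err (Suc k) i w))^2) + 4 / \<beta> * (norm (err (Suc k) N w - err k N w))^2"
proof -
  define B where "B = \<beta> - 1 / \<gamma>"
  define S where "S = (\<Sum>i\<in>{1..<N}. (norm (d (Suc k) i w))^2)"
  define dN where "dN = (norm (d (Suc k) N w))^2"
  define dN' where "dN' = (norm (d k N w))^2"
  define E where "E = (norm (err (Suc k) N w - err k N w))^2"
  have "(\<Sum>i\<in>{1..<N}. ((L + 1) / 2 - sm i / 2) * (norm (d (Suc k) i w))^2)
      \<le> (\<Sum>i\<in>{1..<N}. (- t - 4 * L^2 / \<beta>) * (norm (d (Suc k) i w))^2)"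
  proof (intro sum_mono mult_right_mono)
    fix i assume "i \<in> {1..<N}"
    from t2[OF this] show "(L + 1) / 2 - sm i / 2 \<le> - t - 4 * L^2 / \<beta>" by linarith
  qed simp
  also have "\<dots> = (- t - 4 * L^2 / \<beta>) * S" by (simp add: S_def sum_distrib_left)
  finally have s1: "(\<Sum>i\<in>{1..<N}. ((L + 1) / 2 - sm i / 2) * (norm (d (Suc k) i w))^2)
      \<le> - t * S - 4 * L^2 / \<beta> * S" by (simp add: algebra_simps)
  have "1 / \<beta> * (norm (lam (Suc (Suc k)) w - lam (Suc k) w))^2
      \<le> 1 / \<beta> * (4 * E + 4 * L^2 * (S + dN') + 4 * B^2 * (dN + dN'))"
    using lam_diff[OF w, of k] beta_pos unfolding S_def dN_def dN'_def E_def B_def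
    by (intro mult_left_mono) auto
  also have "\<dots> = 4 / \<beta> * E + 4 * L^2 / \<beta> * S + 4 * B^2 / \<beta> * dN + 4 / \<beta> * (B^2 + L^2) * dN'"
    using beta_pos by (simp add: field_simps)
  finally have s2: "1 / \<beta> * (norm (lam (Suc (Suc k)) w - lam (Suc k) w))^2
      \<le> 4 / \<beta> * E + 4 * L^2 / \<beta> * S + 4 * B^2 / \<beta> * dN + 4 / \<beta> * (B^2 + L^2) * dN'" .
  have "((\<beta> + L) / 2 - 1 / \<gamma> + 1 / 2) * dN \<le> (- t - 8 / \<beta> * B^2 - 4 * L^2 / \<beta>) * dN"
    using t1 by (intro mult_right_mono) (auto simp: B_def dN_def)
  then have s3: "((\<beta> + L) / 2 - 1 / \<gamma> + 1 / 2) * dN + 4 * B^2 / \<beta> * dN + 4 / \<beta> * (B^2 + L^2) * dN \<le> - t * dN"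
    using beta_pos by (simp add: field_simps)
  have "t * (norm (x (Suc (Suc k)) w - x (Suc k) w))^2 = t * S + t * dN"
    unfolding sum_d[symmetric] sum_split_last S_def dN_def by (simp add: algebra_simps)
  then show ?thesis
    using descent_iteration[OF w, of "Suc k"] s1 s2 s3
    unfolding pot_eq B_def[symmetric] dN_def[symmetric] dN'_def[symmetric] E_def[symmetric]
    by linarith
qed

text \<open>
  The minimum \<open>f\<^sup>*\<close> is compared with \<open>f\<close> at the feasible point obtained by correcting the last block,
  which moves by exactly the constraint residual because \<open>A_N = I\<close>.
\<close>

lemma pot_lower:
  assumes w: "w \<in> space P"
  shows "pot k w \<ge> (\<Sum>i\<in>{1..<N}. rstar i) + fstar - 2 / \<beta> * (norm (err k N w))^2"
proof -
  define B where "B = \<beta> - 1 / \<gamma>"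
  define z where "z = A *v x (Suc k) w - b"
  define dN where "dN = d k N w"
  define u where "u = block c N (transpose A *v z)"
  define y where "y = x (Suc k) w - u"
  have lw: "last_block e u = z"
    unfolding u_def by (simp only: last_block_block[OF last_block_coords] last_block_transpose[OF last_block_coords A_N])
  have nw: "norm u = norm z"
    using norm_last_block[OF last_block_coords, of u] lw by (simp add: u_def block_block)
  have "y \<in> {y. \<forall>i\<in>{1..<N}. block c i y \<in> \<M> i \<inter> X i}"
    using feasible[OF w, of _ "Suc k"] by (auto simp: y_def u_def block_simps block_block)
  then have "fstar \<le> f y" unfolding fstar by (intro cInf_lower imageI f_bdd)
  also have "f y \<le> f (x (Suc k) w) - gradf (x (Suc k) w) \<bullet> u + L / 2 * (norm z)^2"
    using descent_upper[OF grad grad_Lipschitz, of y "x (Suc k) w"] by (simp add: y_def nw)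
  also have "gradf (x (Suc k) w) \<bullet> u = last_block e (gradf (x (Suc k) w)) \<bullet> z"
    using inner_last_block[OF last_block_coords, of "gradf (x (Suc k) w)" u] lw
    by (simp add: u_def block_block inner_block)
  finally have f: "f (x (Suc k) w) \<ge> fstar + last_block e (gradf (x (Suc k) w)) \<bullet> z - L / 2 * (norm z)^2"
    by simp
  define v where "v = last_block e (gradf (x (Suc k) w)) - last_block e (gradf (xh k N w)) + B *\<^sub>R last_block e dN"
  have diff: "last_block e (gradf (x (Suc k) w)) - lam (Suc k) w = v - last_block e (err k N w)"
    unfolding lam_formula[OF w] last_block_est v_def B_def dN_def by (simp add: algebra_simps)
  have nv: "(norm v)^2 \<le> 2 * (B^2 + L^2) * (norm dN)^2"
  proof -
    have "(norm (last_block e (gradf (x (Suc k) w) - gradf (xh k N w))))^2 \<le> L^2 * (norm dN)^2"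
      using last_block_grad_diff[of "x (Suc k) w" "xh k N w"] by (simp only: xh_last_diff dN_def)
    moreover have "(norm (B *\<^sub>R last_block e dN))^2 = B^2 * (norm dN)^2"
      by (simp add: dN_def norm_last_d power_mult_distrib)
    moreover have "2 * (B^2 + L^2) * (norm dN)^2 = 2 * (B^2 * (norm dN)^2) + 2 * (L^2 * (norm dN)^2)"
      by (simp add: algebra_simps)
    ultimately show ?thesis
      using norm_add_sq_le2[of "last_block e (gradf (x (Suc k) w) - gradf (xh k N w))" "B *\<^sub>R last_block e dN"]
      unfolding v_def last_block_simps by linarith
  qed
  \<comment> \<open>This weight leaves \<beta>/8 on the squared norm of \<open>z\<close> for each of
    the two cross terms; with \<open>L / 2\<close> from the descent estimate the total stays below
    \<beta>/2 because \<beta> exceeds \<open>2 * L\<close>. The coefficient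
    \<open>2 / \<beta>\<close> is matched by the extra term of the potential.\<close>
  have y1: "- (v \<bullet> z) \<le> 2 / \<beta> * (norm v)^2 + \<beta> / 8 * (norm z)^2"
    using inner_young[of "4 / \<beta>" v z] beta_pos by simp
  have "2 / \<beta> * (norm (last_block e (err k N w)))^2 \<le> 2 / \<beta> * (norm (err k N w))^2"
    using beta_pos by (intro mult_left_mono last_block_err_le) auto
  then have y2: "last_block e (err k N w) \<bullet> z \<le> 2 / \<beta> * (norm (err k N w))^2 + \<beta> / 8 * (norm z)^2"
    using inner_young[of "4 / \<beta>" "last_block e (err k N w)" z] beta_pos by simp
  have "2 / \<beta> * (norm v)^2 \<le> 2 / \<beta> * (2 * (B^2 + L^2) * (norm dN)^2)"
    using nv beta_pos by (intro mult_left_mono) auto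
  also have "\<dots> = 4 / \<beta> * (B^2 + L^2) * (norm dN)^2" using beta_pos by (simp add: field_simps)
  finally have y3: "2 / \<beta> * (norm v)^2 \<le> 4 / \<beta> * (B^2 + L^2) * (norm dN)^2" .
  have y4: "(\<beta> / 2 - L / 2 - \<beta> / 4) * (norm z)^2 \<ge> 0"
    using beta L by (intro mult_nonneg_nonneg) auto
  have y5: "last_block e (gradf (x (Suc k) w)) \<bullet> z - z \<bullet> lam (Suc k) w = v \<bullet> z - last_block e (err k N w) \<bullet> z"
    using arg_cong[OF diff, of "\<lambda>u. u \<bullet> z"] by (simp only: inner_diff_left inner_commute[of "lam _ _" z])
  have "(\<Sum>i\<in>{1..<N}. rstar i) \<le> (\<Sum>i\<in>{1..<N}. r i (block c i (x (Suc k) w)))"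
    by (intro sum_mono rstar_le[OF w])
  then show ?thesis
    using f y1 y2 y3 y4 y5 unfolding pot_eq AL_eq constr_def z_def[symmetric] dN_def[symmetric] B_def[symmetric]
    by (simp add: algebra_simps)
qed

section \<open>Stationarity residuals in terms of steps and errors\<close>

text \<open>The new multiplier is a gradient estimate at \<open>xh k N\<close>, so the residual
  consists of a gradient difference, a multiple of the last step and the sampling error.\<close>

lemma residual_last:
  assumes w: "w \<in> space P"
  shows "(norm (block c N (gradf (x (Suc k) w)) - transpose (block_cols c N A) *v lam (Suc k) w))^2
    \<le> 3 * ((\<beta> - 1 / \<gamma>)^2 + L^2) * (norm (d k N w))^2 + 3 * (norm (err k N w))^2"
proof -
  define B where "B = \<beta> - 1 / \<gamma>"
  define dN where "dN = d k N w"
  have "block c N (gradf (x (Suc k) w)) - transpose (block_cols c N A) *v lam (Suc k) w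
      = block c N (gradf (x (Suc k) w) - transpose A *v lam (Suc k) w)"
    by (simp only: transpose_block_cols_mult block_simps)
  then have n: "norm (block c N (gradf (x (Suc k) w)) - transpose (block_cols c N A) *v lam (Suc k) w)
      = norm (last_block e (gradf (x (Suc k) w)) - lam (Suc k) w)"
    by (simp only: norm_last_block[OF last_block_coords, symmetric] last_block_simps
        last_block_transpose[OF last_block_coords A_N])
  define p where "p = last_block e (gradf (x (Suc k) w) - gradf (xh k N w))"
  define q where "q = B *\<^sub>R last_block e dN"
  define s where "s = - last_block e (err k N w)"
  have eq: "last_block e (gradf (x (Suc k) w)) - lam (Suc k) w = p + q + s"
    unfolding lam_formula[OF w] last_block_est p_def q_def s_def B_def dN_def last_block_simps by (simp add: algebra_simps)
  \<comment> \<open>The weight \<open>1 / 2\<close> makes all three final factors equal to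
    3.\<close>
  have "(norm (p + q + s))^2 \<le> 3 / 2 * (norm (p + q))^2 + 3 * (norm s)^2"
    using norm_add_sq_le[of "1 / 2" "p + q" s] by simp
  moreover have "(norm (p + q))^2 \<le> 2 * (norm p)^2 + 2 * (norm q)^2" by (rule norm_add_sq_le2)
  moreover have "(norm p)^2 \<le> L^2 * (norm dN)^2"
    using last_block_grad_diff[of "x (Suc k) w" "xh k N w"] by (simp only: xh_last_diff p_def dN_def)
  moreover have "(norm q)^2 = B^2 * (norm dN)^2" by (simp add: q_def dN_def norm_last_d power_mult_distrib)
  moreover have "(norm s)^2 \<le> (norm (err k N w))^2"
    unfolding s_def norm_minus_cancel by (rule last_block_err_le)
  moreover have "3 * (B^2 + L^2) * (norm dN)^2 = 3 * (B^2 * (norm dN)^2) + 3 * (L^2 * (norm dN)^2)"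
    by (simp add: algebra_simps)
  ultimately show ?thesis
    unfolding n eq B_def[symmetric] dN_def[symmetric] by linarith
qed

text \<open>The residual is the multiplier difference divided by \<beta>. Two consecutive steps
  appear because the last block contributes with its delay.\<close>

lemma residual_constraint:
  assumes w: "w \<in> space P"
  shows "(norm (A *v x (Suc (Suc k)) w - b))^2
    \<le> 4 / \<beta>^2 * (norm (err (Suc k) N w - err k N w))^2
      + 4 / \<beta>^2 * ((\<beta> - 1 / \<gamma>)^2 + L^2)
        * ((norm (x (Suc (Suc k)) w - x (Suc k) w))^2 + (norm (x (Suc k) w - x k w))^2)"
proof -
  define B where "B = \<beta> - 1 / \<gamma>"
  define S where "S = (\<Sum>i\<in>{1..<N}. (norm (d (Suc k) i w))^2)"
  define dN where "dN = (norm (d (Suc k) N w))^2"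
  define dN' where "dN' = (norm (d k N w))^2"
  define E where "E = (norm (err (Suc k) N w - err k N w))^2"
  define T where "T = (norm (x (Suc (Suc k)) w - x (Suc k) w))^2"
  define T' where "T' = (norm (x (Suc k) w - x k w))^2"
  have T: "T = S + dN" unfolding T_def sum_d[symmetric] sum_split_last S_def dN_def ..
  have T': "dN' \<le> T'" unfolding T'_def sum_d[symmetric] dN'_def sum_split_last by (simp add: sum_nonneg)
  have nonneg: "S \<ge> 0" "dN \<ge> 0" "dN' \<ge> 0" by (auto simp: S_def dN_def dN'_def sum_nonneg)
  have "lam (Suc (Suc k)) w - lam (Suc k) w = - (\<beta> *\<^sub>R (A *v x (Suc (Suc k)) w - b))"
    using lam_step[OF w, of "Suc k"] by simp
  then have "\<beta>^2 * (norm (A *v x (Suc (Suc k)) w - b))^2 = (norm (lam (Suc (Suc k)) w - lam (Suc k) w))^2"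
    by (simp add: power_mult_distrib)
  also have "\<dots> \<le> 4 * E + 4 * L^2 * (S + dN') + 4 * B^2 * (dN + dN')"
    using lam_diff[OF w, of k] unfolding S_def dN_def dN'_def E_def B_def by simp
  also have "\<dots> \<le> 4 * E + 4 * L^2 * (T + T') + 4 * B^2 * (T + T')"
    using T T' nonneg by (intro add_mono mult_left_mono) auto
  finally have "(norm (A *v x (Suc (Suc k)) w - b))^2 \<le> (4 * E + 4 * L^2 * (T + T') + 4 * B^2 * (T + T')) / \<beta>^2"
    using beta_pos by (simp add: pos_le_divide_eq mult.commute)
  also have "\<dots> = 4 / \<beta>^2 * E + 4 / \<beta>^2 * (B^2 + L^2) * (T + T')"
    using beta_pos by (simp add: field_simps)
  finally show ?thesis unfolding E_def B_def T_def T'_def .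
qed

lemma constr_gderiv:
  "GDERIV (\<lambda>y. constr y l) y :> transpose A *v (\<beta> *\<^sub>R (A *v y - b) - l)"
proof -
  have lin: "((\<lambda>y. A *v y - b) has_derivative (\<lambda>h. A *v h)) (at y)"
    using bounded_linear_imp_has_derivative[OF matrix_vector_mul_bounded_linear[of A], of "at y"]
    by (auto intro!: derivative_eq_intros)
  have "((\<lambda>y. - ((A *v y - b) \<bullet> l) + \<beta> / 2 * ((A *v y - b) \<bullet> (A *v y - b)))
      has_derivative (\<lambda>h. - ((A *v h) \<bullet> l) + \<beta> / 2 * ((A *v y - b) \<bullet> (A *v h) + (A *v h) \<bullet> (A *v y - b)))) (at y)"
    by (rule derivative_eq_intros lin refl)+ (simp add: algebra_simps)
  moreover have "- ((A *v h) \<bullet> l) + \<beta> / 2 * ((A *v y - b) \<bullet> (A *v h) + (A *v h) \<bullet> (A *v y - b))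
      = h \<bullet> (transpose A *v (\<beta> *\<^sub>R (A *v y - b) - l))" for h
  proof -
    have "h \<bullet> (transpose A *v w) = (A *v h) \<bullet> w" for w
      using dot_lmul_matrix[of h "transpose A" w] by (metis vector_transpose_matrix)
    then show ?thesis by (simp only:) (simp add: inner_simps inner_commute[of "A *v h"] algebra_simps)
  qed
  ultimately show ?thesis
    unfolding gderiv_def constr_def power2_norm_eq_inner by (simp only:)
qed

text \<open>Precomposing with the block projection extends \<open>r i\<close> to a finite convex
  function on the whole space, where it is also continuous.\<close>

lemma convex_r_block:
  assumes i: "i \<in> {1..<N}"
  shows "convex_on UNIV (\<lambda>y. r i (block c i y))"
proof (rule convex_onI)
  fix t :: real and y z :: "real^'n" assume "0 < t" "t < 1"
  then show "r i (block c i ((1 - t) *\<^sub>R y + t *\<^sub>R z)) \<le> (1 - t) * r i (block c i y) + t * r i (block c i z)"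
    using convex_onD[OF r_convex[OF i], of t "block c i y" "block c i z"] block_mem[of c i]
    by (simp add: block_simps)
qed simp

text \<open>Both parts of the block objective are pulled back along the block projection, so that
  the optimality condition can be applied in the whole space; the gradient is projected
  accordingly.\<close>

lemma optimality_block:
  fixes k
  assumes w: "w \<in> space P" and i: "i \<in> {1..<N}"
  defines "xi \<equiv> block c i (x (Suc k) w)"
  obtains g where "g \<in> subdifferential (block_space c i) (r i) xi"
    "closest_point (tangent_space (\<M> i) xi)
      (- block c i (est k i w + transpose A *v (\<beta> *\<^sub>R (A *v xh k (Suc i) w - b) - lam k w) + H i *v d k i w) - g)
     \<in> manifold_normal_cone (\<M> i) (X i \<inter> \<M> i) xi"
proof -
  define bx where "bx = block c i (x k w)"
  define a where "a = est k i w + transpose A *v (\<beta> *\<^sub>R (A *v xh k (Suc i) w - b) - lam k w) + H i *v d k i w"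
  define \<phi> where "\<phi> y = est k i w \<bullet> (y - bx) + constr (xh k i w + (y - bx)) (lam k w)
    + 1 / 2 * ((y - bx) \<bullet> (H i *v (y - bx)))" for y
  have \<M>i: "\<M> i \<subseteq> block_space c i" "embedded_submanifold (\<M> i)" using manifold[OF i] by auto
  have xi: "xi \<in> X i \<inter> \<M> i" using feasible[OF w i, of "Suc k"] by (auto simp: xi_def)
  have bxi: "block c i xi = xi" by (simp add: xi_def block_block)
  have xid: "xi - bx = d k i w" by (simp add: xi_def bx_def d_def block_simps)
  have min: "\<phi> (block c i xi) + r i (block c i xi) \<le> \<phi> (block c i y) + r i (block c i y)" if y: "y \<in> X i \<inter> \<M> i" for y
  proof -
    have ys: "y \<in> block_space c i" using y \<M>i by blast
    have bh: "block c i (xh k i w) = bx" by (simp add: block_xh bx_def)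
    have put: "put_block c i y (xh k i w) = xh k i w + (y - bx)" using put_block_eq[OF ys] bh by simp
    have xis: "xi \<in> block_space c i" by (simp add: xi_def block_mem)
    have put': "put_block c i xi (xh k i w) = xh k i w + (xi - bx)" using put_block_eq[OF xis] bh by simp
    have "y \<in> \<M> i \<inter> X i" using y by blast
    from arg_min_block(2)[OF w i this, of k] show ?thesis
      unfolding obj_def stochastic_lagrangian_def xi_def[symmetric] put put' bh bx_def[symmetric] bxi block_id[OF ys]
        \<phi>_def constr_def xid
      by simp
  qed
  have "((\<lambda>y. \<phi> y) has_derivative (\<lambda>h. h \<bullet> a)) (at xi)"
  proof -
    have sh: "((\<lambda>y. xh k i w + (y - bx)) has_derivative (\<lambda>h. h)) (at xi)"
      by (auto intro!: derivative_eq_intros)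
    have xh': "xh k i w + (xi - bx) = xh k (Suc i) w" by (simp add: xid xh_Suc)
    have c': "((\<lambda>y. constr (xh k i w + (y - bx)) (lam k w)) has_derivative
        (\<lambda>h. h \<bullet> (transpose A *v (\<beta> *\<^sub>R (A *v xh k (Suc i) w - b) - lam k w)))) (at xi)"
      using has_derivative_compose[OF sh, of "\<lambda>y. constr y (lam k w)"] constr_gderiv[of "lam k w" "xh k (Suc i) w"]
      unfolding gderiv_def xh' by blast
    have lin: "((\<lambda>y. H i *v (y - bx)) has_derivative (\<lambda>h. H i *v h)) (at xi)"
    proof -
      have "((\<lambda>y. y - bx) has_derivative (\<lambda>h. h)) (at xi)" by (auto intro!: derivative_eq_intros)
      then show ?thesis
        by (rule has_derivative_compose[OF _ bounded_linear_imp_has_derivative[OF matrix_vector_mul_bounded_linear]])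
    qed
    have sym: "v \<bullet> (H i *v u) = (H i *v v) \<bullet> u" for v u
      using dot_lmul_matrix[of v "H i" u] H_block[OF i] by (metis vector_transpose_matrix)
    have "(\<phi> has_derivative (\<lambda>h. est k i w \<bullet> h
        + h \<bullet> (transpose A *v (\<beta> *\<^sub>R (A *v xh k (Suc i) w - b) - lam k w))
        + 1 / 2 * ((xi - bx) \<bullet> (H i *v h) + h \<bullet> (H i *v (xi - bx))))) (at xi)"
      unfolding \<phi>_def by (rule derivative_eq_intros c' lin refl)+ simp
    moreover have "est k i w \<bullet> h + h \<bullet> (transpose A *v (\<beta> *\<^sub>R (A *v xh k (Suc i) w - b) - lam k w))
        + 1 / 2 * ((xi - bx) \<bullet> (H i *v h) + h \<bullet> (H i *v (xi - bx))) = h \<bullet> a" for h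
      unfolding a_def xid inner_add_right
      using sym[of "d k i w" h] by (simp add: inner_commute)
    ultimately show ?thesis by (simp only:)
  qed
  then have "(\<phi> has_derivative (\<lambda>h. h \<bullet> a)) (at (block c i xi))" by (simp add: bxi)
  from has_derivative_compose[OF bounded_linear_imp_has_derivative[OF bounded_linear_block] this]
  have "GDERIV (\<lambda>y. \<phi> (block c i y)) xi :> block c i a"
    by (simp add: gderiv_def inner_block)
  from first_order_optimality[OF \<M>i(2) _ xi convex_r_block[OF i] this min]
  obtain g where g: "\<And>y. r i (block c i y) \<ge> r i (block c i xi) + g \<bullet> (y - xi)"
    "closest_point (tangent_space (\<M> i) xi) (- block c i a - g) \<in> manifold_normal_cone (\<M> i) (X i \<inter> \<M> i) xi"
    by blast
  \<comment> \<open>The pulled-back function is constant in directions outside the block, so its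
    subgradient has no component there.\<close>
  have "g \<in> block_space c i"
  proof -
    define u where "u = g - block c i g"
    have bw: "block c i u = 0" by (simp add: u_def block_simps block_block)
    have "r i (block c i (xi + u)) = r i (block c i xi)" by (simp add: block_simps bw)
    then have "g \<bullet> u \<le> 0" using g(1)[of "xi + u"] by simp
    moreover have "block c i g \<bullet> u = 0" by (simp add: inner_block bw)
    ultimately have "u \<bullet> u \<le> 0" by (simp add: u_def inner_diff_left)
    then have "u = 0" by (meson inner_ge_zero antisym inner_eq_zero_iff)
    then show ?thesis using block_mem[of c i g] by (simp add: u_def)
  qed
  moreover have "r i y \<ge> r i xi + g \<bullet> (y - xi)" if "y \<in> block_space c i" for y
    using g(1)[of y] block_id[OF that] bxi by simp
  ultimately have "g \<in> subdifferential (block_space c i) (r i) xi" by (simp add: subdifferential_def)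
  then show thesis using that g(2) unfolding a_def by blast
qed

definition block_residual :: "nat \<Rightarrow> nat \<Rightarrow> 'w \<Rightarrow> real" where
  "block_residual k i w = (let xi = block c i (x (Suc k) w) in
      setdist
        (closest_point (tangent_space (\<M> i) xi) `
           {- block c i (gradf (x (Suc k) w)) + transpose (block_cols c i A) *v lam (Suc k) w - g | g.
              g \<in> subdifferential (block_space c i) (r i) xi})
        (manifold_normal_cone (\<M> i) (X i \<inter> \<M> i) xi))"

text \<open>The stationarity vector \<open>v\<close> and the vector from the optimality condition
  share the subgradient \<open>g\<close>; projection is nonexpansive, so their difference bounds the
  distance. It consists of the error, a gradient difference, a penalty term and the proximal
  term.\<close>

lemma residual_block:
  assumes w: "w \<in> space P" and i: "i \<in> {1..<N}"
    and Amax: "\<And>j. j \<in> {1..N} \<Longrightarrow> (spectral_norm (block_cols c j A))^2 \<le> Amax"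
    and Hmax: "spectral_norm (H i) \<le> Hmax"
  shows "block_residual k i w \<le> (L + \<beta> * sqrt (real N) * Amax + Hmax) * norm (x (Suc k) w - x k w) + norm (err k i w)"
proof -
  define xi where "xi = block c i (x (Suc k) w)"
  define x' where "x' = x (Suc k) w"
  define dx where "dx = norm (x (Suc k) w - x k w)"
  define u where "u = xh k (Suc i) w - x'"
  define a where "a = est k i w + transpose A *v (\<beta> *\<^sub>R (A *v xh k (Suc i) w - b) - lam k w) + H i *v d k i w"
  obtain g where g: "g \<in> subdifferential (block_space c i) (r i) xi"
    "closest_point (tangent_space (\<M> i) xi) (- block c i a - g) \<in> manifold_normal_cone (\<M> i) (X i \<inter> \<M> i) xi"
    using optimality_block[OF w i, of k] unfolding xi_def a_def by blast
  define v where "v = - block c i (gradf x') + transpose (block_cols c i A) *v lam (Suc k) w - g"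
  \<comment> \<open>A partially updated point differs from the new iterate by some of the block
    steps, which are mutually orthogonal.\<close>
  have sweep_le: "norm (sweep c j (x (Suc k) w) (x k w) - x (Suc k) w) \<le> dx" for j
  proof -
    have "(norm (sweep c j (x (Suc k) w) (x k w) - x (Suc k) w))^2
        = (\<Sum>l=1..N. (norm (block c l (sweep c j (x (Suc k) w) (x k w) - x (Suc k) w)))^2)"
      using sum_norm_block[OF blocks'] by simp
    also have "\<dots> \<le> (\<Sum>l=1..N. (norm (d k l w))^2)"
      by (intro sum_mono) (auto simp: block_simps block_sweep d_def norm_minus_commute)
    finally show ?thesis unfolding sum_d dx_def by (rule power2_le_imp_le) simp
  qed
  have xi_mem: "xi \<in> \<M> i" using feasible[OF w i, of "Suc k"] by (simp add: xi_def)
  have sub: "subspace (tangent_space (\<M> i) xi)"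
    using subspace_tangent_space manifold[OF i] xi_mem by blast
  have "setdist (closest_point (tangent_space (\<M> i) xi) `
           {- block c i (gradf x') + transpose (block_cols c i A) *v lam (Suc k) w - g | g.
              g \<in> subdifferential (block_space c i) (r i) xi})
        (manifold_normal_cone (\<M> i) (X i \<inter> \<M> i) xi)
      \<le> dist (closest_point (tangent_space (\<M> i) xi) v) (closest_point (tangent_space (\<M> i) xi) (- block c i a - g))"
    by (rule setdist_le_dist) (use g in \<open>auto simp: v_def\<close>)
  also have "\<dots> \<le> dist v (- block c i a - g)"
    using sub closed_subspace subspace_imp_convex subspace_0 by (intro closest_point_lipschitz) blast+
  also have "\<dots> = norm (block c i (err k i w + (gradf (xh k i w) - gradf x')
      + \<beta> *\<^sub>R (transpose A *v (A *v u)) + H i *v d k i w))"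
  proof -
    have "A *v xh k (Suc i) w - b = A *v u + (A *v x' - b)"
      by (simp add: u_def matrix_vector_mult_diff_distrib)
    \<comment> \<open>The multiplier update absorbs the residual at the new iterate; only the blocks
      not yet updated, collected in \<open>u\<close>, remain.\<close>
    then have "\<beta> *\<^sub>R (A *v xh k (Suc i) w - b) - lam k w = \<beta> *\<^sub>R (A *v u) - lam (Suc k) w"
      unfolding lam_step[OF w] x'_def by (simp add: algebra_simps)
    then have a: "a = est k i w + (\<beta> *\<^sub>R (transpose A *v (A *v u)) - transpose A *v lam (Suc k) w) + H i *v d k i w"
      unfolding a_def by (simp only: matrix_vector_mult_diff_distrib matrix_vector_mult_scaleR)
    have "v - (- block c i a - g) = block c i (err k i w + (gradf (xh k i w) - gradf x')
        + \<beta> *\<^sub>R (transpose A *v (A *v u)) + H i *v d k i w)"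
      unfolding v_def a err_def transpose_block_cols_mult block_simps block_block by (simp only: if_True refl) simp
    then show ?thesis by (simp only: dist_norm)
  qed
  also have "\<dots> \<le> norm (err k i w) + L * dx + \<beta> * (sqrt (real N) * Amax * dx) + Hmax * dx"
  proof -
    have n1: "norm (block c i (gradf (xh k i w) - gradf x')) \<le> L * dx"
    proof -
      have "norm (block c i (gradf (xh k i w) - gradf x')) \<le> norm (gradf (xh k i w) - gradf x')"
        by (rule norm_block_le)
      also have "\<dots> \<le> L * norm (xh k i w - x')"
        using lipschitz_onD[OF grad_Lipschitz, of "xh k i w" x'] by (simp add: dist_norm)
      also have "\<dots> \<le> L * dx" using L sweep_le[of i] by (intro mult_left_mono) (auto simp: xh_def x'_def)
      finally show ?thesis .
    qed
    have n2: "norm (block c i (H i *v d k i w)) \<le> Hmax * dx"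
    proof -
      have "norm (block c i (H i *v d k i w)) \<le> norm (H i *v d k i w)" by (rule norm_block_le)
      also have "\<dots> \<le> spectral_norm (H i) * norm (d k i w)" by (rule spectral_norm)
      also have "\<dots> \<le> Hmax * dx"
        using Hmax spectral_norm_nonneg[of "H i"] norm_block_le[of c i "x (Suc k) w - x k w"]
        by (intro mult_mono) (auto simp: d_def dx_def)
      finally show ?thesis .
    qed
    \<comment> \<open>One factor \<open>sqrt Amax\<close> comes from the transposed block, the other
      from summing over all blocks; the Cauchy-Schwarz inequality for that sum gives
      \<open>sqrt (real N)\<close>.\<close>
    have n3: "norm (block c i (transpose A *v (A *v u))) \<le> sqrt (real N) * Amax * dx"
    proof -
      define sp where "sp j = spectral_norm (block_cols c j A)" for j
      have sp: "sp j \<ge> 0" "j \<in> {1..N} \<Longrightarrow> sp j \<le> sqrt Amax" for j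
        using spectral_norm_nonneg Amax[of j] by (auto simp: sp_def real_le_rsqrt)
      have "(1::nat) \<in> {1..N}" using N by simp
      from order_trans[OF zero_le_power2 Amax[OF this]] have Amax0: "Amax \<ge> 0" .
      have "norm (block c i (transpose A *v (A *v u))) = norm (transpose (block_cols c i A) *v (A *v u))"
        by (simp only: transpose_block_cols_mult)
      also have "\<dots> \<le> sp i * norm (A *v u)" unfolding sp_def by (rule spectral_norm_transpose)
      also have "\<dots> \<le> sqrt Amax * (sqrt Amax * (sqrt (real N) * dx))"
      proof (rule mult_mono)
        have "A *v u = A *v (\<Sum>j=1..N. block c j u)" using sum_block[OF blocks', of u] by simp
        also have "\<dots> = (\<Sum>j=1..N. block_cols c j A *v block c j u)"
          by (simp add: linear_sum[OF matrix_vector_mul_linear[of A]] block_cols_mult block_block)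
        finally have "norm (A *v u) \<le> (\<Sum>j=1..N. norm (block_cols c j A *v block c j u))"
          by (simp add: norm_sum)
        also have "\<dots> \<le> (\<Sum>j=1..N. sqrt Amax * norm (block c j u))"
        proof (rule sum_mono)
          fix j assume j: "j \<in> {1..N}"
          have "norm (block_cols c j A *v block c j u) \<le> sp j * norm (block c j u)"
            unfolding sp_def by (rule spectral_norm)
          also have "\<dots> \<le> sqrt Amax * norm (block c j u)" using sp(2)[OF j] by (intro mult_right_mono) auto
          finally show "norm (block_cols c j A *v block c j u) \<le> sqrt Amax * norm (block c j u)" .
        qed
        also have "\<dots> = sqrt Amax * (\<Sum>j=1..N. norm (block c j u))" by (simp add: sum_distrib_left)
        also have "\<dots> \<le> sqrt Amax * (sqrt (real N) * dx)"
        proof (rule mult_left_mono)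
          have "(\<Sum>j=1..N. 1 * norm (block c j u))^2 \<le> (\<Sum>j=1..N. 1^2) * (\<Sum>j=1..N. (norm (block c j u))^2)"
            by (rule Cauchy_Schwarz_ineq_sum)
          also have "\<dots> = real N * (norm u)^2" using sum_norm_block[OF blocks', of u] by simp
          also have "\<dots> \<le> real N * dx^2"
            using sweep_le[of "Suc i"] by (intro mult_left_mono power_mono) (auto simp: u_def xh_def x'_def)
          also have "\<dots> = (sqrt (real N) * dx)^2" by (simp add: power_mult_distrib)
          finally have "(\<Sum>j=1..N. norm (block c j u))^2 \<le> (sqrt (real N) * dx)^2" by simp
          then show "(\<Sum>j=1..N. norm (block c j u)) \<le> sqrt (real N) * dx"
            by (rule power2_le_imp_le) (simp add: dx_def)
        qed (use Amax0 in simp)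
        finally show "norm (A *v u) \<le> sqrt Amax * (sqrt (real N) * dx)" .
      qed (use sp i Amax0 in auto)
      also have "\<dots> = sqrt (real N) * Amax * dx" using Amax0 by simp
      finally show ?thesis .
    qed
    have "norm (block c i (err k i w) + block c i (gradf (xh k i w) - gradf x')
        + \<beta> *\<^sub>R block c i (transpose A *v (A *v u)) + block c i (H i *v d k i w))
      \<le> norm (block c i (err k i w)) + norm (block c i (gradf (xh k i w) - gradf x'))
        + norm (\<beta> *\<^sub>R block c i (transpose A *v (A *v u))) + norm (block c i (H i *v d k i w))"
      by (intro norm_triangle_le add_mono order_refl)
    moreover have "norm (\<beta> *\<^sub>R block c i (transpose A *v (A *v u))) \<le> \<beta> * (sqrt (real N) * Amax * dx)"
      using n3 beta_pos by simp
    ultimately show ?thesis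
      using n1 n2 norm_block_le[of c i "err k i w"] unfolding block_simps(1,4) by linarith
  qed
  also have "\<dots> = (L + \<beta> * sqrt (real N) * Amax + Hmax) * dx + norm (err k i w)" by (simp add: algebra_simps)
  finally show ?thesis unfolding block_residual_def Let_def xi_def x'_def dx_def .
qed

end

context stochastic_admm_run
begin

subsection \<open>Expectations along the run\<close>

lemma gradient_sample:
  assumes i: "i \<in> {1..N}"
  shows "prob_space (D i)" "(\<lambda>(x, s). G i x s) \<in> borel_measurable (borel \<Otimes>\<^sub>M D i)"
    "integrable (D i) (G i y)" "(\<integral>s. G i y s \<partial>D i) = block c i (gradf y)"
    "(\<integral>\<^sup>+s. ennreal ((norm (G i y s - block c i (gradf y)))^2) \<partial>D i) \<le> ennreal (\<sigma>^2)"
  using unbiased i unfolding stochastic_oracle_def by blast+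

lemma sample:
  assumes i: "i \<in> {1..N}"
  shows "q < M \<Longrightarrow> \<xi> k i q \<in> measurable P (D i)" "q < M \<Longrightarrow> distr P (D i) (\<xi> k i q) = D i"
    "prob_space.indep_vars P (\<lambda>_. D i) (\<xi> k i) {..<M}"
    "prob_space.indep_set P (past P N c D M \<xi> x k i)
       (sigma_sets (space P) {\<xi> k i q -` B \<inter> space P | q B. q < M \<and> B \<in> sets (D i)})"
  using samples i unfolding fresh_samples_def by blast+

section \<open>What the past determines\<close>

abbreviation past_algebra :: "nat \<Rightarrow> nat \<Rightarrow> 'w measure" where
  "past_algebra k i \<equiv> sigma (space P) (past P N c D M \<xi> x k i)"

lemma past_sigma_algebra: "sigma_algebra (space P) (past P N c D M \<xi> x k i)"
  unfolding past_def by (rule sigma_algebra_sigma_sets) auto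

lemma past_algebra: "space (past_algebra k i) = space P" "sets (past_algebra k i) = past P N c D M \<xi> x k i"
proof -
  interpret sigma_algebra "space P" "past P N c D M \<xi> x k i" by (rule past_sigma_algebra)
  show "space (past_algebra k i) = space P" "sets (past_algebra k i) = past P N c D M \<xi> x k i"
    using space_closed by (auto simp: space_measure_of_conv sets_measure_of sigma_sets_eq)
qed

lemma block_past:
  assumes "l < k \<or> l = k \<and> j < i" "j \<in> {1..N}"
  shows "(\<lambda>w. block c j (x (Suc l) w)) \<in> borel_measurable (past_algebra k i)"
proof (rule measurableI)
  fix B :: "(real^'n) set" assume "B \<in> sets borel"
  then show "(\<lambda>w. block c j (x (Suc l) w)) -` B \<inter> space (past_algebra k i) \<in> sets (past_algebra k i)"
    unfolding past_algebra using assms unfolding past_def by (intro sigma_sets.Basic) blast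
qed simp

lemma sample_past:
  assumes "l < k \<or> l = k \<and> j < i" "j \<in> {1..N}" "q < M"
  shows "\<xi> l j q \<in> measurable (past_algebra k i) (D j)"
proof (rule measurableI)
  show "\<xi> l j q w \<in> space (D j)" if "w \<in> space (past_algebra k i)" for w
    using sample(1)[OF assms(2,3)] that past_algebra(1) by (auto dest: measurable_space)
  fix B assume "B \<in> sets (D j)"
  then show "\<xi> l j q -` B \<inter> space (past_algebra k i) \<in> sets (past_algebra k i)"
    unfolding past_algebra using assms unfolding past_def by (intro sigma_sets.Basic) blast
qed

text \<open>Blocks below \<open>i\<close> come from earlier calls of iteration \<open>l\<close>; the
  others come from the preceding iteration, or from the deterministic initial point if
  \<open>l = 0\<close>.\<close>

lemma xh_past:
  assumes "l < k \<or> l = k \<and> i \<le> i'"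
  shows "xh l i \<in> borel_measurable (past_algebra k i')"
proof -
  have "(\<lambda>w. block c j (xh l i w)) \<in> borel_measurable (past_algebra k i')" if j: "j \<in> {1..N}" for j
  proof (cases "j < i")
    case True
    then show ?thesis using block_past[of l k j i'] assms j by (auto simp: block_xh)
  next
    case False
    show ?thesis
    proof (cases l)
      case 0
      have "(\<lambda>w. block c j x0) \<in> borel_measurable (past_algebra k i')" by simp
      then show ?thesis
        by (rule measurable_cong[THEN iffD1, rotated])
          (use init False 0 in \<open>auto simp: block_xh past_algebra\<close>)
    next
      case (Suc l')
      then show ?thesis using block_past[of l' k j i'] assms j False by (auto simp: block_xh)
    qed
  qed
  then have "(\<lambda>w. \<Sum>j=1..N. block c j (xh l i w)) \<in> borel_measurable (past_algebra k i')"
    by (intro borel_measurable_sum)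
  then show ?thesis using sum_block[OF blocks'] by simp
qed

lemma grad_block_measurable: "(\<lambda>y. block c i (gradf y)) \<in> borel_measurable borel"
proof -
  have "gradf \<in> borel_measurable borel"
    using lipschitz_on_continuous_on[OF grad_Lipschitz] by (rule borel_measurable_continuous_onI)
  then show ?thesis
    using borel_measurable_continuous_onI[OF linear_continuous_on[OF bounded_linear_block[of c i], of UNIV]]
    by (rule measurable_compose)
qed

text \<open>Here the samples themselves have to belong to the past: the error is a function of the
  query point and the batch, both known before call \<open>(Suc k, N)\<close>.\<close>

lemma err_past: "err k N \<in> borel_measurable (past_algebra (Suc k) N)"
proof -
  have N': "N \<in> {1..N}" using N by simp
  have xh: "xh k N \<in> borel_measurable (past_algebra (Suc k) N)" by (rule xh_past) simp
  have "(\<lambda>w. G N (xh k N w) (\<xi> k N q w)) \<in> borel_measurable (past_algebra (Suc k) N)" if "q < M" for q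
    using measurable_compose[OF measurable_Pair[OF xh sample_past[OF _ N' that, of k "Suc k" N]] gradient_sample(2)[OF N']]
    by simp
  moreover have "(\<lambda>w. block c N (gradf (xh k N w))) \<in> borel_measurable (past_algebra (Suc k) N)"
    by (rule measurable_compose[OF xh grad_block_measurable])
  ultimately have "(\<lambda>w. (1 / real M) *\<^sub>R (\<Sum>q<M. G N (xh k N w) (\<xi> k N q w)) - block c N (gradf (xh k N w)))
      \<in> borel_measurable (past_algebra (Suc k) N)"
    by (intro borel_measurable_diff borel_measurable_scaleR borel_measurable_const borel_measurable_sum) auto
  then show ?thesis by (simp add: err_def[abs_def] est_def minibatch_def)
qed

interpretation P: prob_space P by (rule P)

lemma
  assumes i: "i \<in> {1..N}"
  shows err_sq: "sq_integrable P (err k i)"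
    and err_var: "P.expectation (\<lambda>w. (norm (err k i w))^2) \<le> \<sigma>^2 / real M"
    and err_orthogonal: "W \<in> borel_measurable (past_algebra k i) \<Longrightarrow> sq_integrable P W \<Longrightarrow>
      P.expectation (\<lambda>w. W w \<bullet> err k i w) = 0"
proof -
  have xh: "xh k i \<in> borel_measurable (past_algebra k i)" by (rule xh_past) simp
  note me = P.minibatch_error[OF gradient_sample(2)[OF i] grad_block_measurable gradient_sample(1,3,4,5)[OF i] sample(1,2,3)[OF i]
      M_pos past_sigma_algebra sample(4)[OF i] xh]
  have eq: "(\<lambda>w. minibatch (G i) M (xh k i w) (\<lambda>q. \<xi> k i q w) - block c i (gradf (xh k i w))) = err k i"
    by (simp add: err_def[abs_def] est_def)
  show "sq_integrable P (err k i)" using me(1) unfolding eq .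
  show "P.expectation (\<lambda>w. (norm (err k i w))^2) \<le> \<sigma>^2 / real M"
    using me(2) by (simp add: err_def est_def)
  show "W \<in> borel_measurable (past_algebra k i) \<Longrightarrow> sq_integrable P W \<Longrightarrow>
      P.expectation (\<lambda>w. W w \<bullet> err k i w) = 0"
    using me(3)[of W] by (simp add: err_def est_def)
qed

text \<open>The old error is known when the new batch is drawn, so the mixed term has mean zero and
  the variances add.\<close>

lemma err_diff_var:
  "P.expectation (\<lambda>w. (norm (err (Suc k) N w - err k N w))^2) \<le> 2 * (\<sigma>^2 / real M)"
proof -
  have N': "N \<in> {1..N}" using N by simp
  note sq = err_sq[OF N']
  have eq: "(norm (err (Suc k) N w - err k N w))^2
      = (norm (err (Suc k) N w))^2 + (norm (err k N w))^2 - 2 * (err k N w \<bullet> err (Suc k) N w)" for w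
    by (simp add: power2_norm_eq_inner inner_simps inner_commute)
  have "P.expectation (\<lambda>w. (norm (err (Suc k) N w - err k N w))^2)
      = P.expectation (\<lambda>w. (norm (err (Suc k) N w))^2) + P.expectation (\<lambda>w. (norm (err k N w))^2)
        - 2 * P.expectation (\<lambda>w. err k N w \<bullet> err (Suc k) N w)"
    unfolding eq using sq_integrableD(2)[OF sq] sq_integrable_inner[OF sq sq]
    by (simp add: Bochner_Integration.integral_diff Bochner_Integration.integral_add)
  then show ?thesis
    using err_var[OF N', of "Suc k"] err_var[OF N', of k] err_orthogonal[OF N' err_past sq] by simp
qed

section \<open>Integrability along the run\<close>

lemma r_measurable:
  assumes i: "i \<in> {1..<N}"
  shows "(\<lambda>w. r i (block c i (x k w))) \<in> borel_measurable P"
proof -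
  have "continuous_on UNIV (\<lambda>y. r i (block c i y))"
    using convex_on_continuous[OF open_UNIV] convex_r_block[OF i] by blast
  from measurable_compose[OF random[of k] borel_measurable_continuous_onI[OF this]] show ?thesis .
qed

lemma constr_integrable:
  assumes Y: "sq_integrable P Y" and l: "sq_integrable P l"
  shows "integrable P (\<lambda>w. constr (Y w) (l w))"
proof -
  have "sq_integrable P (\<lambda>w. A *v Y w - b)"
    using P.finite_measure_axioms
    by (intro sq_integrable_diff sq_integrable_linear[OF matrix_vector_mul_bounded_linear Y] sq_integrable_const)
  from sq_integrable_inner[OF this l] sq_integrableD(2)[OF this] show ?thesis unfolding constr_def by auto
qed

lemma constr_lower: "constr y l \<ge> - (1 / (2 * \<beta>) * (norm l)^2)"
  using inner_young[OF beta_pos, of "A *v y - b" l] unfolding constr_def by linarith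

text \<open>The right-hand side is known before the block update. Since \<open>sm i \<ge> 1\<close>,
  the proximal term gives half of the squared step; Young's inequality spends a quarter on the
  gradient term.\<close>

lemma block_step_bound:
  assumes w: "w \<in> space P" and i: "i \<in> {1..<N}"
  shows "r i (block c i (x (Suc k) w)) + 1 / 4 * (norm (d k i w))^2
    \<le> r i (block c i (x k w)) + constr (xh k i w) (lam k w) + (norm (est k i w))^2
      + 1 / (2 * \<beta>) * (norm (lam k w))^2"
proof -
  have "L^2 / \<beta> \<ge> 0" using beta_pos by simp
  then have "sm i \<ge> 1" using H_eigen(1)[OF i] L by simp
  then have "1 * (norm (d k i w))^2 \<le> sm i * (norm (d k i w))^2" by (intro mult_right_mono) auto
  then have "d k i w \<bullet> (H i *v d k i w) \<ge> (norm (d k i w))^2" using H_eigen(2)[OF i d_mem, of k w] by linarith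
  moreover have "est k i w \<bullet> d k i w \<ge> - ((norm (est k i w))^2) - 1 / 4 * (norm (d k i w))^2"
    using inner_young[of 2 "est k i w" "d k i w"] by simp
  ultimately show ?thesis
    using block_step[OF w i, of k] constr_lower[of "lam k w" "xh k (Suc i) w"] by linarith
qed

lemma xh_measurable: "xh k i \<in> borel_measurable P"
proof -
  have "(\<lambda>w. block c j (x l w)) \<in> borel_measurable P" for j l
    using random borel_measurable_continuous_onI[OF linear_continuous_on[OF bounded_linear_block[of c j], of UNIV]]
    by (rule measurable_compose)
  then have "(\<lambda>w. \<Sum>j=1..N. block c j (xh k i w)) \<in> borel_measurable P"
    unfolding block_xh by (intro borel_measurable_sum)
  then show ?thesis using sum_block[OF blocks'] by simp
qed

lemma d_measurable: "d k i \<in> borel_measurable P"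
proof -
  have "(\<lambda>w. xh k (Suc i) w - xh k i w) \<in> borel_measurable P"
    by (intro borel_measurable_diff xh_measurable)
  then show ?thesis by (simp add: xh_Suc)
qed

lemma est_sq:
  assumes i: "i \<in> {1..N}" and xh: "sq_integrable P (xh k i)"
  shows "sq_integrable P (est k i)"
proof -
  have "sq_integrable P (\<lambda>w. block c i (gradf (xh k i w)))"
    by (rule sq_integrable_linear[OF bounded_linear_block
          sq_integrable_lipschitz[OF P.finite_measure_axioms grad_Lipschitz xh]])
  from sq_integrable_add[OF err_sq[OF i, of k] this] show ?thesis by (simp add: err_def)
qed

text \<open>The step bound controls \<open>r i\<close> at the new block and the squared step
  together. As \<open>rstar\<close> bounds the former from below, each of the two is controlled
  separately by the integrable \<open>R\<close>.\<close>

lemma sweep_integrable: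
  assumes x: "sq_integrable P (x k)" and lam: "sq_integrable P (lam k)"
    and r: "\<And>i. i \<in> {1..<N} \<Longrightarrow> integrable P (\<lambda>w. r i (block c i (x k w)))" and n: "n < N"
  shows "sq_integrable P (xh k (Suc n)) \<and>
    (\<forall>i\<in>{1..n}. integrable P (\<lambda>w. r i (block c i (x (Suc k) w))))"
  using n
proof (induction n)
  case 0
  then show ?case using x by (simp add: xh_1[abs_def])
next
  case (Suc n)
  define i where "i = Suc n"
  have i: "i \<in> {1..<N}" and i': "i \<in> {1..N}" using Suc.prems by (auto simp: i_def)
  have xh: "sq_integrable P (xh k i)" using Suc by (simp add: i_def)
  define R where "R w = r i (block c i (x k w)) + constr (xh k i w) (lam k w) + (norm (est k i w))^2
      + 1 / (2 * \<beta>) * (norm (lam k w))^2" for w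
  have R: "integrable P R"
    unfolding R_def using sq_integrableD(2)[OF est_sq[OF i' xh]] sq_integrableD(2)[OF lam]
    by (intro Bochner_Integration.integrable_add r[OF i] constr_integrable[OF xh lam] integrable_mult_right)
  have le: "r i (block c i (x (Suc k) w)) + 1 / 4 * (norm (d k i w))^2 \<le> R w"
    "rstar i \<le> r i (block c i (x (Suc k) w))" if "w \<in> space P" for w
    using block_step_bound[OF that i, of k] rstar_le[OF that i, of "Suc k"] by (auto simp: R_def)
  have "sq_integrable P (d k i)"
  proof (rule sq_integrable_bound)
    show "integrable P (\<lambda>w. 4 * (R w - rstar i))" using R by auto
    show "(norm (d k i w))^2 \<le> 4 * (R w - rstar i)" if "w \<in> space P" for w
      using le[OF that] by (simp add: right_diff_distrib)
  qed (rule d_measurable)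
  from sq_integrable_add[OF xh this]
  have 1: "sq_integrable P (xh k (Suc i))" by (simp add: xh_Suc[abs_def])
  have 2: "integrable P (\<lambda>w. r i (block c i (x (Suc k) w)))"
  proof (rule integrable_between)
    show "integrable P (\<lambda>w. rstar i)" by simp
    show "rstar i \<le> r i (block c i (x (Suc k) w)) \<and> r i (block c i (x (Suc k) w)) \<le> R w"
      if "w \<in> space P" for w
    proof -
      have "(norm (d k i w))^2 \<ge> 0" by simp
      then show ?thesis using le[OF that] by linarith
    qed
  qed (use R r_measurable[OF i] in auto)
  have "{1..Suc n} = insert i {1..n}" by (auto simp: i_def)
  then show ?case using 1 2 Suc by (simp add: i_def)
qed

text \<open>The three claims need each other: the sweep uses the multiplier and the old values of
  \<open>r\<close>, and the new multiplier uses the new iterate.\<close>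

lemma run_integrable:
  "sq_integrable P (x k) \<and> sq_integrable P (lam k) \<and> (\<forall>i\<in>{1..<N}. integrable P (\<lambda>w. r i (block c i (x k w))))"
proof (induction k)
  case 0
  have "sq_integrable P (x 0)"
    by (rule sq_integrable_bound[where q = "\<lambda>_. (norm x0)^2"]) (use init random in auto)
  moreover have "sq_integrable P (lam 0)"
  proof (rule sq_integrable_bound[where q = "\<lambda>_. (norm lam0)^2"])
    have "(\<lambda>_. lam0) \<in> borel_measurable P" by simp
    then show "lam 0 \<in> borel_measurable P"
      by (rule measurable_cong[THEN iffD1, rotated]) (use init in auto)
  qed (use init in auto)
  moreover have "integrable P (\<lambda>w. r i (block c i (x 0 w)))" for i
  proof -
    have "integrable P (\<lambda>w. r i (block c i x0))" by simp
    then show ?thesis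
      by (rule Bochner_Integration.integrable_cong[THEN iffD1, rotated 2]) (use init in auto)
  qed
  ultimately show ?case by blast
next
  case (Suc k)
  obtain n where n: "N = Suc n" "n < N" using N by (cases N) auto
  have N': "N \<in> {1..N}" using N by simp
  note x = Suc.IH[THEN conjunct1] and lam = Suc.IH[THEN conjunct2, THEN conjunct1]
  have r: "integrable P (\<lambda>w. r i (block c i (x k w)))" if "i \<in> {1..<N}" for i using Suc.IH that by blast
  note sw = sweep_integrable[OF x lam r n(2)]
  have xh: "sq_integrable P (xh k N)" using sw n by simp
  define s where "s w = - (\<gamma> *\<^sub>R (last_block e (est k N w) - lam k w + \<beta> *\<^sub>R (A *v xh k N w - b)))" for w
  have "sq_integrable P (\<lambda>w. (- \<gamma>) *\<^sub>R (last_block e (est k N w) - lam k w + \<beta> *\<^sub>R (A *v xh k N w - b)))"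
    using P.finite_measure_axioms
    by (intro sq_integrable_scaleR sq_integrable_add sq_integrable_diff lam sq_integrable_const
        sq_integrable_linear[OF bounded_linear_last_block est_sq[OF N' xh]]
        sq_integrable_linear[OF matrix_vector_mul_bounded_linear xh])
  then have s: "sq_integrable P s" by (simp add: s_def[abs_def])
  have "sq_integrable P (d k N)"
  proof (rule sq_integrable_bound[OF d_measurable sq_integrableD(2)[OF s]])
    fix w assume "w \<in> space P"
    then show "(norm (d k N w))^2 \<le> (norm (s w))^2"
      unfolding norm_last_d[symmetric] s_def by (simp only: last_step)
  qed
  from sq_integrable_add[OF xh this] have x': "sq_integrable P (x (Suc k))"
    by (simp add: xh_Suc[symmetric] xh_last)
  have lam'': "sq_integrable P (\<lambda>w. lam k w - \<beta> *\<^sub>R (A *v x (Suc k) w - b))"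
    using P.finite_measure_axioms
    by (intro sq_integrable_scaleR sq_integrable_diff lam sq_integrable_const
        sq_integrable_linear[OF matrix_vector_mul_bounded_linear x'])
  \<comment> \<open>Measurability of the multiplier is inherited from the recursion, which holds on
    \<open>space P\<close>.\<close>
  have lam': "sq_integrable P (lam (Suc k))"
  proof (rule sq_integrable_bound[OF _ sq_integrableD(2)[OF lam'']])
    show "lam (Suc k) \<in> borel_measurable P"
      by (rule measurable_cong[THEN iffD1, OF _ sq_integrableD(1)[OF lam'']]) (simp only: lam_step)
  qed (simp only: lam_step)
  have "{1..<N} = {1..n}" using n by auto
  then show ?case using x' lam' sw by auto
qed

lemma x_sq: "sq_integrable P (x k)" and lam_sq: "sq_integrable P (lam k)"
  using run_integrable by auto

lemma step_integrable: "integrable P (\<lambda>w. (norm (x (Suc k) w - x k w))^2)"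
  using sq_integrableD(2)[OF sq_integrable_diff[OF x_sq x_sq]] .

lemma pot_integrable: "integrable P (pot k)"
proof -
  have cont: "continuous_on UNIV f"
    using grad unfolding gderiv_def by (meson continuous_at_imp_continuous_on has_derivative_continuous)
  have f: "integrable P (\<lambda>w. f (x (Suc k) w))"
  proof (rule integrable_between)
    have i: "integrable P (\<lambda>w. gradf 0 \<bullet> x (Suc k) w)" "integrable P (\<lambda>w. L / 2 * (norm (x (Suc k) w))^2)"
      using sq_integrable_inner[OF sq_integrable_const[OF P.finite_measure_axioms] x_sq]
        sq_integrableD(2)[OF x_sq] by auto
    show "integrable P (\<lambda>w. f 0 + gradf 0 \<bullet> x (Suc k) w - L / 2 * (norm (x (Suc k) w))^2)"
      "integrable P (\<lambda>w. f 0 + gradf 0 \<bullet> x (Suc k) w + L / 2 * (norm (x (Suc k) w))^2)"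
      using i by auto
    show "(\<lambda>w. f (x (Suc k) w)) \<in> borel_measurable P"
      by (rule measurable_compose[OF random borel_measurable_continuous_onI[OF cont]])
    show "f 0 + gradf 0 \<bullet> x (Suc k) w - L / 2 * (norm (x (Suc k) w))^2 \<le> f (x (Suc k) w) \<and>
        f (x (Suc k) w) \<le> f 0 + gradf 0 \<bullet> x (Suc k) w + L / 2 * (norm (x (Suc k) w))^2" for w
      using descent_abs[OF grad grad_Lipschitz, of "x (Suc k) w" 0]
      unfolding diff_0_right abs_le_iff by (intro conjI) linarith+
  qed
  have "sq_integrable P (d k N)"
    unfolding d_def[abs_def] by (intro sq_integrable_linear[OF bounded_linear_block] sq_integrable_diff x_sq)
  from sq_integrableD(2)[OF this] f constr_integrable[OF x_sq lam_sq, of "Suc k" "Suc k"] run_integrable[of "Suc k"]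
  show ?thesis unfolding pot_eq[abs_def] AL_eq
    by (intro Bochner_Integration.integrable_add integrable_mult_right Bochner_Integration.integrable_sum) auto
qed

section \<open>Expected descent of the potential\<close>

definition step :: "nat \<Rightarrow> real" where
  "step k = P.expectation (\<lambda>w. (norm (x (Suc k) w - x k w))^2)"

text \<open>The \<open>N\<close> errors with weight one half give \<open>real N / 2\<close>; the
  error difference gives \<open>4 / \<beta>\<close> times the factor 2 from orthogonality. Together
  they form the bracket in \<kappa>4.\<close>

lemma pot_descent_expectation:
  assumes t1: "t \<le> - ((\<beta> + L) / 2 - 1 / \<gamma> + 8 / \<beta> * (\<beta> - 1 / \<gamma>)^2 + 4 * L^2 / \<beta> + 1 / 2)"
    and t2: "\<And>i. i \<in> {1..<N} \<Longrightarrow> t \<le> - (4 * L^2 / \<beta> + (L + 1) / 2 - sm i / 2)"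
  shows "P.expectation (pot (Suc k)) \<le> P.expectation (pot k) - t * step (Suc k)
    + (8 / \<beta> + real N / 2) * (\<sigma>^2 / real M)"
proof -
  have N': "N \<in> {1..N}" using N by simp
  have i1: "integrable P (\<lambda>w. (norm (err (Suc k) i w))^2)" if "i \<in> {1..N}" for i
    using sq_integrableD(2)[OF err_sq[OF that]] .
  have i2: "integrable P (\<lambda>w. (norm (err (Suc k) N w - err k N w))^2)"
    using sq_integrableD(2)[OF sq_integrable_diff[OF err_sq[OF N'] err_sq[OF N']]] .
  have i3: "integrable P (\<lambda>w. \<Sum>i=1..N. (norm (err (Suc k) i w))^2)"
    by (intro Bochner_Integration.integrable_sum i1)
  have "P.expectation (pot (Suc k)) \<le> P.expectation (\<lambda>w. pot k w
      - t * (norm (x (Suc (Suc k)) w - x (Suc k) w))^2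
      + 1 / 2 * (\<Sum>i=1..N. (norm (err (Suc k) i w))^2) + 4 / \<beta> * (norm (err (Suc k) N w - err k N w))^2)"
    using i2 i3 pot_integrable step_integrable
    by (intro integral_mono_AE AE_I2 pot_descent t1 t2 pot_integrable) auto
  also have "\<dots> = P.expectation (pot k) - t * step (Suc k)
      + 1 / 2 * P.expectation (\<lambda>w. \<Sum>i=1..N. (norm (err (Suc k) i w))^2)
      + 4 / \<beta> * P.expectation (\<lambda>w. (norm (err (Suc k) N w - err k N w))^2)"
    using i2 i3 pot_integrable step_integrable by (simp add: step_def)
  also have "P.expectation (\<lambda>w. \<Sum>i=1..N. (norm (err (Suc k) i w))^2)
      = (\<Sum>i=1..N. P.expectation (\<lambda>w. (norm (err (Suc k) i w))^2))"
    by (rule Bochner_Integration.integral_sum) (rule i1)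
  finally have "P.expectation (pot (Suc k)) \<le> P.expectation (pot k) - t * step (Suc k)
      + 1 / 2 * (\<Sum>i=1..N. P.expectation (\<lambda>w. (norm (err (Suc k) i w))^2))
      + 4 / \<beta> * P.expectation (\<lambda>w. (norm (err (Suc k) N w - err k N w))^2)" .
  moreover have "(\<Sum>i=1..N. P.expectation (\<lambda>w. (norm (err (Suc k) i w))^2)) \<le> (\<Sum>i=1..N. \<sigma>^2 / real M)"
    by (intro sum_mono err_var)
  moreover have "4 / \<beta> * P.expectation (\<lambda>w. (norm (err (Suc k) N w - err k N w))^2) \<le> 4 / \<beta> * (2 * (\<sigma>^2 / real M))"
    using beta_pos by (intro mult_left_mono err_diff_var) auto
  moreover have "(8 / \<beta> + real N / 2) * (\<sigma>^2 / real M) = 1 / 2 * (\<Sum>i=1..N. \<sigma>^2 / real M) + 4 / \<beta> * (2 * (\<sigma>^2 / real M))"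
    by (simp add: distrib_right add_divide_distrib)
  ultimately show ?thesis by linarith
qed

lemma pot_lower_expectation:
  "P.expectation (pot k) \<ge> (\<Sum>i\<in>{1..<N}. rstar i) + fstar - 2 * \<sigma>^2 / \<beta>"
proof -
  have N': "N \<in> {1..N}" using N by simp
  note int = sq_integrableD(2)[OF err_sq[OF N', of k]]
  have "(\<Sum>i\<in>{1..<N}. rstar i) + fstar - 2 / \<beta> * P.expectation (\<lambda>w. (norm (err k N w))^2)
      = P.expectation (\<lambda>w. (\<Sum>i\<in>{1..<N}. rstar i) + fstar - 2 / \<beta> * (norm (err k N w))^2)"
    using int by (simp add: P.prob_space)
  also have "\<dots> \<le> P.expectation (pot k)"
    using int by (intro integral_mono_AE AE_I2 pot_lower pot_integrable) auto
  finally have "(\<Sum>i\<in>{1..<N}. rstar i) + fstar - 2 / \<beta> * P.expectation (\<lambda>w. (norm (err k N w))^2)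
      \<le> P.expectation (pot k)" .
  moreover have "2 / \<beta> * P.expectation (\<lambda>w. (norm (err k N w))^2) \<le> 2 / \<beta> * \<sigma>^2"
  proof (rule mult_left_mono)
    \<comment> \<open>The factor \<open>1 / M\<close> is given up here, in accordance with the term
      \<open>2 * \<sigma>^2 / \<beta>\<close> in \<open>K\<close>.\<close>
    have "\<sigma>^2 / real M \<le> \<sigma>^2 / 1" using M_pos by (intro divide_left_mono) auto
    then show "P.expectation (\<lambda>w. (norm (err k N w))^2) \<le> \<sigma>^2" using err_var[OF N', of k] by simp
  qed (use beta_pos in simp)
  ultimately show ?thesis by simp
qed

text \<open>Telescoping from \<open>pot 0\<close>. The sum begins with \<open>step 1\<close>, since
  passing from \<open>pot 0\<close> to \<open>pot 1\<close> pays for that step.\<close>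

lemma sum_steps:
  assumes t1: "t \<le> - ((\<beta> + L) / 2 - 1 / \<gamma> + 8 / \<beta> * (\<beta> - 1 / \<gamma>)^2 + 4 * L^2 / \<beta> + 1 / 2)"
    and t2: "\<And>i. i \<in> {1..<N} \<Longrightarrow> t \<le> - (4 * L^2 / \<beta> + (L + 1) / 2 - sm i / 2)"
  shows "t * (\<Sum>k=1..n. step k) \<le> P.expectation (pot 0) - (\<Sum>i\<in>{1..<N}. rstar i) - fstar + 2 * \<sigma>^2 / \<beta>
    + real n * ((8 / \<beta> + real N / 2) * (\<sigma>^2 / real M))"
proof -
  have "t * (\<Sum>k=1..n. step k) \<le> P.expectation (pot 0) - P.expectation (pot n)
    + real n * ((8 / \<beta> + real N / 2) * (\<sigma>^2 / real M))"
  proof (induction n)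
    case (Suc n)
    define C where "C = (8 / \<beta> + real N / 2) * (\<sigma>^2 / real M)"
    have "real (Suc n) * C = real n * C + C" "t * (\<Sum>k=1..Suc n. step k) = t * (\<Sum>k=1..n. step k) + t * step (Suc n)"
      by (simp_all add: distrib_left distrib_right)
    then show ?case using Suc pot_descent_expectation[OF t1 t2, of n] unfolding C_def[symmetric] by linarith
  qed simp
  then show ?thesis using pot_lower_expectation[of n] by simp
qed

end

theorem theorem3p14:
  fixes N :: nat
    and c :: "'n::finite \<Rightarrow> nat"
    and e :: "'m::finite \<Rightarrow> 'n"
    and A :: "real^'n^'m"
    and b :: "real^'m"
    and f :: "real^'n \<Rightarrow> real"
    and gradf :: "real^'n \<Rightarrow> real^'n"
    and L \<sigma> \<beta> \<gamma> \<epsilon> \<Delta> \<kappa>1 \<kappa>2 \<kappa>3 \<kappa>4 \<tau> fstar :: real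
    and r :: "nat \<Rightarrow> real^'n \<Rightarrow> real"
    and rstar :: "nat \<Rightarrow> real"
    and \<M> X :: "nat \<Rightarrow> (real^'n) set"
    and D :: "nat \<Rightarrow> 's measure"
    and G :: "nat \<Rightarrow> real^'n \<Rightarrow> 's \<Rightarrow> real^'n"
    and H :: "nat \<Rightarrow> real^'n^'n"
    and M K kstar :: nat
    and P :: "'w measure"
    and \<xi> :: "nat \<Rightarrow> nat \<Rightarrow> nat \<Rightarrow> 'w \<Rightarrow> 's"
    and x :: "nat \<Rightarrow> 'w \<Rightarrow> real^'n"
    and lam :: "nat \<Rightarrow> 'w \<Rightarrow> real^'m"
    and x0 :: "real^'n"
    and lam0 :: "real^'m"
  (* problem (P) *)
  assumes N: "N \<ge> 2"
    and blocks: "range c = {1..N}"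
    and last_block_coords: "bij_betw e UNIV {j. c j = N}"
    and A_N: "\<And>k l. A $ k $ (e l) = (if k = l then 1 else 0)"
    and L: "L > 0"
    and grad: "\<And>y. GDERIV f y :> gradf y"
    and grad_Lipschitz: "L-lipschitz_on UNIV gradf"
    and r_convex: "\<And>i. i \<in> {1..<N} \<Longrightarrow> convex_on (block_space c i) (r i)"
    and r_Lipschitz: "\<And>i. i \<in> {1..<N} \<Longrightarrow> locally_Lipschitz_on (block_space c i) (r i)"
    and manifold: "\<And>i. i \<in> {1..<N} \<Longrightarrow> \<M> i \<subseteq> block_space c i \<and> embedded_submanifold (\<M> i)"
    and X: "\<And>i. i \<in> {1..<N} \<Longrightarrow> X i \<subseteq> block_space c i \<and> closed (X i) \<and> convex (X i)"
    and r_bdd: "\<And>i. i \<in> {1..<N} \<Longrightarrow> bdd_below (r i ` (\<M> i \<inter> X i))"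
    and rstar: "\<And>i. i \<in> {1..<N} \<Longrightarrow> rstar i = Inf (r i ` (\<M> i \<inter> X i))"
    and f_bdd: "bdd_below (f ` {y. \<forall>i\<in>{1..<N}. block c i y \<in> \<M> i \<inter> X i})"
    and fstar: "fstar = Inf (f ` {y. \<forall>i\<in>{1..<N}. block c i y \<in> \<M> i \<inter> X i})"
  (* stochastic oracle and algorithm *)
    and P: "prob_space P"
    and unbiased: "stochastic_oracle N c gradf D G \<sigma>"
    and random: "\<And>k. x k \<in> borel_measurable P"
    and samples: "fresh_samples P N c D M \<xi> x"
    and H_block: "\<And>i. i \<in> {1..<N} \<Longrightarrow> block_matrix c i (H i) \<and> transpose (H i) = H i"
    and x0: "\<And>i. i \<in> {1..<N} \<Longrightarrow> block c i x0 \<in> \<M> i \<inter> X i"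
    and init: "\<And>\<omega>. \<omega> \<in> space P \<Longrightarrow> x 0 \<omega> = x0 \<and> lam 0 \<omega> = lam0"
    and alg: "\<And>\<omega>. \<omega> \<in> space P \<Longrightarrow>
           stochastic_admm N c e A b f r \<M> X G \<beta> \<gamma> H M
             (\<lambda>k i q. \<xi> k i q \<omega>) (\<lambda>k. x k \<omega>) (\<lambda>k. lam k \<omega>)"
  (* parameters *)
    and Delta: "\<Delta> = 17 * \<beta>\<^sup>2 - 16 * (L + 1) * \<beta> - 128 * L\<^sup>2"
    and beta: "\<beta> > (8 * (L + 1) + 8 * sqrt ((L + 1)\<^sup>2 + 34 * L\<^sup>2)) / 17"
    and gamma: "\<gamma> \<in> {16 / (17 * \<beta> + sqrt \<Delta>) <..< 16 / (17 * \<beta> - sqrt \<Delta>)}"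
    and H_bound: "\<And>i. i \<in> {1..<N} \<Longrightarrow>
           succ_scaled_id (block_space c i) (H i) (8 * L\<^sup>2 / \<beta> + L + 1)"
    and kappa1: "\<kappa>1 = 4 / \<beta>\<^sup>2 * ((\<beta> - 1 / \<gamma>)\<^sup>2 + L\<^sup>2)"
    and kappa2: "\<kappa>2 = 3 * ((\<beta> - 1 / \<gamma>)\<^sup>2 + L\<^sup>2)"
    and kappa3: "\<kappa>3 = 2 * (L
           + \<beta> * sqrt (real N) * Max ((\<lambda>i. (spectral_norm (block_cols c i A))\<^sup>2) ` {1..N})
           + Max ((\<lambda>i. spectral_norm (H i)) ` {1..<N}))\<^sup>2"
    and tau: "\<tau> = min
           (- ((\<beta> + L) / 2 - 1 / \<gamma> + 8 / \<beta> * (\<beta> - 1 / \<gamma>)\<^sup>2 + 4 * L\<^sup>2 / \<beta> + 1 / 2))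
           (Min ((\<lambda>i. - (4 * L\<^sup>2 / \<beta> + (L + 1) / 2 - sigma_min (block_space c i) (H i) / 2))
                  ` {1..<N}))"
    and kappa4: "\<kappa>4 = 2 / \<tau> * (8 / \<beta> + real N / 2)"
    and eps: "\<epsilon> > 0"
    and M_pos: "M \<ge> 1"
    and M: "real M \<ge> 2 * \<sigma>\<^sup>2 / \<epsilon>\<^sup>2
           * Max {\<kappa>1 * \<kappa>4 + 8 / \<beta>\<^sup>2, \<kappa>2 * \<kappa>4 + 3, \<kappa>3 * \<kappa>4 + 2}"
    and K: "K = nat \<lceil>4 * Max {\<kappa>1, \<kappa>2, \<kappa>3} / (\<tau> * \<epsilon>\<^sup>2)
           * (prob_space.expectation P
                (\<lambda>\<omega>. potential N c e A b f r L \<beta> \<gamma> (x 1 \<omega>) (lam 1 \<omega>) (last_block e (x 0 \<omega>)))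
              - (\<Sum>i\<in>{1..<N}. rstar i) - fstar + 2 * \<sigma>\<^sup>2 / \<beta>)\<rceil>"
    and kstar: "is_arg_min
           (\<lambda>k. prob_space.expectation P (\<lambda>\<omega>. \<Sum>i=1..N.
              (norm (block c i (x k \<omega>) - block c i (x (k + 1) \<omega>)))\<^sup>2
              + (norm (block c i (x (k - 1) \<omega>) - block c i (x k \<omega>)))\<^sup>2))
           (\<lambda>k. k \<in> {2..K + 1}) kstar"
  shows "eps_stationary_in_expectation P N c A b gradf r \<M> X \<epsilon> (x (kstar + 1)) (lam (kstar + 1))"
proof -
  note steps = admm_step_sizes[OF L Delta beta gamma]
  interpret stochastic_admm_run N c e A b f gradf L \<sigma> \<beta> \<gamma> fstar r rstar \<M> X D G H M P \<xi> x lam x0 lam0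
    by (rule stochastic_admm_run.intro) (fact N blocks last_block_coords A_N L grad grad_Lipschitz r_convex manifold r_bdd rstar
        f_bdd fstar P unbiased random samples H_block x0 init alg steps(2,3) H_bound M_pos)+
  interpret P: prob_space P by (rule P)
  define s where "s = \<sigma>^2 / real M"
  define Amax where "Amax = Max ((\<lambda>i. (spectral_norm (block_cols c i A))^2) ` {1..N})"
  define Hmax where "Hmax = Max ((\<lambda>i. spectral_norm (H i)) ` {1..<N})"
  define C where "C = L + \<beta> * sqrt (real N) * Amax + Hmax"
  define \<mu> where "\<mu> = Max {\<kappa>1, \<kappa>2, \<kappa>3}"
  define W where "W = P.expectation (pot 0) - (\<Sum>i\<in>{1..<N}. rstar i) - fstar + 2 * \<sigma>^2 / \<beta>"
  have N1: "1 \<in> {1..<N}" "N \<in> {1..N}" using N by auto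
  have \<beta>0: "\<beta> > 0" using steps(1) by simp
  have s0: "s \<ge> 0" by (simp add: s_def)
  \<comment> \<open>The square of \<open>16 / 17\<close>.\<close>
  have \<beta>2: "\<beta>^2 \<ge> 256 / 289"
    using power_mono[OF less_imp_le[OF steps(1)], of 2] by (simp add: power2_eq_square)

  have t1: "\<tau> \<le> - ((\<beta> + L) / 2 - 1 / \<gamma> + 8 / \<beta> * (\<beta> - 1 / \<gamma>)^2 + 4 * L^2 / \<beta> + 1 / 2)"
    unfolding tau by (rule min.cobounded1)
  have t2: "\<tau> \<le> - (4 * L^2 / \<beta> + (L + 1) / 2 - sm i / 2)" if "i \<in> {1..<N}" for i
    unfolding tau using that by (intro min.coboundedI2 Min_le) auto
  have "0 < - (4 * L^2 / \<beta> + (L + 1) / 2 - sm i / 2)" if "i \<in> {1..<N}" for i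
  proof -
    have "0 < - (u + (L + 1) / 2 - v / 2)" if "2 * u + L + 1 < v" for u v using that by (simp add: field_simps)
    from this[of "4 * L^2 / \<beta>" "sm i"] show ?thesis using H_eigen(1)[OF that] by simp
  qed
  then have "Min ((\<lambda>i. - (4 * L^2 / \<beta> + (L + 1) / 2 - sm i / 2)) ` {1..<N}) > 0"
    using N1(1) by (subst Min_gr_iff) blast+
  then have \<tau>0: "\<tau> > 0"
    unfolding tau min_less_iff_conj neg_0_less_iff_less using steps(4) by blast
  have \<tau>\<beta>: "\<tau> \<le> \<beta>" using t1 steps(5) by simp

  have Amax: "(spectral_norm (block_cols c j A))^2 \<le> Amax" if "j \<in> {1..N}" for j
    unfolding Amax_def using that by (intro Max_ge) auto
  have "1 \<le> (spectral_norm (block_cols c N A))^2"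
    using spectral_norm_last_block[OF last_block_coords A_N] by simp
  then have Amax1: "Amax \<ge> 1" using Amax[OF N1(2)] by simp
  have Hmax: "spectral_norm (H i) \<le> Hmax" if "i \<in> {1..<N}" for i
    unfolding Hmax_def using that by (intro Max_ge) auto
  then have Hmax0: "Hmax \<ge> 0" using spectral_norm_nonneg[of "H 1"] N1(1) order_trans by blast

  have \<kappa>3: "\<kappa>3 = 2 * C^2" unfolding kappa3 C_def Amax_def Hmax_def ..
  \<comment> \<open>From \<open>N \<ge> 2\<close> and \<open>Amax \<ge> 1\<close> the penalty part
    of \<open>C\<close> alone is at least \<open>\<beta> * sqrt 2\<close>.\<close>
  have \<kappa>3_ge: "\<kappa>3 \<ge> 4 * \<beta>^2"
  proof -
    have "\<beta> * sqrt 2 * 1 \<le> \<beta> * sqrt (real N) * Amax"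
      using N Amax1 \<beta>0 by (intro mult_mono) auto
    then have "\<beta> * sqrt 2 \<le> C" unfolding C_def using L Hmax0 by simp
    then have "(\<beta> * sqrt 2)^2 \<le> C^2" using \<beta>0 by (intro power_mono) auto
    then show ?thesis unfolding \<kappa>3 by (simp add: power_mult_distrib)
  qed
  have \<kappa>3_pos: "\<kappa>3 > 0" using \<kappa>3_ge \<beta>2 by simp
  define B2 where "B2 = (\<beta> - 1 / \<gamma>)^2 + L^2"
  have B2: "64 * B2 \<le> 9 * \<beta>^2" "B2 \<ge> 0" using steps(6) by (auto simp only: B2_def) simp
  have \<kappa>2: "9 * \<kappa>2 \<le> \<kappa>3" "\<kappa>2 \<ge> 0"
    using \<kappa>3_ge B2 unfolding kappa2 B2_def[symmetric] by linarith+
  have \<kappa>1: "6 * \<kappa>1 \<le> \<kappa>3" "\<kappa>1 \<ge> 0"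
  proof -
    have "\<kappa>1 \<le> 4 / \<beta>^2 * (9 / 64 * \<beta>^2)"
      unfolding kappa1 B2_def[symmetric] using B2 by (intro mult_left_mono) auto
    \<comment> \<open>Six times this is \<open>27 / 8\<close>, which is below
      \<open>4 * (256 / 289)\<close>.\<close>
    then have "\<kappa>1 \<le> 9 / 16" using \<beta>0 by simp
    then show "6 * \<kappa>1 \<le> \<kappa>3" using \<kappa>3_ge \<beta>2 by linarith
    show "\<kappa>1 \<ge> 0" unfolding kappa1 by simp
  qed
  have \<kappa>34: "\<kappa>3 * \<kappa>4 \<ge> 64"
  proof -
    \<comment> \<open>Because \<tau> is at most \<beta>, the constant \<kappa>4 is at least
      \<open>16 / \<beta>^2\<close>, which cancels against \<open>4 * \<beta>^2\<close>.\<close>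
    have "2 / \<beta> * (8 / \<beta>) \<le> \<kappa>4"
      unfolding kappa4 using \<tau>0 \<tau>\<beta> \<beta>0 by (intro mult_mono divide_left_mono) auto
    then have "(4 * \<beta>^2) * (2 / \<beta> * (8 / \<beta>)) \<le> \<kappa>3 * \<kappa>4"
      using \<kappa>3_ge \<kappa>3_pos \<beta>0 by (intro mult_mono) auto
    then show ?thesis using \<beta>0 by (simp add: power2_eq_square)
  qed
  have noise: "2 * (\<kappa>3 * \<kappa>4 + 2) * s \<le> \<epsilon>^2"
  proof -
    have "2 * \<sigma>^2 / \<epsilon>^2 * (\<kappa>3 * \<kappa>4 + 2)
        \<le> 2 * \<sigma>^2 / \<epsilon>^2 * Max {\<kappa>1 * \<kappa>4 + 8 / \<beta>^2, \<kappa>2 * \<kappa>4 + 3, \<kappa>3 * \<kappa>4 + 2}"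
      by (intro mult_left_mono Max_ge) auto
    with M have "2 * \<sigma>^2 / \<epsilon>^2 * (\<kappa>3 * \<kappa>4 + 2) \<le> real M" by linarith
    then show ?thesis using eps M_pos by (simp add: s_def field_simps)
  qed
  \<comment> \<open>132 is twice \<open>64 + 2\<close>.\<close>
  have "132 * s \<le> 2 * (\<kappa>3 * \<kappa>4 + 2) * s" using \<kappa>34 s0 by (intro mult_right_mono) auto
  then have s_le: "132 * s \<le> \<epsilon>^2" using noise by linarith

  have kstar': "kstar \<in> {2..K + 1}" using kstar by (simp add: is_arg_min_def)
  \<comment> \<open>An argmin over an empty range is impossible, which excludes
    \<open>K = 0\<close>.\<close>
  then have K1: "K \<ge> 1" by simp
  define \<theta> where "\<theta> k = step k + step (k - 1)" for k
  have obj: "P.expectation (\<lambda>w. \<Sum>i=1..N.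
              (norm (block c i (x k w) - block c i (x (k + 1) w)))^2
              + (norm (block c i (x (k - 1) w) - block c i (x k w)))^2) = \<theta> k" if "k \<ge> 1" for k
  proof -
    obtain k' where k: "k = Suc k'" using \<open>k \<ge> 1\<close> by (cases k) auto
    have sum: "(\<Sum>i=1..N. (norm (block c i u - block c i v))^2) = (norm (v - u))^2" for u v
      using sum_norm_block[OF blocks', of "u - v"] by (simp add: block_simps norm_minus_commute)
    have "(\<lambda>w. \<Sum>i=1..N. (norm (block c i (x k w) - block c i (x (k + 1) w)))^2
              + (norm (block c i (x (k - 1) w) - block c i (x k w)))^2)
        = (\<lambda>w. (norm (x (Suc k) w - x k w))^2 + (norm (x (Suc k') w - x k' w))^2)"
      unfolding sum.distrib sum k by simp
    then show ?thesis unfolding \<theta>_def step_def using step_integrable by (simp add: k)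
  qed
  have \<theta>_min: "\<theta> kstar \<le> \<theta> k" if "k \<in> {2..K + 1}" for k
    using kstar that kstar' obj[of k] obj[of kstar] unfolding is_arg_min_def by (auto simp: not_less)
  have step0: "step k \<ge> 0" for k unfolding step_def by (intro integral_nonneg_AE AE_I2) simp

  \<comment> \<open>Each step occurs in at most two consecutive values of \<theta>; the indices
    involved are 1 up to \<open>K + 1\<close>, one more than the number of averaged terms.\<close>
  have \<theta>_sum: "real K * \<theta> kstar \<le> 2 * (\<Sum>k=1..K+1. step k)"
  proof -
    have "real K * \<theta> kstar = (\<Sum>k=2..K+1. \<theta> kstar)" by simp
    also have "\<dots> \<le> (\<Sum>k=2..K+1. \<theta> k)" by (intro sum_mono \<theta>_min)
    also have "\<dots> = (\<Sum>k=2..K+1. step k) + (\<Sum>k=2..K+1. step (k - 1))" by (simp add: \<theta>_def sum.distrib)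
    also have "(\<Sum>k=2..K+1. step (k - 1)) = (\<Sum>k=1..K. step k)"
      by (rule sum.reindex_bij_witness[of _ Suc "\<lambda>k. k - 1"]) auto
    also have "(\<Sum>k=2..K+1. step k) + (\<Sum>k=1..K. step k) \<le> (\<Sum>k=1..K+1. step k) + (\<Sum>k=1..K+1. step k)"
      using step0 by (intro add_mono sum_mono2) auto
    finally show ?thesis by simp
  qed
  \<comment> \<open>For negative \<open>W\<close> the function \<open>nat\<close> clips the ceiling,
    but then the inequality is trivial.\<close>
  have W_le: "4 * \<kappa>3 * W \<le> \<tau> * \<epsilon>^2 * real K"
  proof (cases "W \<ge> 0")
    case True
    have "4 * \<kappa>3 / (\<tau> * \<epsilon>^2) * W \<le> 4 * \<mu> / (\<tau> * \<epsilon>^2) * W"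
      using True \<tau>0 eps unfolding \<mu>_def by (intro mult_right_mono divide_right_mono) auto
    also have "\<dots> \<le> real K"
    proof -
      have "K = nat \<lceil>4 * \<mu> / (\<tau> * \<epsilon>^2) * W\<rceil>" unfolding K \<mu>_def W_def pot_def by simp
      then show ?thesis using real_nat_ceiling_ge by simp
    qed
    finally show ?thesis using \<tau>0 eps by (simp add: field_simps)
  next
    case False
    then have "4 * \<kappa>3 * W \<le> 0" using \<kappa>3_pos by (simp add: mult_le_0_iff)
    also have "0 \<le> \<tau> * \<epsilon>^2 * real K" using \<tau>0 by simp
    finally show ?thesis .
  qed
  \<comment> \<open>Bounding \<open>K + 1\<close> noise terms by \<open>2 * K\<close> doubles their
    share to \<open>2 * (\<kappa>3 * \<kappa>4 * s)\<close>, which \<open>noise\<close> bounds by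
    \<open>\<epsilon>^2 - 4 * s\<close>. The initial gap \<open>W\<close> contributes the remaining
    \<open>\<epsilon>^2 / 2\<close>.\<close>
  have \<theta>_le: "\<kappa>3 * \<theta> kstar \<le> 3 / 2 * \<epsilon>^2 - 4 * s"
  proof -
    define c0 where "c0 = (8 / \<beta> + real N / 2) * s"
    have c0: "c0 \<ge> 0" using s0 \<beta>0 by (simp add: c0_def)
    have \<kappa>4: "\<kappa>4 * s * \<tau> = 2 * c0" using \<tau>0 by (simp add: kappa4 c0_def)
    have "\<tau> * (\<Sum>k=1..K+1. step k) \<le> W + real (K + 1) * c0"
      using sum_steps[OF t1 t2, of "K + 1"] unfolding W_def c0_def s_def by simp
    also have "\<dots> \<le> W + real (2 * K) * c0" using K1 c0 by (intro add_mono mult_right_mono) auto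
    finally have "\<kappa>3 * (\<tau> * (\<Sum>k=1..K+1. step k)) \<le> \<kappa>3 * (W + 2 * real K * c0)"
      using \<kappa>3_pos by (intro mult_left_mono) auto
    moreover have "(\<kappa>3 * \<tau>) * (real K * \<theta> kstar) \<le> (\<kappa>3 * \<tau>) * (2 * (\<Sum>k=1..K+1. step k))"
      using \<theta>_sum \<kappa>3_pos \<tau>0 by (intro mult_left_mono) auto
    ultimately have "\<tau> * real K * (\<kappa>3 * \<theta> kstar) \<le> 2 * \<kappa>3 * W + 4 * real K * (\<kappa>3 * c0)"
      by (simp add: algebra_simps)
    also have "\<dots> \<le> 1 / 2 * (\<tau> * \<epsilon>^2 * real K) + 4 * real K * (\<kappa>3 * c0)" using W_le by simp
    also have "\<dots> = \<tau> * real K * (1 / 2 * \<epsilon>^2 + 2 * (\<kappa>3 * \<kappa>4 * s))"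
    proof -
      have "\<kappa>3 * c0 = \<kappa>3 * (\<kappa>4 * s * \<tau>) / 2" using \<kappa>4 by simp
      then show ?thesis by (auto simp: algebra_simps)
    qed
    finally have "\<kappa>3 * \<theta> kstar \<le> 1 / 2 * \<epsilon>^2 + 2 * (\<kappa>3 * \<kappa>4 * s)"
      using \<tau>0 K1 by simp
    then show ?thesis using noise by (simp add: algebra_simps)
  qed

  obtain k where k: "kstar = Suc k" using kstar' by (cases kstar) auto
  have \<theta>: "\<theta> kstar = step (Suc k) + step k" by (simp add: \<theta>_def k)
  have \<theta>0: "\<theta> kstar \<ge> 0" using step0 by (simp add: \<theta>)
  note si = step_integrable
  have ei: "integrable P (\<lambda>w. (norm (err (Suc k) i w))^2)" if "i \<in> {1..N}" for i
    using sq_integrableD(2)[OF err_sq[OF that]] .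
  have "6 * (\<kappa>1 * \<theta> kstar) \<le> \<kappa>3 * \<theta> kstar" "9 * (\<kappa>2 * \<theta> kstar) \<le> \<kappa>3 * \<theta> kstar"
    using mult_right_mono[OF \<kappa>1(1) \<theta>0] mult_right_mono[OF \<kappa>2(1) \<theta>0] by simp_all
  \<comment> \<open>The bound \<open>3 / 2 * \<epsilon>^2\<close> divided by 6 and by 9.\<close>
  then have \<kappa>1\<theta>: "\<kappa>1 * \<theta> kstar \<le> 1 / 4 * \<epsilon>^2" and \<kappa>2\<theta>: "\<kappa>2 * \<theta> kstar \<le> 1 / 6 * \<epsilon>^2"
    using \<theta>_le s0 by linarith+
  have kk: "kstar + 1 = Suc (Suc k)" using k by simp

  have feas: "block c i (x (kstar + 1) w) \<in> \<M> i \<inter> X i" if "w \<in> space P" "i \<in> {1..<N}" for w i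
    using feasible that by blast
  have last: "(\<integral>\<^sup>+w. ennreal (norm (block c N (gradf (x (kstar + 1) w))
      - transpose (block_cols c N A) *v lam (kstar + 1) w)) \<partial>P) \<le> ennreal \<epsilon>"
  proof -
    define h where "h w = block c N (gradf (x (kstar + 1) w)) - transpose (block_cols c N A) *v lam (kstar + 1) w" for w
    have hm: "sq_integrable P h"
      unfolding h_def[abs_def]
      by (intro sq_integrable_diff sq_integrable_linear[OF bounded_linear_block]
          sq_integrable_linear[OF matrix_vector_mul_bounded_linear lam_sq]
          sq_integrable_lipschitz[OF P.finite_measure_axioms grad_Lipschitz x_sq])
    define q where "q w = \<kappa>2 * (norm (x (Suc (Suc k)) w - x (Suc k) w))^2 + 3 * (norm (err (Suc k) N w))^2" for w
    have qi: "integrable P q" unfolding q_def using si ei[OF N1(2)] by auto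
    have "P.expectation q = \<kappa>2 * step (Suc k) + 3 * P.expectation (\<lambda>w. (norm (err (Suc k) N w))^2)"
      unfolding q_def step_def using si ei[OF N1(2)] by simp
    also have "\<dots> \<le> \<kappa>2 * \<theta> kstar + 3 * s"
      using err_var[OF N1(2), of "Suc k"] step0 \<kappa>2(2) unfolding \<theta> s_def
      by (intro add_mono mult_left_mono) auto
    also have "\<dots> \<le> \<epsilon>^2" using \<kappa>2\<theta> s_le s0 by linarith
    finally have qe: "P.expectation q \<le> \<epsilon>^2" .
    have hq: "(norm (h w))^2 \<le> q w" if "w \<in> space P" for w
    proof -
      have "(norm (d (Suc k) N w))^2 \<le> (norm (x (Suc (Suc k)) w - x (Suc k) w))^2"
        unfolding d_def by (intro power_mono norm_block_le) auto
      then have "\<kappa>2 * (norm (d (Suc k) N w))^2 \<le> \<kappa>2 * (norm (x (Suc (Suc k)) w - x (Suc k) w))^2"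
        using \<kappa>2(2) by (rule mult_left_mono)
      then show ?thesis
        using residual_last[OF that, of "Suc k"] unfolding h_def q_def kk kappa2[symmetric] by linarith
    qed
    have "upper_expectation P (\<lambda>w. norm (h w)) \<le> ennreal \<epsilon>"
      by (rule upper_expectation_le[OF P eps qi qe hq])
    then show ?thesis
      using upper_expectation_eq_nn_integral[of "\<lambda>w. norm (h w)" P] sq_integrableD(1)[OF hm]
      unfolding h_def by simp
  qed
  have constraint: "(\<integral>\<^sup>+w. ennreal (norm (A *v x (kstar + 1) w - b)) \<partial>P) \<le> ennreal \<epsilon>"
  proof -
    define h where "h w = A *v x (kstar + 1) w - b" for w
    have hm: "sq_integrable P h"
      unfolding h_def[abs_def] using P.finite_measure_axioms
      by (intro sq_integrable_diff sq_integrable_const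
          sq_integrable_linear[OF matrix_vector_mul_bounded_linear x_sq])
    have di: "integrable P (\<lambda>w. (norm (err (Suc k) N w - err k N w))^2)"
      using sq_integrableD(2)[OF sq_integrable_diff[OF err_sq[OF N1(2)] err_sq[OF N1(2)]]] .
    define q where "q w = 4 / \<beta>^2 * (norm (err (Suc k) N w - err k N w))^2
        + \<kappa>1 * ((norm (x (Suc (Suc k)) w - x (Suc k) w))^2 + (norm (x (Suc k) w - x k w))^2)" for w
    have qi: "integrable P q" unfolding q_def using si di by auto
    have "P.expectation q = 4 / \<beta>^2 * P.expectation (\<lambda>w. (norm (err (Suc k) N w - err k N w))^2) + \<kappa>1 * \<theta> kstar"
      unfolding q_def \<theta> step_def using si di by simp
    \<comment> \<open>\<open>289 / 64\<close> is 4 divided by the lower bound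
      \<open>256 / 289\<close> for \<open>\<beta>^2\<close>.\<close>
    moreover have "4 / \<beta>^2 * P.expectation (\<lambda>w. (norm (err (Suc k) N w - err k N w))^2) \<le> 289 / 64 * (2 * s)"
    proof (rule mult_mono)
      show "4 / \<beta>^2 \<le> 289 / 64" using \<beta>2 \<beta>0 by (simp add: field_simps)
      show "P.expectation (\<lambda>w. (norm (err (Suc k) N w - err k N w))^2) \<le> 2 * s"
        unfolding s_def by (rule err_diff_var)
    qed (auto intro!: integral_nonneg_AE)
    ultimately have qe: "P.expectation q \<le> \<epsilon>^2" using \<kappa>1\<theta> s_le s0 by linarith
    have hq: "(norm (h w))^2 \<le> q w" if "w \<in> space P" for w
      using residual_constraint[OF that, of k] unfolding h_def q_def kk kappa1 .
    have "upper_expectation P (\<lambda>w. norm (h w)) \<le> ennreal \<epsilon>"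
      by (rule upper_expectation_le[OF P eps qi qe hq])
    then show ?thesis
      using upper_expectation_eq_nn_integral[of "\<lambda>w. norm (h w)" P] sq_integrableD(1)[OF hm]
      unfolding h_def by simp
  qed
  have block: "upper_expectation P (block_residual (Suc k) i) \<le> ennreal \<epsilon>" if i: "i \<in> {1..<N}" for i
  proof -
    have i': "i \<in> {1..N}" using i by auto
    \<comment> \<open>Unequal Young weights: factor 2 on both squares would leave
      \<open>3 / 2 * \<epsilon>^2\<close> for the step. With \<open>5 / 4\<close> and 5, using
      \<open>C^2 = \<kappa>3 / 2\<close>, the step part is at most
      \<open>15 / 16 * \<epsilon>^2\<close>, and the smallness of \<open>s\<close> covers the
      rest.\<close>
    define q where "q w = 5 / 4 * C^2 * (norm (x (Suc (Suc k)) w - x (Suc k) w))^2 + 5 * (norm (err (Suc k) i w))^2" for w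
    have qi: "integrable P q" unfolding q_def using si ei[OF i'] by auto
    have "P.expectation q = 5 / 4 * C^2 * step (Suc k) + 5 * P.expectation (\<lambda>w. (norm (err (Suc k) i w))^2)"
      unfolding q_def step_def using si ei[OF i'] by simp
    also have "\<dots> \<le> 5 / 4 * C^2 * \<theta> kstar + 5 * s"
      using err_var[OF i', of "Suc k"] step0 unfolding \<theta> s_def by (intro add_mono mult_left_mono) auto
    also have "\<dots> = 5 / 8 * (\<kappa>3 * \<theta> kstar) + 5 * s" by (simp add: \<kappa>3)
    also have "\<dots> \<le> \<epsilon>^2" using \<theta>_le s_le s0 by linarith
    finally have qe: "P.expectation q \<le> \<epsilon>^2" .
    show ?thesis
    proof (rule upper_expectation_le[OF P eps qi qe])
      fix w assume w: "w \<in> space P"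
      define h where "h = block_residual (Suc k) i w"
      have "h \<le> C * norm (x (Suc (Suc k)) w - x (Suc k) w) + norm (err (Suc k) i w)"
        using residual_block[OF w i Amax Hmax[OF i], of "Suc k"] unfolding h_def C_def .
      moreover have "h \<ge> 0" by (simp add: h_def block_residual_def Let_def setdist_pos_le)
      ultimately have "h^2 \<le> (C * norm (x (Suc (Suc k)) w - x (Suc k) w) + norm (err (Suc k) i w))^2"
        by (intro power_mono)
      also have "\<dots> \<le> q w"
        using norm_add_sq_le[of "1 / 4" "C * norm (x (Suc (Suc k)) w - x (Suc k) w)" "norm (err (Suc k) i w)"]
        by (simp add: q_def power_mult_distrib)
      finally show "(block_residual (Suc k) i w)^2 \<le> q w" unfolding h_def .
    qed
  qed
  show ?thesis
    unfolding eps_stationary_in_expectation_def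
    using feas last constraint block unfolding block_residual_def[abs_def] kk by blast
qed

end
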